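(* There is a function $f:\mathbb{N}\to[0,\infty)$ with $f(\Delta)\to 0$ as $\Delta\to\infty$ such that the following holds. Let $\Delta=\Delta(n)$ be any function of $n$ and, for each $n$, let $H=H_n$ be an $n$-vertex graph with maximum degree $\Delta(n)$. Then, in the semirandom tree process on vertex set $[n]$, Builder has a strategy (which may depend on $H$) such that, with probability tending to $1$ as $n\to\infty$, after $$(1+f(\Delta))\frac{\Delta n}{2}$$ rounds (rounded up to an integer) the constructed graph contains a copy of $H$. Furthermore, the same statement holds (for some function $f$ with the same property) when the number of rounds is instead random with the Poisson distribution $\mathrm{Po}\left((1+f(\Delta))\frac{\Delta n}{2}\right)$.
   Context: The semirandom tree process on $[n]=\{1,\dots,n\}$: start with the empty graph $G_0$ on $[n]$. In each round $t=1,2,\dots$ a player called Builder is offered the edge set of a spanning tree $T_t$ chosen uniformly at random from all spanning trees of the complete graph on $[n]$, independently of all previous rounds; Builder then chooses one edge $e_t\in E(T_t)$ and sets $E(G_t)=E(G_{t-1})\cup\{e_t\}$. Builder may also choose no edge in a round. A strategy determines Builder's choice in each round from the history of the process so far. A graph contains a copy of $H$ if it has a subgraph isomorphic to $H$. When the number of rounds is Poisson, it is independent of which trees are offered. *)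

theory Defs
  imports "HOL-Probability.Probability"
begin

section \<open>Finite simple graphs\<close>

type_synonym 'a graph = "'a set \<times> 'a set set"

abbreviation verts :: "'a graph \<Rightarrow> 'a set" where "verts \<equiv> fst"
abbreviation edges :: "'a graph \<Rightarrow> 'a set set" where "edges \<equiv> snd"

definition simple_graph :: "'a graph \<Rightarrow> bool" where
  "simple_graph G \<longleftrightarrow> finite (verts G) \<and> (\<forall>e\<in>edges G. e \<subseteq> verts G \<and> card e = 2)"

definition vertex_degree :: "'a graph \<Rightarrow> 'a \<Rightarrow> nat" where
  "vertex_degree G v = card {e \<in> edges G. v \<in> e}"

text \<open>Only meaningful for graphs with at least one vertex.\<close>
definition max_degree :: "'a graph \<Rightarrow> nat" where
  "max_degree G = Max (vertex_degree G ` verts G)"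

definition complete_graph :: "nat \<Rightarrow> nat graph" where
  "complete_graph n = ({1..n}, {e. e \<subseteq> {1..n} \<and> card e = 2})"

definition connected_graph :: "'a graph \<Rightarrow> bool" where
  "connected_graph G \<longleftrightarrow> (\<forall>u\<in>verts G. \<forall>v\<in>verts G. (u, v) \<in> {(x, y). {x, y} \<in> edges G}\<^sup>*)"

text \<open>A cycle is given by the list of its distinct vertices in cyclic order.\<close>
definition is_cycle :: "'a graph \<Rightarrow> 'a list \<Rightarrow> bool" where
  "is_cycle G vs \<longleftrightarrow> length vs \<ge> 3 \<and> distinct vs \<and>
     (\<forall>i<length vs. {vs ! i, vs ! (Suc i mod length vs)} \<in> edges G)"

definition is_tree :: "'a graph \<Rightarrow> bool" where
  "is_tree G \<longleftrightarrow> simple_graph G \<and> connected_graph G \<and> (\<nexists>vs. is_cycle G vs)"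

text \<open>A spanning tree is identified with its edge set.\<close>
definition spanning_trees :: "'a graph \<Rightarrow> 'a set set set" where
  "spanning_trees G = {T. T \<subseteq> edges G \<and> is_tree (verts G, T)}"

definition subgraph :: "'a graph \<Rightarrow> 'a graph \<Rightarrow> bool" where
  "subgraph K G \<longleftrightarrow> simple_graph K \<and> verts K \<subseteq> verts G \<and> edges K \<subseteq> edges G"

definition isomorphic_graphs :: "'a graph \<Rightarrow> 'b graph \<Rightarrow> bool" where
  "isomorphic_graphs H K \<longleftrightarrow>
     (\<exists>\<phi>. bij_betw \<phi> (verts H) (verts K) \<and>
       (\<forall>u\<in>verts H. \<forall>v\<in>verts H. {u, v} \<in> edges H \<longleftrightarrow> {\<phi> u, \<phi> v} \<in> edges K))"

definition contains_copy :: "'a graph \<Rightarrow> 'b graph \<Rightarrow> bool" where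
  "contains_copy G H \<longleftrightarrow> (\<exists>K. subgraph K G \<and> isomorphic_graphs H K)"

section \<open>The semirandom tree process\<close>

text \<open>
  The history of the process is the list of rounds so far, oldest first; a round records the
  offered tree and Builder's choice, where \<open>None\<close> means that Builder chooses no edge.
\<close>
type_synonym history = "(nat set set \<times> nat set option) list"
type_synonym strategy = "history \<Rightarrow> nat set set \<Rightarrow> nat set option"

definition valid_strategy :: "nat \<Rightarrow> strategy \<Rightarrow> bool" where
  "valid_strategy n \<sigma> \<longleftrightarrow>
     (\<forall>h. \<forall>T\<in>spanning_trees (complete_graph n). \<forall>e. \<sigma> h T = Some e \<longrightarrow> e \<in> T)"

primrec play :: "strategy \<Rightarrow> history \<Rightarrow> nat set set list \<Rightarrow> history" where
  "play \<sigma> h [] = h"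
| "play \<sigma> h (T # Ts) = play \<sigma> (h @ [(T, \<sigma> h T)]) Ts"

definition built_graph :: "nat \<Rightarrow> history \<Rightarrow> nat graph" where
  "built_graph n h = ({1..n}, {e. Some e \<in> snd ` set h})"

text \<open>The distribution of the graph built after \<open>m\<close> rounds.\<close>
definition tree_process :: "nat \<Rightarrow> strategy \<Rightarrow> nat \<Rightarrow> nat graph pmf" where
  "tree_process n \<sigma> m =
     map_pmf (\<lambda>Ts. built_graph n (play \<sigma> [] Ts))
       (replicate_pmf m (pmf_of_set (spanning_trees (complete_graph n))))"

text \<open>
  The library's \<^const>\<open>poisson_pmf\<close> is only specified for positive rates; the rate \<open>0\<close>, which occurs
  for edgeless graphs, gives the point mass at \<open>0\<close>.
\<close>
definition Po :: "real \<Rightarrow> nat pmf" where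
  "Po r = (if r = 0 then return_pmf 0 else poisson_pmf r)"

text \<open>
  The number of rounds is drawn from \<open>N\<close>; given that it is \<open>m\<close>, the offered trees are still
  \<open>m\<close> independent uniform ones, i.e. the number of rounds is independent of the trees. The strategy
  does not see the number of rounds.
\<close>
definition tree_process_random :: "nat \<Rightarrow> strategy \<Rightarrow> nat pmf \<Rightarrow> nat graph pmf" where
  "tree_process_random n \<sigma> N = bind_pmf N (tree_process n \<sigma>)"

section \<open>The uniform distribution on spanning trees is well defined\<close>

lemma finite_spanning_trees: "finite (spanning_trees (complete_graph n))"
  by (rule finite_subset[of _ "Pow (Pow {1..n})"])
     (auto simp: spanning_trees_def complete_graph_def)

lemma spanning_trees_nonempty: "spanning_trees (complete_graph n) \<noteq> {}"
proof -
  define S where "S = (\<lambda>v. {1, v}) ` {2..n}"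
  have card2: "card e = 2" if "e \<in> S" for e
    using that by (auto simp: S_def)
  have sub: "S \<subseteq> edges (complete_graph n)"
    using card2 by (auto simp: S_def complete_graph_def)
  have one: "1 \<in> e" if "e \<in> S" for e
    using that by (auto simp: S_def)
  let ?R = "{(x, y). {x, y} \<in> S}"
  have "connected_graph ({1..n}, S)"
    unfolding connected_graph_def
  proof (intro ballI, simp)
    fix u v assume uv: "Suc 0 \<le> u \<and> u \<le> n" "Suc 0 \<le> v \<and> v \<le> n"
    have "(u, 1) \<in> ?R\<^sup>*"
      using uv by (cases "u = 1") (auto simp: S_def insert_commute intro!: r_into_rtrancl)
    moreover have "(1, v) \<in> ?R\<^sup>*"
      using uv by (cases "v = 1") (auto simp: S_def insert_commute intro!: r_into_rtrancl)
    ultimately show "(u, v) \<in> ?R\<^sup>*"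
      by (rule rtrancl_trans)
  qed
  moreover have "\<not> is_cycle ({1..n}, S) vs" for vs
  proof
    assume c: "is_cycle ({1..n}, S) vs"
    define k where "k = length vs"
    have k: "k \<ge> 3" and d: "distinct vs"
      using c by (auto simp: is_cycle_def k_def)
    have e: "1 \<in> {vs ! i, vs ! (Suc i mod k)}" if "i < k" for i
      using c that one by (auto simp: is_cycle_def k_def)
    have ne: "vs ! i \<noteq> vs ! j" if "i < k" "j < k" "i \<noteq> j" for i j
      using d that by (simp add: nth_eq_iff_index_eq k_def)
    have z: "Suc 2 mod k = (if k = 3 then 0 else 3)"
      using k by auto
    have "1 \<in> {vs ! 0, vs ! 1}" "1 \<in> {vs ! 1, vs ! 2}" "1 \<in> {vs ! 2, vs ! (if k = 3 then 0 else 3)}"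
      using e[of 0] e[of 1] e[of 2] k z by (simp_all add: numeral_2_eq_2)
    then show False
      using ne[of 0 1] ne[of 0 2] ne[of 1 2] ne[of 1 "if k = 3 then 0 else 3"] k
      by (auto split: if_splits)
  qed
  ultimately have "S \<in> spanning_trees (complete_graph n)"
    using sub card2 by (auto simp: spanning_trees_def is_tree_def simple_graph_def complete_graph_def)
  then show ?thesis
    by blast
qed

end

theory Submission
  imports Defs "HOL-Combinatorics.Permutations" "HOL-Real_Asymp.Real_Asymp"
begin

text \<open>
  Label the vertices of the target graph by \<open>{1..n}\<close> and let \<open>D\<close> be its edge set, so
  \<open>2 * card D \<le> \<Delta> * n\<close>.  A set of \<open>M\<close> edges misses a uniform random spanning tree with
  probability at most \<open>8 * n / M\<close> (second moment, \<open>tree_avg_miss\<close>).  While the number of missing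
  edges of \<open>D\<close> is large compared with \<open>n\<close>, Builder therefore loses few rounds by taking any missing
  edge that is offered, and this accounts for the main term \<open>\<Delta> * n / 2\<close> (\<open>greedy_bulk\<close>).  The
  difficulty is the end: a prescribed edge is offered with probability only \<open>2 / n\<close>, so waiting for
  every last edge of a fixed copy takes of the order of \<open>n * ln n\<close> rounds, which is too much when
  \<open>\<Delta>\<close> is small compared with \<open>ln n\<close>.

  Builder therefore gives up the last edges of the copy and changes the embedding instead.  A set in
  \<open>near_copy n D m\<close> contains a copy of \<open>D\<close> except for edges at \<open>m\<close> defective vertices.  A defective
  vertex \<open>u\<close> is repaired by exchanging it with one of \<open>K\<close> candidates \<open>z\<close> that are reserved for it; this
  needs the at most \<open>2 * \<Delta>\<close> edges from \<open>z\<close> to the neighbours of \<open>u\<close> and from \<open>u\<close> to the neighbours of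
  \<open>z\<close>, the star of the pair.  In one stage all defective vertices are treated in parallel: Builder
  collects every edge that can occur in some star.  Candidates are pairwise at distance at least 3,
  and an edge between two adjacent defective vertices is charged to the larger one, which makes the
  stars of different pairs disjoint (\<open>star_disjoint\<close>).  If at most \<open>n / 8\<close> edges are watched, each
  missing one is collected with probability at least \<open>1 / n\<close> per round (\<open>tree_avg_only\<close>), so the
  collection dominates a coupon collector, and that in turn is comparable, up to a factor 2, with
  independent coupons (\<open>coupon_le_bern_exp\<close>).  If \<open>q\<close> is the probability that a given watched edge is
  still missing, a vertex thus stays defective with probability about \<open>(1 - (1 - q) ^ (2 * \<Delta>)) ^ K\<close>,
  independently of the others (\<open>stage\<close>).

  The fewer vertices are defective, the more candidates each of them can have, and with many
  candidates a stage succeeds even when \<open>1 - q\<close> is small, that is, when it is short.  In the schedule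
  below, stage \<open>i\<close> takes at most about \<open>4 * n / 2 ^ i\<close> rounds and divides the number of defective vertices by
  about \<open>256 ^ \<Delta>\<close>; the number of stages grows with \<open>n\<close>, but their total length does not exceed a constant
  times \<open>n\<close>, apart from an initial stage of length \<open>2 * n * ln (16 * \<Delta>)\<close>.  When
  \<open>K\<close> exceeds \<open>2 * ln n\<close>, one more stage of that length leaves no defective vertex with
  probability at least \<open>1 - 2 / n\<close>.  Everything besides \<open>\<Delta> * n / 2\<close> adds up to at most
  \<open>5000 * \<Delta> powr (3 / 4) * n\<close> rounds, uniformly in \<open>\<Delta>\<close> (\<open>near_copy_reachable\<close>).

  The analysis never handles strategies.  The function \<open>fail\<close> is the value of the dynamic program
  that minimises the probability of missing a target; \<open>fail_compose\<close> concatenates phases, and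
  \<open>prob_best_strategy\<close> turns the value into an actual strategy.  That strategy stops choosing edges
  once its planned number of rounds is over, so it also serves a Poisson number of rounds, which
  by Chebyshev's inequality is rarely too small.
\<close>

section \<open>Trees as connected graphs with one edge less than vertices\<close>

definition adj :: "'a set set \<Rightarrow> ('a \<times> 'a) set" where
  "adj E = {(x, y). {x, y} \<in> E}"

definition reach :: "'a set set \<Rightarrow> 'a \<Rightarrow> 'a set" where
  "reach E v = (adj E)\<^sup>* `` {v}"

lemma connected_graph_reach:
  "connected_graph (V, E) \<longleftrightarrow> (\<forall>u\<in>V. V \<subseteq> reach E u)"
  by (auto simp: connected_graph_def reach_def adj_def)

lemma reach_refl [simp]: "v \<in> reach E v"
  by (auto simp: reach_def)

lemma reach_step: "v \<in> reach E u \<Longrightarrow> {v, w} \<in> E \<Longrightarrow> w \<in> reach E u"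
  by (auto simp: reach_def adj_def intro: rtrancl_into_rtrancl)

lemma reach_edge: "{v, w} \<in> E \<Longrightarrow> w \<in> reach E v"
  by (rule reach_step[OF reach_refl])

lemma reach_trans: "v \<in> reach E u \<Longrightarrow> w \<in> reach E v \<Longrightarrow> w \<in> reach E u"
  by (auto simp: reach_def)

lemma reach_sym: "v \<in> reach E u \<Longrightarrow> u \<in> reach E v"
proof -
  have "sym (adj E)"
    by (auto simp: sym_def adj_def insert_commute)
  then show "v \<in> reach E u \<Longrightarrow> u \<in> reach E v"
    by (auto simp: reach_def dest: symD[OF sym_rtrancl])
qed

lemma reach_mono: "E \<subseteq> F \<Longrightarrow> reach E v \<subseteq> reach F v"
  unfolding reach_def adj_def by (intro Image_mono rtrancl_mono) auto

lemma reach_induct [consumes 1, case_names refl step]: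
  assumes "w \<in> reach E v" "P v"
    "\<And>x y. x \<in> reach E v \<Longrightarrow> P x \<Longrightarrow> {x, y} \<in> E \<Longrightarrow> P y"
  shows "P w"
proof -
  have "(v, w) \<in> (adj E)\<^sup>*"
    using assms(1) by (auto simp: reach_def)
  then have "P w \<and> w \<in> reach E v"
    by induction (use assms in \<open>auto simp: adj_def intro: reach_step\<close>)
  then show ?thesis ..
qed

lemma reach_eq: "v \<in> reach E u \<Longrightarrow> reach E v = reach E u"
proof -
  assume a: "v \<in> reach E u"
  show "reach E v = reach E u"
    using reach_trans[OF a] reach_trans[OF reach_sym[OF a]] by (intro equalityI subsetI)
qed

lemma reach_closed:
  assumes "w \<in> reach E v" "v \<in> V" "\<forall>e\<in>E. e \<subseteq> V"
  shows "w \<in> V"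
  using assms(1) by (induction rule: reach_induct) (use assms in auto)

text \<open>
  Adding an edge merges the components of its two ends and changes no other component; this is the
  induction step for counting components.
\<close>
lemma reach_insert:
  "reach (insert {a, b} E) v =
     (if v \<in> reach E a \<union> reach E b then reach E a \<union> reach E b else reach E v)"
proof (cases "v \<in> reach E a \<union> reach E b")
  case True
  have "w \<in> reach E a \<union> reach E b" if "w \<in> reach (insert {a, b} E) v" for w
    using that
  proof (induction rule: reach_induct)
    case refl
    then show ?case using True .
  next
    case (step x y)
    then consider "{x, y} = {a, b}" | "{x, y} \<in> E" by auto
    then show ?case
      by cases (use step.IH in \<open>auto simp: doubleton_eq_iff intro: reach_step\<close>)
  qed
  moreover have "w \<in> reach (insert {a, b} E) v" if "w \<in> reach E a \<union> reach E b" for w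
  proof -
    have m: "reach E x \<subseteq> reach (insert {a, b} E) x" for x
      by (rule reach_mono) auto
    have ab: "b \<in> reach (insert {a, b} E) a"
      by (rule reach_edge) simp
    have "x \<in> reach (insert {a, b} E) a" if "x \<in> reach E a \<union> reach E b" for x
      using that m[of a] reach_trans[OF ab, of x] m[of b] by auto
    from this[OF \<open>w \<in> reach E a \<union> reach E b\<close>] this[OF True] show ?thesis
      by (metis reach_eq)
  qed
  ultimately have "reach (insert {a, b} E) v = reach E a \<union> reach E b"
    by (intro equalityI subsetI)
  then show ?thesis using True by simp
next
  case False
  have "w \<in> reach E v" if "w \<in> reach (insert {a, b} E) v" for w
    using that
  proof (induction rule: reach_induct)
    case (step x y)
    have "v \<in> reach E x"
      using step.IH by (rule reach_sym)
    then have "x \<noteq> a" "x \<noteq> b"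
      using False by auto
    then have "{x, y} \<in> E"
      using step.hyps by (auto simp: doubleton_eq_iff)
    then show ?case
      by (rule reach_step[OF step.IH])
  qed simp
  moreover have "reach E v \<subseteq> reach (insert {a, b} E) v"
    by (rule reach_mono) auto
  ultimately have "reach (insert {a, b} E) v = reach E v"
    by (intro equalityI subsetI) auto
  then show ?thesis
    using False by simp
qed

definition comps :: "'a set \<Rightarrow> 'a set set \<Rightarrow> 'a set set" where
  "comps V E = reach E ` V"

lemma card_comps_insert:
  assumes "finite V" "a \<in> V" "b \<in> V"
  shows "card (comps V E) \<le> card (comps V (insert {a, b} E)) + 1"
    and "b \<notin> reach E a \<Longrightarrow> card (comps V E) = card (comps V (insert {a, b} E)) + 1"
proof -
  let ?E = "insert {a, b} E"
  let ?m = "reach E a \<union> reach E b"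
  have fin: "finite (comps V F)" for F
    using assms by (simp add: comps_def)
  have eq: "comps V ?E = insert ?m (comps V E - {reach E a, reach E b})"
  proof (intro equalityI subsetI)
    fix X assume "X \<in> comps V ?E"
    then obtain v where v: "v \<in> V" "X = reach ?E v"
      by (auto simp: comps_def)
    show "X \<in> insert ?m (comps V E - {reach E a, reach E b})"
    proof (cases "v \<in> ?m")
      case True
      then show ?thesis using v by (simp add: reach_insert)
    next
      case False
      then have "reach E v \<noteq> reach E a" "reach E v \<noteq> reach E b"
        using reach_refl[of v E] by (metis Un_iff)+
      then show ?thesis using v False by (auto simp: reach_insert comps_def)
    qed
  next
    fix X assume "X \<in> insert ?m (comps V E - {reach E a, reach E b})"
    then consider "X = ?m" | v where "v \<in> V" "X = reach E v" "X \<noteq> reach E a" "X \<noteq> reach E b"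
      by (auto simp: comps_def)
    then show "X \<in> comps V ?E"
    proof cases
      case 1
      then have "X = reach ?E a" by (simp add: reach_insert)
      then show ?thesis using assms by (auto simp: comps_def)
    next
      case 2
      then have "v \<notin> ?m"
        using reach_eq by fastforce
      then have "X = reach ?E v"
        using 2 by (simp add: reach_insert)
      then show ?thesis using 2 by (auto simp: comps_def)
    qed
  qed
  have ab: "reach E a \<in> comps V E" "reach E b \<in> comps V E"
    using assms by (auto simp: comps_def)
  have notin: "?m \<notin> comps V E - {reach E a, reach E b}"
  proof
    assume "?m \<in> comps V E - {reach E a, reach E b}"
    then obtain v where "?m = reach E v" "?m \<noteq> reach E a"
      by (auto simp: comps_def)
    moreover have "a \<in> ?m" by simp
    ultimately show False using reach_eq by metis
  qed
  have c: "card (comps V ?E) = card (comps V E - {reach E a, reach E b}) + 1"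
    unfolding eq using fin notin by simp
  have d: "card (comps V E - {reach E a, reach E b}) = card (comps V E) - card {reach E a, reach E b}"
    using ab by (intro card_Diff_subset) auto
  have le: "card {reach E a, reach E b} \<le> card (comps V E)"
    using ab fin by (intro card_mono) auto
  have "card {reach E a, reach E b} \<le> 2"
    by (simp add: card_insert_if)
  then show "card (comps V E) \<le> card (comps V ?E) + 1"
    using c d by simp
  assume "b \<notin> reach E a"
  then have "reach E a \<noteq> reach E b"
    using reach_refl[of b E] by metis
  then have "card {reach E a, reach E b} = 2" by simp
  then show "card (comps V E) = card (comps V ?E) + 1"
    using c d le by simp
qed

lemma comps_empty: "card (comps V {}) = card V"
proof -
  have "adj ({} :: 'a set set) = {}" by (auto simp: adj_def)
  then have "reach {} v = {v}" for v :: 'a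
    by (auto simp: reach_def)
  then show ?thesis
    by (simp add: comps_def card_image)
qed

text \<open>
  Every new edge lowers the number of components by at most one, and by exactly one if it is a
  bridge of the final graph, because it then joins two components of every smaller edge set.
\<close>
lemma comps_bounds:
  assumes "finite V" "finite E" "\<forall>e\<in>E. e \<subseteq> V \<and> card e = 2"
  shows "card V \<le> card (comps V E) + card E"
    and "(\<And>a b. {a, b} \<in> E \<Longrightarrow> b \<notin> reach (E - {{a, b}}) a) \<Longrightarrow> card V = card (comps V E) + card E"
proof -
  have "card V \<le> card (comps V E) + card E \<and>
     ((\<forall>a b. {a, b} \<in> E \<longrightarrow> b \<notin> reach (E - {{a, b}}) a) \<longrightarrow> card V = card (comps V E) + card E)"
    using assms(2,3)
  proof (induction E rule: finite_induct)
    case empty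
    then show ?case by (simp add: comps_empty)
  next
    case (insert e E)
    from insert.prems obtain a b where e: "e = {a, b}" and ab: "a \<in> V" "b \<in> V"
      by (auto simp: card_2_iff)
    have IH: "card V \<le> card (comps V E) + card E"
      "(\<forall>a b. {a, b} \<in> E \<longrightarrow> b \<notin> reach (E - {{a, b}}) a) \<Longrightarrow> card V = card (comps V E) + card E"
      using insert by auto
    note ins = card_comps_insert[OF assms(1) ab, of E]
    have "card V = card (comps V (insert e E)) + card (insert e E)"
      if br: "\<forall>x y. {x, y} \<in> insert e E \<longrightarrow> y \<notin> reach (insert e E - {{x, y}}) x"
    proof -
      have "insert e E - {{a, b}} = E"
        using insert.hyps e by auto
      then have "b \<notin> reach E a"
        using spec[OF spec[OF br, of a], of b] e by simp
      moreover have "y \<notin> reach (E - {{x, y}}) x" if "{x, y} \<in> E" for x y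
        using br that reach_mono[of "E - {{x, y}}" "insert e E - {{x, y}}" x] by blast
      ultimately show ?thesis
        using IH(2) ins(2) insert.hyps e by simp
    qed
    then show ?case
      using IH(1) ins(1) insert.hyps e by simp
  qed
  then show "card V \<le> card (comps V E) + card E"
    and "(\<And>a b. {a, b} \<in> E \<Longrightarrow> b \<notin> reach (E - {{a, b}}) a) \<Longrightarrow> card V = card (comps V E) + card E"
    by auto
qed

lemma comps_connected:
  assumes "connected_graph (V, E)" "V \<noteq> {}" "\<forall>e\<in>E. e \<subseteq> V"
  shows "card (comps V E) = 1"
proof -
  have "reach E v = V" if "v \<in> V" for v
    using assms that reach_closed[of _ E v V] by (auto simp: connected_graph_reach)
  then have "comps V E = {V}"
    using assms(2) by (auto simp: comps_def)
  then show ?thesis by simp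
qed

text \<open>
  When a step leads to a vertex that already lies on the path, the loop in between is cut out.
\<close>
lemma reach_distinct_path:
  assumes "b \<in> reach E a"
  shows "\<exists>xs. xs \<noteq> [] \<and> hd xs = a \<and> last xs = b \<and> distinct xs \<and> successively (\<lambda>x y. {x, y} \<in> E) xs"
proof -
  have "(a, b) \<in> (adj E)\<^sup>*"
    using assms by (auto simp: reach_def)
  then show ?thesis
  proof (induction rule: converse_rtrancl_induct)
    case base
    then show ?case by (intro exI[of _ "[b]"]) auto
  next
    case (step y z)
    then obtain xs where xs: "xs \<noteq> []" "hd xs = z" "last xs = b" "distinct xs"
      "successively (\<lambda>x y. {x, y} \<in> E) xs" by blast
    show ?case
    proof (cases "y \<in> set xs")
      case True
      then obtain ys zs where "xs = ys @ y # zs"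
        by (auto simp: in_set_conv_decomp)
      then show ?thesis
        using xs by (intro exI[of _ "y # zs"]) (auto simp: successively_append_iff)
    next
      case False
      then show ?thesis
        using xs step.hyps by (intro exI[of _ "y # xs"]) (auto simp: adj_def successively_Cons)
    qed
  qed
qed

text \<open>
  A path that joins the ends of an edge while avoiding it closes up to a cycle, and conversely a
  cycle minus one of its edges is such a path.
\<close>
lemma acyclic_iff_bridges:
  assumes "\<forall>e\<in>E. card e = 2"
  shows "(\<nexists>vs. is_cycle (V, E) vs) \<longleftrightarrow> (\<forall>a b. {a, b} \<in> E \<longrightarrow> b \<notin> reach (E - {{a, b}}) a)"
proof (intro iffI allI impI notI)
  fix a b assume nc: "\<nexists>vs. is_cycle (V, E) vs" and e: "{a, b} \<in> E" and r: "b \<in> reach (E - {{a, b}}) a"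
  from reach_distinct_path[OF r] obtain xs where xs: "xs \<noteq> []" "hd xs = a" "last xs = b"
    "distinct xs" "successively (\<lambda>x y. {x, y} \<in> E - {{a, b}}) xs" by blast
  have ab: "a \<noteq> b"
    using e assms by fastforce
  have "length xs \<noteq> 0" "length xs \<noteq> 1"
    using xs ab by (auto simp: length_Suc_conv)
  moreover have "length xs \<noteq> 2"
  proof
    assume "length xs = 2"
    then obtain x y where "xs = [x, y]"
      by (auto simp: numeral_2_eq_2 length_Suc_conv)
    then show False using xs by auto
  qed
  ultimately have len: "length xs \<ge> 3" by linarith
  have "is_cycle (V, E) xs"
    unfolding is_cycle_def
  proof (intro conjI allI impI)
    fix i assume i: "i < length xs"
    show "{xs ! i, xs ! (Suc i mod length xs)} \<in> edges (V, E)"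
    proof (cases "Suc i = length xs")
      case True
      then have "length xs - 1 = i" by simp
      then have "xs ! i = b" "xs ! 0 = a"
        using xs(1-3) by (auto simp: last_conv_nth hd_conv_nth)
      then show ?thesis using True e by (simp add: insert_commute)
    next
      case False
      then have "Suc i < length xs" using i by simp
      then show ?thesis
        using xs(5) successively_nth[of "\<lambda>x y. {x, y} \<in> E - {{a, b}}" xs i] by auto
    qed
  qed (use len xs in auto)
  then show False using nc by blast
next
  assume br: "\<forall>a b. {a, b} \<in> E \<longrightarrow> b \<notin> reach (E - {{a, b}}) a" and "\<exists>vs. is_cycle (V, E) vs"
  then obtain vs where c: "length vs \<ge> 3" "distinct vs"
    "\<And>i. i < length vs \<Longrightarrow> {vs ! i, vs ! (Suc i mod length vs)} \<in> E"
    by (auto simp: is_cycle_def)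
  define k where "k = length vs - 1"
  have k: "length vs = Suc k" "k \<ge> 2"
    using c by (auto simp: k_def)
  have e: "{vs ! 0, vs ! k} \<in> E"
    using c(3)[of k] k by (simp add: insert_commute)
  have "vs ! i \<in> reach (E - {{vs ! 0, vs ! k}}) (vs ! 0)" if "i \<le> k" for i
    using that
  proof (induction i)
    case (Suc i)
    have "{vs ! i, vs ! Suc i} \<in> E"
      using c(3)[of i] k Suc.prems by simp
    moreover have "{vs ! i, vs ! Suc i} \<noteq> {vs ! 0, vs ! k}"
      using c(2) k Suc.prems by (auto simp: doubleton_eq_iff nth_eq_iff_index_eq)
    ultimately show ?case
      using Suc reach_step[of "vs ! i" _ _ "vs ! Suc i"] by auto
  qed simp
  then show False using br e by blast
qed

lemma tree_bridge:
  assumes "is_tree (V, E)" "{a, b} \<in> E"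
  shows "b \<notin> reach (E - {{a, b}}) a"
  using assms acyclic_iff_bridges[of E V] by (auto simp: is_tree_def simple_graph_def)

text \<open>
  Counting edges is easier to transport along permutations and edge exchanges than the absence of
  cycles, so trees are used in this form from here on.
\<close>
lemma is_tree_iff_card:
  assumes "V \<noteq> {}"
  shows "is_tree (V, E) \<longleftrightarrow> simple_graph (V, E) \<and> connected_graph (V, E) \<and> Suc (card E) = card V"
proof (cases "simple_graph (V, E) \<and> connected_graph (V, E)")
  case True
  then have s: "finite V" "\<forall>e\<in>E. e \<subseteq> V \<and> card e = 2" and con: "connected_graph (V, E)"
    by (auto simp: simple_graph_def)
  have fE: "finite E"
    using s by (intro finite_subset[of E "Pow V"]) auto
  have c1: "card (comps V E) = 1"
    using comps_connected[OF con assms] s by auto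
  have "(\<nexists>vs. is_cycle (V, E) vs) \<longleftrightarrow> Suc (card E) = card V"
  proof
    assume "\<nexists>vs. is_cycle (V, E) vs"
    then have "\<And>a b. {a, b} \<in> E \<Longrightarrow> b \<notin> reach (E - {{a, b}}) a"
      using acyclic_iff_bridges[of E V] s by blast
    then show "Suc (card E) = card V"
      using comps_bounds(2)[OF s(1) fE s(2)] c1 by simp
  next
    assume cd: "Suc (card E) = card V"
    have "b \<notin> reach (E - {{a, b}}) a" if e: "{a, b} \<in> E" for a b
    proof
      assume r: "b \<in> reach (E - {{a, b}}) a"
      have "reach E v = reach (E - {{a, b}}) v" for v
      proof -
        have "insert {a, b} (E - {{a, b}}) = E" using e by auto
        moreover have "reach (E - {{a, b}}) b = reach (E - {{a, b}}) a"
          using r by (rule reach_eq)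
        ultimately show ?thesis
          using reach_insert[of a b "E - {{a, b}}" v] reach_eq[of v "E - {{a, b}}" a] by (auto split: if_splits)
      qed
      then have "comps V (E - {{a, b}}) = comps V E"
        by (simp add: comps_def)
      then have "card V \<le> 1 + card (E - {{a, b}})"
        using comps_bounds(1)[OF s(1), of "E - {{a, b}}"] fE s(2) c1 by simp
      moreover have "card (E - {{a, b}}) < card E"
        using fE e by (meson card_Diff1_less)
      ultimately show False using cd by simp
    qed
    then show "\<nexists>vs. is_cycle (V, E) vs"
      using acyclic_iff_bridges[of E V] s by blast
  qed
  then show ?thesis using True by (simp add: is_tree_def)
qed (auto simp: is_tree_def)

abbreviation Kn :: "nat \<Rightarrow> nat set set" where
  "Kn n \<equiv> edges (complete_graph n)"

abbreviation trees :: "nat \<Rightarrow> nat set set set" where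
  "trees n \<equiv> spanning_trees (complete_graph n)"

lemma Kn_eq: "Kn n = {e. e \<subseteq> {1..n} \<and> card e = 2}"
  by (simp add: complete_graph_def)

lemma finite_Kn [simp]: "finite (Kn n)"
  by (rule finite_subset[of _ "Pow {1..n}"]) (auto simp: Kn_eq)

lemma card_Kn: "card (Kn n) = n choose 2"
  using n_subsets[of "{1..n}" 2] by (simp add: Kn_eq)

lemma in_Kn_pair: "{a, b} \<in> Kn n \<longleftrightarrow> a \<in> {1..n} \<and> b \<in> {1..n} \<and> a \<noteq> b"
  by (auto simp: Kn_eq card_insert_if)

lemma trees_iff:
  assumes "n \<ge> 1"
  shows "T \<in> trees n \<longleftrightarrow> T \<subseteq> Kn n \<and> connected_graph ({1..n}, T) \<and> Suc (card T) = n"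
  using assms is_tree_iff_card[of "{1..n}" T]
  by (auto simp: spanning_trees_def simple_graph_def complete_graph_def)

lemma tree_subset: "T \<in> trees n \<Longrightarrow> T \<subseteq> Kn n"
  by (simp add: spanning_trees_def)

lemma finite_tree: "T \<in> trees n \<Longrightarrow> finite T"
  using tree_subset finite_Kn finite_subset by metis

section \<open>Spanning trees through given edges\<close>

text \<open>
  Permutations of the vertices act on the spanning trees; this lemma provides enough of them to
  identify all edges, and all pairs of disjoint edges.
\<close>
lemma permutation_extending:
  assumes "finite S" "A \<subseteq> S" "inj_on f A" "f ` A \<subseteq> S"
  obtains \<pi> where "\<pi> permutes S" "\<And>x. x \<in> A \<Longrightarrow> \<pi> x = f x"
proof -
  have "card (S - A) = card (S - f ` A)"
    using assms by (simp add: card_Diff_subset finite_subset card_image)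
  then obtain g where g: "bij_betw g (S - A) (S - f ` A)"
    using finite_same_card_bij[of "S - A" "S - f ` A"] assms(1) by auto
  define \<pi> where "\<pi> = (\<lambda>x. if x \<in> A then f x else if x \<in> S then g x else x)"
  have "bij_betw \<pi> A (f ` A)"
    using assms(3) by (auto simp: bij_betw_def \<pi>_def inj_on_def)
  moreover have "bij_betw \<pi> (S - A) (S - f ` A)"
    using g by (rule bij_betw_cong[THEN iffD1, rotated]) (auto simp: \<pi>_def)
  ultimately have "bij_betw \<pi> (A \<union> (S - A)) (f ` A \<union> (S - f ` A))"
    by (rule bij_betw_combine) auto
  moreover have "A \<union> (S - A) = S" "f ` A \<union> (S - f ` A) = S"
    using assms by auto
  ultimately have "\<pi> permutes S"
    using assms(2) by (intro bij_imp_permutes) (auto simp: \<pi>_def)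
  then show thesis
    by (rule that) (simp add: \<pi>_def)
qed

lemma reach_image:
  assumes "w \<in> reach E v"
  shows "\<pi> w \<in> reach ((`) \<pi> ` E) (\<pi> v)"
  using assms
proof (induction rule: reach_induct)
  case (step x y)
  have "\<pi> ` {x, y} \<in> (`) \<pi> ` E"
    using step by blast
  then show ?case
    using step reach_step[of "\<pi> x" _ _ "\<pi> y"] by simp
qed simp

lemma Kn_pairE:
  assumes "e \<in> Kn n"
  obtains a b where "e = {a, b}" "a \<noteq> b" "a \<in> {1..n}" "b \<in> {1..n}"
proof -
  from assms have "e \<subseteq> {1..n}" "card e = 2"
    by (auto simp: Kn_eq)
  then obtain a b where "e = {a, b}" "a \<noteq> b"
    by (meson card_2_iff)
  then show thesis
    using that \<open>e \<subseteq> {1..n}\<close> by blast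
qed

lemma image_in_Kn:
  assumes "\<pi> permutes {1..n}" "e \<in> Kn n"
  shows "\<pi> ` e \<in> Kn n"
proof -
  have "inj_on \<pi> e"
    using permutes_inj[OF assms(1)] by (rule inj_on_subset) auto
  moreover have "\<pi> ` e \<subseteq> {1..n}"
    using assms permutes_image[OF assms(1)] by (auto simp: Kn_eq)
  ultimately show ?thesis
    using assms(2) by (simp add: Kn_eq card_image)
qed

lemma inj_image_set:
  assumes "\<pi> permutes S"
  shows "inj ((`) \<pi>)" "inj ((`) ((`) \<pi>))"
proof -
  show "inj ((`) \<pi>)"
    using inj_image_eq_iff[OF permutes_inj[OF assms]] by (intro injI) simp
  then show "inj ((`) ((`) \<pi>))"
    using inj_image_eq_iff[of "(`) \<pi>"] by (intro injI) simp
qed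

lemma connected_graphD:
  "connected_graph (V, E) \<Longrightarrow> u \<in> V \<Longrightarrow> v \<in> V \<Longrightarrow> v \<in> reach E u"
  by (auto simp: connected_graph_reach)

lemma image_in_trees:
  assumes "n \<ge> 1" "\<pi> permutes {1..n}" "T \<in> trees n"
  shows "(`) \<pi> ` T \<in> trees n"
proof -
  have T: "T \<subseteq> Kn n" "connected_graph ({1..n}, T)" "Suc (card T) = n"
    using assms trees_iff by auto
  have "(`) \<pi> ` T \<subseteq> Kn n"
    using T image_in_Kn[OF assms(2)] by auto
  moreover have "card ((`) \<pi> ` T) = card T"
    by (rule card_image[OF inj_on_subset[OF inj_image_set(1)[OF assms(2)] subset_UNIV]])
  moreover have "connected_graph ({1..n}, (`) \<pi> ` T)"
    unfolding connected_graph_reach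
  proof (intro ballI subsetI)
    fix u v assume "u \<in> {1..n}" "v \<in> {1..n}"
    then obtain u' v' where uv: "u' \<in> {1..n}" "v' \<in> {1..n}" "u = \<pi> u'" "v = \<pi> v'"
      using permutes_image[OF assms(2)] by (metis imageE)
    show "v \<in> reach ((`) \<pi> ` T) u"
      using reach_image[OF connected_graphD[OF T(2) uv(1,2)], of \<pi>] uv by simp
  qed
  ultimately show ?thesis
    using T assms(1) trees_iff by auto
qed

definition tree_count :: "nat \<Rightarrow> nat set set \<Rightarrow> nat" where
  "tree_count n S = card {T \<in> trees n. S \<subseteq> T}"

lemma finite_trees [simp]: "finite (trees n)"
  by (rule finite_spanning_trees)

lemma tree_count_image:
  assumes "n \<ge> 1" "\<pi> permutes {1..n}"
  shows "tree_count n ((`) \<pi> ` S) = tree_count n S"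
proof -
  have le: "tree_count n S \<le> tree_count n ((`) \<pi> ` S)" if "\<pi> permutes {1..n}" for \<pi> S
    unfolding tree_count_def
  proof (rule card_inj_on_le)
    show "inj_on ((`) ((`) \<pi>)) {T \<in> trees n. S \<subseteq> T}"
      using inj_image_set(2)[OF that] by (rule inj_on_subset) auto
    show "(`) ((`) \<pi>) ` {T \<in> trees n. S \<subseteq> T} \<subseteq> {T \<in> trees n. (`) \<pi> ` S \<subseteq> T}"
      using image_in_trees[OF assms(1) that] by auto
  qed simp
  have "(`) (inv \<pi>) ` (`) \<pi> ` S = S"
    using permutes_inj[OF assms(2)] by (auto simp: image_image)
  then show ?thesis
    using le[OF assms(2), of S] le[OF permutes_inv[OF assms(2)], of "(`) \<pi> ` S"] by simp
qed

lemma sum_tree_count: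
  assumes "finite P"
  shows "(\<Sum>p\<in>P. tree_count n (g p)) = (\<Sum>T\<in>trees n. card {p \<in> P. g p \<subseteq> T})"
proof -
  have "(\<Sum>p\<in>P. tree_count n (g p)) = (\<Sum>p\<in>P. \<Sum>T\<in>trees n. if g p \<subseteq> T then 1 else 0)"
    by (simp add: tree_count_def sum.If_cases Int_def)
  also have "\<dots> = (\<Sum>T\<in>trees n. \<Sum>p\<in>P. if g p \<subseteq> T then 1 else 0)"
    by (rule sum.swap)
  also have "\<dots> = (\<Sum>T\<in>trees n. card {p \<in> P. g p \<subseteq> T})"
    using assms by (simp add: sum.If_cases Int_def)
  finally show ?thesis .
qed

lemma two_choose_two: "2 * (n choose 2) = n * (n - 1)"
proof -
  have "even (n * (n - 1))" by (cases n) auto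
  then show ?thesis by (simp add: choose_two)
qed

text \<open>
  By symmetry all edges lie in equally many trees, and every tree has \<open>n - 1\<close> of the
  \<open>n choose 2\<close> edges.
\<close>
lemma tree_count_edge:
  assumes "n \<ge> 2" "e \<in> Kn n"
  shows "n * tree_count n {e} = 2 * card (trees n)"
proof -
  have eq: "tree_count n {f} = tree_count n {e}" if f: "f \<in> Kn n" for f
  proof -
    obtain a b where ab: "f = {a, b}" "a \<noteq> b" "a \<in> {1..n}" "b \<in> {1..n}"
      using f by (rule Kn_pairE)
    obtain c d where cd: "e = {c, d}" "c \<noteq> d" "c \<in> {1..n}" "d \<in> {1..n}"
      using assms(2) by (rule Kn_pairE)
    obtain \<pi> where p: "\<pi> permutes {1..n}" "\<And>x. x \<in> {a, b} \<Longrightarrow> \<pi> x = (if x = a then c else d)"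
      by (rule permutation_extending[of "{1..n}" "{a, b}" "\<lambda>x. if x = a then c else d"])
        (use ab cd in \<open>auto simp: inj_on_def\<close>)
    have "(`) \<pi> ` {f} = {e}"
      using p(2) ab cd by auto
    then show ?thesis
      using tree_count_image[OF _ p(1), of "{f}"] assms by simp
  qed
  have "(\<Sum>f\<in>Kn n. tree_count n {f}) = (\<Sum>T\<in>trees n. card {p \<in> Kn n. {p} \<subseteq> T})"
    by (rule sum_tree_count) simp
  also have "\<dots> = (\<Sum>T\<in>trees n. n - 1)"
  proof (rule sum.cong)
    fix T assume T: "T \<in> trees n"
    then have "{p \<in> Kn n. {p} \<subseteq> T} = T"
      using tree_subset by auto
    then show "card {p \<in> Kn n. {p} \<subseteq> T} = n - 1"
      using T trees_iff[of n T] assms by auto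
  qed simp
  finally have "(n choose 2) * tree_count n {e} = card (trees n) * (n - 1)"
    using eq by (simp add: card_Kn)
  then have "2 * (n choose 2) * tree_count n {e} = 2 * card (trees n) * (n - 1)"
    by simp
  moreover note two_choose_two[of n]
  ultimately have "(n - 1) * (n * tree_count n {e}) = (n - 1) * (2 * card (trees n))"
    by (simp add: mult_ac)
  then show ?thesis
    using assms(1) by simp
qed

text \<open>
  Again by symmetry, now for pairs of disjoint edges.  A tree contains at most
  \<open>(n - 1) * (n - 2)\<close> ordered pairs of distinct edges; since on average few of those are adjacent, little is lost,
  and the constant 4 is asymptotically the square of the constant 2 for single edges.  The second moment
  argument in \<open>tree_avg_miss\<close> depends on that.
\<close>
lemma tree_count_disjoint:
  assumes "n \<ge> 3" "e \<in> Kn n" "f \<in> Kn n" "e \<inter> f = {}"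
  shows "n * (n - 3) * tree_count n {e, f} \<le> 4 * card (trees n)"
proof -
  define P where "P = (SIGMA e:Kn n. {f \<in> Kn n. e \<inter> f = {}})"
  have eq: "tree_count n {fst p, snd p} = tree_count n {e, f}" if p: "p \<in> P" for p
  proof -
    obtain e' f' where ef: "p = (e', f')" "e' \<in> Kn n" "f' \<in> Kn n" "e' \<inter> f' = {}"
      using p by (auto simp: P_def)
    obtain a b where ab: "e' = {a, b}" "a \<noteq> b" "a \<in> {1..n}" "b \<in> {1..n}"
      using ef(2) by (rule Kn_pairE)
    obtain c d where cd: "f' = {c, d}" "c \<noteq> d" "c \<in> {1..n}" "d \<in> {1..n}"
      using ef(3) by (rule Kn_pairE)
    obtain a' b' where ab': "e = {a', b'}" "a' \<noteq> b'" "a' \<in> {1..n}" "b' \<in> {1..n}"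
      using assms(2) by (rule Kn_pairE)
    obtain c' d' where cd': "f = {c', d'}" "c' \<noteq> d'" "c' \<in> {1..n}" "d' \<in> {1..n}"
      using assms(3) by (rule Kn_pairE)
    have ne: "a \<noteq> c" "a \<noteq> d" "b \<noteq> c" "b \<noteq> d" "a' \<noteq> c'" "a' \<noteq> d'" "b' \<noteq> c'" "b' \<noteq> d'"
      using ef(4) assms(4) ab(1) cd(1) ab'(1) cd'(1) by auto
    define h where "h = (\<lambda>x. if x = a then a' else if x = b then b' else if x = c then c' else d')"
    have h: "h a = a'" "h b = b'" "h c = c'" "h d = d'"
      using ab(2) cd(2) ne by (simp_all add: h_def)
    have "inj_on h {a, b, c, d}"
      using ab'(2) cd'(2) ne unfolding inj_on_def by (simp add: h)
    moreover have "h ` {a, b, c, d} \<subseteq> {1..n}"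
      using ab' cd' by (simp add: h)
    ultimately obtain \<pi> where p: "\<pi> permutes {1..n}" "\<And>x. x \<in> {a, b, c, d} \<Longrightarrow> \<pi> x = h x"
      using permutation_extending[of "{1..n}" "{a, b, c, d}" h] ab cd by auto
    have "(`) \<pi> ` {e', f'} = {e, f}"
      using p(2) ab(1) cd(1) ab'(1) cd'(1) by (simp add: h)
    then show ?thesis
      using tree_count_image[OF _ p(1), of "{e', f'}"] assms ef by simp
  qed
  have fP: "finite P" by (auto simp: P_def)
  have "card P = (\<Sum>e\<in>Kn n. card {f \<in> Kn n. e \<inter> f = {}})"
    by (simp add: P_def)
  also have "\<dots> = (\<Sum>e\<in>Kn n. (n - 2) choose 2)"
  proof (rule sum.cong)
    fix e assume e: "e \<in> Kn n"
    have "{f \<in> Kn n. e \<inter> f = {}} = {f. f \<subseteq> {1..n} - e \<and> card f = 2}"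
      by (auto simp: Kn_eq)
    moreover have "card ({1..n} - e) = n - 2"
      using e by (subst card_Diff_subset) (auto simp: Kn_eq intro: finite_subset)
    ultimately show "card {f \<in> Kn n. e \<inter> f = {}} = (n - 2) choose 2"
      using n_subsets[of "{1..n} - e" 2] by simp
  qed simp
  finally have cP: "card P = (n choose 2) * ((n - 2) choose 2)"
    by (simp add: card_Kn)
  have "card P * tree_count n {e, f} = (\<Sum>p\<in>P. tree_count n {fst p, snd p})"
    using eq by simp
  also have "\<dots> = (\<Sum>T\<in>trees n. card {p \<in> P. {fst p, snd p} \<subseteq> T})"
    by (rule sum_tree_count[OF fP])
  also have "\<dots> \<le> (\<Sum>T\<in>trees n. (n - 1) * (n - 2))"
  proof (rule sum_mono)
    fix T assume T: "T \<in> trees n"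
    have cT: "card T = n - 1" "finite T"
      using T trees_iff[of n T] assms finite_tree by auto
    have "{p \<in> P. {fst p, snd p} \<subseteq> T} \<subseteq> (SIGMA e:T. T - {e})"
      by (auto simp: P_def Kn_eq)
    then have "card {p \<in> P. {fst p, snd p} \<subseteq> T} \<le> card (SIGMA e:T. T - {e})"
      using cT by (intro card_mono) auto
    also have "\<dots> = (n - 1) * (n - 2)"
      using cT by (simp add: numeral_2_eq_2)
    finally show "card {p \<in> P. {fst p, snd p} \<subseteq> T} \<le> (n - 1) * (n - 2)" .
  qed
  finally have le: "card P * tree_count n {e, f} \<le> card (trees n) * ((n - 1) * (n - 2))"
    by simp
  have "4 * card P = (2 * (n choose 2)) * (2 * ((n - 2) choose 2))"
    by (simp add: cP)
  also have "\<dots> = n * (n - 1) * ((n - 2) * (n - 3))"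
    by (simp only: two_choose_two) simp
  finally have "4 * card P = n * (n - 1) * ((n - 2) * (n - 3))" .
  then have "((n - 1) * (n - 2)) * (n * (n - 3) * tree_count n {e, f}) = 4 * (card P * tree_count n {e, f})"
    by (simp add: mult_ac)
  also have "\<dots> \<le> ((n - 1) * (n - 2)) * (4 * card (trees n))"
    using le by (simp add: mult_ac)
  finally show ?thesis
    using assms(1) by simp
qed

lemma reach_Diff_edge:
  assumes "u \<in> reach E v"
  shows "u \<in> reach (E - {{v, y}}) v \<or> u \<in> reach (E - {{v, y}}) y"
  using assms
proof (induction rule: reach_induct)
  case (step x z)
  show ?case
  proof (cases "{x, z} = {v, y}")
    case True
    then show ?thesis by (auto simp: doubleton_eq_iff)
  next
    case False
    then have "{x, z} \<in> E - {{v, y}}" using step by simp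
    then show ?thesis using step.IH reach_step by metis
  qed
qed simp

text \<open>
  Edges at a vertex that cannot be reached are not used either.
\<close>
lemma reach_avoiding_vertex:
  assumes "w \<in> reach E y" "v \<notin> reach E y"
  shows "w \<in> reach {e \<in> E. v \<notin> e} y"
  using assms(1)
proof (induction rule: reach_induct)
  case (step x z)
  have "z \<in> reach E y"
    using step.hyps by (metis reach_step)
  then have "{x, z} \<in> {e \<in> E. v \<notin> e}"
    using step assms(2) by auto
  then show ?case using step.IH reach_step by metis
qed simp

lemma reach_in_Kn:
  assumes "E \<subseteq> Kn n" "y \<in> {1..n}"
  shows "reach E y \<subseteq> {1..n}"
proof
  fix w assume "w \<in> reach E y"
  then show "w \<in> {1..n}"
    using assms(2)
  proof (rule reach_closed)
    show "\<forall>e\<in>E. e \<subseteq> {1..n}"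
      using assms(1) by (auto simp: Kn_eq)
  qed
qed

lemma trees_bridge:
  assumes "T \<in> trees n" "{a, b} \<in> T"
  shows "b \<notin> reach (T - {{a, b}}) a" "a \<notin> reach (T - {{a, b}}) b"
proof -
  have "is_tree (fst (complete_graph n), T)"
    using assms(1) by (simp add: spanning_trees_def)
  then show "b \<notin> reach (T - {{a, b}}) a"
    using assms(2) by (rule tree_bridge)
  then show "a \<notin> reach (T - {{a, b}}) b"
    using reach_sym[of a "T - {{a, b}}" b] by blast
qed

text \<open>
  Removing \<open>{v, y}\<close> splits the tree into the side of \<open>y\<close> and the side of \<open>v\<close>, and any edge from \<open>y\<close> to
  the latter reconnects it.
\<close>
lemma tree_exchange:
  assumes "n \<ge> 1" "T \<in> trees n" "{v, y} \<in> T" "w \<in> {1..n}" "w \<notin> reach (T - {{v, y}}) y"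
  shows "insert {y, w} (T - {{v, y}}) \<in> trees n"
proof -
  let ?E = "T - {{v, y}}" and ?T = "insert {y, w} (T - {{v, y}})"
  have T: "T \<subseteq> Kn n" "connected_graph ({1..n}, T)" "Suc (card T) = n" "finite T"
    using assms(1,2) trees_iff[of n T] finite_tree[of T n] by auto
  have vy: "v \<in> {1..n}" "y \<in> {1..n}" "v \<noteq> y"
    using T(1) assms(3) in_Kn_pair by auto
  have side: "u \<in> reach ?E v \<or> u \<in> reach ?E y" if "u \<in> {1..n}" for u
    using connected_graphD[OF T(2) vy(1) that] by (rule reach_Diff_edge)
  have "{y, w} \<notin> ?E"
    using assms(5) reach_edge by metis
  then have "card ?T = card T"
    using card_Suc_Diff1[OF T(4) assms(3)] T(4) by (simp del: card_Diff_insert)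
  moreover have "w \<noteq> y"
    using assms(5) reach_refl by metis
  then have "?T \<subseteq> Kn n"
    using T(1) assms(4) vy by (auto simp: in_Kn_pair simp del: fst_conv snd_conv)
  moreover have "u \<in> reach ?T y" if "u \<in> {1..n}" for u
  proof -
    have m: "reach ?E x \<subseteq> reach ?T x" for x
      by (rule reach_mono) auto
    have yw: "w \<in> reach ?T y"
      by (rule reach_edge) simp
    have "w \<in> reach ?E v"
      using side[OF assms(4)] assms(5) by simp
    then have "v \<in> reach ?T y"
      using m[of w] reach_sym[of w] yw reach_trans[OF yw, of v] by auto
    then show ?thesis
      using side[OF that] m[of y] m[of v] reach_trans[of v ?T y u] by auto
  qed note to_y = this
  have "connected_graph ({1..n}, ?T)"
    unfolding connected_graph_reach
  proof (intro ballI subsetI)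
    fix u u' assume "u \<in> {1..n}" "u' \<in> {1..n}"
    then show "u' \<in> reach ?T u"
      using reach_trans[OF reach_sym[OF to_y[of u]] to_y[of u']] by simp
  qed
  ultimately show ?thesis
    using trees_iff[OF assms(1)] T(3) by simp
qed

text \<open>
  The exchanged edge can be recovered from the new tree: it is the first edge on the path from \<open>y\<close> to
  \<open>v\<close>.  The proof expresses this without paths: if \<open>{y, w1}\<close> and \<open>{y, w2}\<close> were both present and
  different, then \<open>v\<close>, \<open>w1\<close>, \<open>y\<close> would still be joined after the removal of \<open>{y, w2}\<close>.
\<close>
lemma tree_exchange_inj:
  assumes "n \<ge> 1" "T1 \<in> trees n" "T2 \<in> trees n" "{v, y} \<in> T1" "{v, y} \<in> T2"
    "w1 \<in> {1..n}" "w2 \<in> {1..n}"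
    "w1 \<notin> reach (T1 - {{v, y}}) y" "w2 \<notin> reach (T2 - {{v, y}}) y"
    "insert {y, w1} (T1 - {{v, y}}) = insert {y, w2} (T2 - {{v, y}})"
  shows "T1 = T2 \<and> w1 = w2"
proof -
  let ?E1 = "T1 - {{v, y}}" and ?E2 = "T2 - {{v, y}}"
  have n1: "{y, w1} \<notin> ?E1" and n2: "{y, w2} \<notin> ?E2"
    using assms(8,9) reach_edge[of y w1 ?E1] reach_edge[of y w2 ?E2] by auto
  have "w1 = w2"
  proof (rule ccontr)
    assume ne: "w1 \<noteq> w2"
    then have ne': "{y, w1} \<noteq> {y, w2}"
      by (auto simp: doubleton_eq_iff)
    have "{y, w1} \<in> insert {y, w2} ?E2"
      unfolding assms(10)[symmetric] by (rule insertI1)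
    then have E12: "{y, w1} \<in> ?E2"
      using ne' by (metis insertE)
    have v1: "v \<notin> reach ?E1 y" and v2: "v \<notin> reach ?E2 y"
      using trees_bridge(2)[OF assms(2,4)] trees_bridge(2)[OF assms(3,5)] by simp_all
    have "w1 \<in> reach ?E1 v"
    proof -
      have "v \<in> {1..n}"
        using tree_subset[OF assms(2)] assms(4) in_Kn_pair by blast
      then have "w1 \<in> reach T1 v"
        using assms(1,2,6) trees_iff[of n T1] connected_graphD by metis
      then show ?thesis
        using reach_Diff_edge[of w1 T1 v y] assms(8) by simp
    qed
    moreover have "y \<notin> reach ?E1 v"
      using v1 reach_sym by metis
    ultimately have "w1 \<in> reach {e \<in> ?E1. y \<notin> e} v"
      by (rule reach_avoiding_vertex)
    moreover have "{e \<in> ?E1. y \<notin> e} \<subseteq> ?E2"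
    proof
      fix e assume "e \<in> {e \<in> ?E1. y \<notin> e}"
      then have "e \<in> insert {y, w2} ?E2" "e \<noteq> {y, w2}"
        unfolding assms(10)[symmetric] by blast+
      then show "e \<in> ?E2" by (simp only: insert_iff simp_thms)
    qed
    ultimately have "w1 \<in> reach ?E2 v"
      by (metis reach_mono subsetD)
    then have "v \<in> reach ?E2 y"
      by (rule reach_trans[OF reach_edge[OF E12] reach_sym])
    with v2 show False ..
  qed
  moreover from this have "?E1 = ?E2"
    using assms(10) n1 n2 insert_ident[of "{y, w1}" ?E1 ?E2] by simp
  then have "T1 = T2"
    using insert_Diff[OF assms(4)] insert_Diff[OF assms(5)] by metis
  ultimately show ?thesis by simp
qed

text \<open>
  Double counting of the exchanges: a tree whose \<open>y\<close>-side contains at most half of the vertices has at least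
  \<open>n / 2\<close> exchanges, and each of them leads to a different tree through \<open>{v, x}\<close>.
\<close>
lemma tree_count_switch:
  assumes "n \<ge> 1" "x \<noteq> y"
  shows "card {T \<in> trees n. {v, x} \<in> T \<and> {v, y} \<in> T \<and> 2 * card (reach (T - {{v, y}}) y) \<le> n} * n
    \<le> 2 * tree_count n {{v, x}}"
proof -
  define A where "A = {T \<in> trees n. {v, x} \<in> T \<and> {v, y} \<in> T \<and> 2 * card (reach (T - {{v, y}}) y) \<le> n}"
  define Z where "Z = (SIGMA T:A. {1..n} - reach (T - {{v, y}}) y)"
  have fA: "finite A" by (simp add: A_def)
  have "card Z \<le> tree_count n {{v, x}}"
    unfolding tree_count_def
  proof (rule card_inj_on_le)
    show "inj_on (\<lambda>(T, w). insert {y, w} (T - {{v, y}})) Z"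
    proof (rule inj_onI)
      fix p q assume p: "p \<in> Z" and q: "q \<in> Z"
        and eq: "(case p of (T, w) \<Rightarrow> insert {y, w} (T - {{v, y}})) = (case q of (T, w) \<Rightarrow> insert {y, w} (T - {{v, y}}))"
      obtain T1 w1 T2 w2 where pq: "p = (T1, w1)" "q = (T2, w2)"
        by (cases p, cases q)
      have "T1 \<in> trees n" "T2 \<in> trees n" "{v, y} \<in> T1" "{v, y} \<in> T2" "w1 \<in> {1..n}" "w2 \<in> {1..n}"
        "w1 \<notin> reach (T1 - {{v, y}}) y" "w2 \<notin> reach (T2 - {{v, y}}) y"
        using p q by (simp_all add: pq Z_def A_def)
      from tree_exchange_inj[OF assms(1) this] eq show "p = q"
        by (simp add: pq)
    qed
    show "(\<lambda>(T, w). insert {y, w} (T - {{v, y}})) ` Z \<subseteq> {T \<in> trees n. {{v, x}} \<subseteq> T}"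
    proof (rule image_subsetI)
      fix p assume p: "p \<in> Z"
      obtain T w where pq: "p = (T, w)"
        by (cases p)
      have T: "T \<in> trees n" "{v, x} \<in> T" "{v, y} \<in> T" "w \<in> {1..n}" "w \<notin> reach (T - {{v, y}}) y"
        using p by (simp_all add: pq Z_def A_def)
      have "{v, x} \<noteq> {v, y}"
        using assms(2) by (auto simp: doubleton_eq_iff)
      then show "(case p of (T, w) \<Rightarrow> insert {y, w} (T - {{v, y}})) \<in> {T \<in> trees n. {{v, x}} \<subseteq> T}"
        using tree_exchange[OF assms(1) T(1,3-5)] T(2) by (simp add: pq)
    qed
  qed simp
  moreover have "card A * n \<le> 2 * card Z"
  proof -
    have "n \<le> 2 * card ({1..n} - reach (T - {{v, y}}) y)" if "T \<in> A" for T
    proof -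
      have T: "T \<in> trees n" "{v, y} \<in> T" "2 * card (reach (T - {{v, y}}) y) \<le> n"
        using that by (auto simp: A_def)
      have "{v, y} \<in> Kn n" "T - {{v, y}} \<subseteq> Kn n"
        using tree_subset[OF T(1)] T(2) by blast+
      then have "reach (T - {{v, y}}) y \<subseteq> {1..n}"
        using reach_in_Kn in_Kn_pair by metis
      then show ?thesis
        using T(3) by (subst card_Diff_subset) (auto intro: finite_subset)
    qed
    then have "card A * n \<le> (\<Sum>T\<in>A. 2 * card ({1..n} - reach (T - {{v, y}}) y))"
      using sum_bounded_below[of A n "\<lambda>T. 2 * card ({1..n} - reach (T - {{v, y}}) y)"] by simp
    also have "\<dots> = 2 * card Z"
      using fA by (simp add: Z_def sum_distrib_left)
    finally show ?thesis .
  qed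
  ultimately show ?thesis
    by (simp add: A_def)
qed

text \<open>
  The sides of \<open>x\<close> and \<open>y\<close> seen from \<open>v\<close> are disjoint, so one of them is small enough for
  \<open>tree_count_switch\<close>.  Symmetry alone does not bound the number of trees through two adjacent edges,
  since a tree could have most of its edges at one vertex.
\<close>
lemma tree_count_adjacent:
  assumes "n \<ge> 2" "{v, x} \<in> Kn n" "{v, y} \<in> Kn n" "x \<noteq> y"
  shows "n * n * tree_count n {{v, x}, {v, y}} \<le> 8 * card (trees n)"
proof -
  define A where "A = (\<lambda>x y. {T \<in> trees n. {v, x} \<in> T \<and> {v, y} \<in> T \<and> 2 * card (reach (T - {{v, y}}) y) \<le> n})"
  have "{T \<in> trees n. {{v, x}, {v, y}} \<subseteq> T} \<subseteq> A x y \<union> A y x"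
  proof
    fix T assume "T \<in> {T \<in> trees n. {{v, x}, {v, y}} \<subseteq> T}"
    then have T: "T \<in> trees n" "{v, x} \<in> T" "{v, y} \<in> T" by auto
    let ?Y = "reach (T - {{v, y}}) y" and ?X = "reach (T - {{v, x}}) x"
    have br: "v \<notin> ?X" "v \<notin> ?Y"
      using trees_bridge(2)[OF T(1,2)] trees_bridge(2)[OF T(1,3)] by simp_all
    have disj: "?X \<inter> ?Y = {}"
    proof (rule ccontr)
      assume "?X \<inter> ?Y \<noteq> {}"
      then obtain w where w: "w \<in> ?X" "w \<in> ?Y" by auto
      have "w \<in> reach {e \<in> T - {{v, y}}. v \<notin> e} y"
        using w br by (intro reach_avoiding_vertex) auto
      moreover have "{e \<in> T - {{v, y}}. v \<notin> e} \<subseteq> T - {{v, x}}" by auto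
      ultimately have wy: "w \<in> reach (T - {{v, x}}) y"
        by (metis reach_mono subsetD)
      have "{y, v} \<in> T - {{v, x}}"
        using T assms(4) by (auto simp: doubleton_eq_iff insert_commute)
      then have "v \<in> reach (T - {{v, x}}) y" by (rule reach_edge)
      then have "v \<in> ?X"
        by (rule reach_trans[OF reach_trans[OF w(1) reach_sym[OF wy]]])
      then show False
        using br(1) by simp
    qed
    have sub: "?X \<subseteq> {1..n}" "?Y \<subseteq> {1..n}"
    proof -
      have "T - {{v, x}} \<subseteq> Kn n" "T - {{v, y}} \<subseteq> Kn n"
        using tree_subset[OF T(1)] by blast+
      then show "?X \<subseteq> {1..n}" "?Y \<subseteq> {1..n}"
        using reach_in_Kn assms(2,3) in_Kn_pair by metis+
    qed
    have "card ?X + card ?Y = card (?X \<union> ?Y)"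
      using disj sub by (intro card_Un_disjoint[symmetric]) (auto intro: finite_subset)
    also have "\<dots> \<le> card {1..n}"
      using sub by (intro card_mono) auto
    finally have "card ?X + card ?Y \<le> n" by simp
    then have "2 * card ?X \<le> n \<or> 2 * card ?Y \<le> n" by linarith
    then show "T \<in> A x y \<union> A y x"
      using T by (auto simp: A_def)
  qed
  then have "tree_count n {{v, x}, {v, y}} \<le> card (A x y \<union> A y x)"
    unfolding tree_count_def by (intro card_mono) (auto simp: A_def)
  also have "\<dots> \<le> card (A x y) + card (A y x)"
    by (rule card_Un_le)
  finally have le: "tree_count n {{v, x}, {v, y}} \<le> card (A x y) + card (A y x)" .
  have "n * n * tree_count n {{v, x}, {v, y}} \<le> n * n * (card (A x y) + card (A y x))"
    using le by (rule mult_le_mono2)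
  also have "\<dots> = n * (card (A x y) * n) + n * (card (A y x) * n)"
    by (simp add: algebra_simps)
  also have "\<dots> \<le> n * (2 * tree_count n {{v, x}}) + n * (2 * tree_count n {{v, y}})"
    using tree_count_switch[of n x y v] tree_count_switch[of n y x v] assms
    by (intro add_mono mult_le_mono2) (auto simp: A_def)
  also have "\<dots> = 8 * card (trees n)"
    using tree_count_edge[OF assms(1,2)] tree_count_edge[OF assms(1,3)] by simp
  finally show ?thesis .
qed

section \<open>Edges of a uniform random spanning tree\<close>

definition tree_avg :: "nat \<Rightarrow> (nat set set \<Rightarrow> real) \<Rightarrow> real" where
  "tree_avg n g = (\<Sum>T\<in>trees n. g T) / card (trees n)"

lemma card_trees_pos: "card (trees n) > 0"
  using spanning_trees_nonempty[of n] by (simp add: card_gt_0_iff)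

lemma trees_nonempty [simp]: "trees n \<noteq> {}"
  by (rule spanning_trees_nonempty)

lemma tree_avg_mono: "(\<And>T. T \<in> trees n \<Longrightarrow> f T \<le> g T) \<Longrightarrow> tree_avg n f \<le> tree_avg n g"
  unfolding tree_avg_def by (intro divide_right_mono sum_mono) auto

lemma tree_avg_cong: "(\<And>T. T \<in> trees n \<Longrightarrow> f T = g T) \<Longrightarrow> tree_avg n f = tree_avg n g"
  unfolding tree_avg_def by (intro arg_cong2[where f = "(/)"] sum.cong) auto

lemma tree_avg_const [simp]: "tree_avg n (\<lambda>T. c) = c"
  using spanning_trees_nonempty[of n] by (simp add: tree_avg_def)

lemma tree_avg_add: "tree_avg n (\<lambda>T. f T + g T) = tree_avg n f + tree_avg n g"
  by (simp add: tree_avg_def sum.distrib add_divide_distrib)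

lemma tree_avg_diff: "tree_avg n (\<lambda>T. f T - g T) = tree_avg n f - tree_avg n g"
  by (simp add: tree_avg_def sum_subtractf diff_divide_distrib)

lemma tree_avg_mult: "tree_avg n (\<lambda>T. c * f T) = c * tree_avg n f"
  by (simp add: tree_avg_def sum_distrib_left)

lemma tree_avg_sum: "tree_avg n (\<lambda>T. \<Sum>i\<in>I. f i T) = (\<Sum>i\<in>I. tree_avg n (f i))"
  unfolding tree_avg_def by (subst sum.swap) (simp add: sum_divide_distrib)

lemma tree_avg_count: "tree_avg n (\<lambda>T. of_bool (S \<subseteq> T)) = tree_count n S / card (trees n)"
  by (simp add: tree_avg_def tree_count_def Int_def)

lemma tree_avg_count_le:
  assumes "real m * tree_count n S \<le> real c * card (trees n)" "m > 0"
  shows "tree_avg n (\<lambda>T. of_bool (S \<subseteq> T)) \<le> c / m"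
proof -
  have "t / N \<le> c / m" if "m * t \<le> c * N" "N > 0" "m > 0" for t N c m :: real
    using that by (simp add: field_simps)
  from this[OF assms(1)] show ?thesis
    unfolding tree_avg_count using assms(2) card_trees_pos[of n] by simp
qed

lemma tree_avg_edge:
  assumes "n \<ge> 2" "e \<in> Kn n"
  shows "tree_avg n (\<lambda>T. of_bool (e \<in> T)) = 2 / n"
proof -
  have "real n * tree_count n {e} = 2 * card (trees n)"
    using tree_count_edge[OF assms] by (metis of_nat_mult of_nat_numeral)
  moreover have div: "t / N = 2 / m" if "m * t = 2 * N" "N > 0" "m > 0" for t N m :: real
    using that by (subst frac_eq_eq) (simp_all add: mult.commute)
  ultimately have "tree_count n {e} / real (card (trees n)) = 2 / real n"
    using card_trees_pos[of n] assms(1) by (intro div) simp_all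
  moreover have "tree_avg n (\<lambda>T. of_bool ({e} \<subseteq> T)) = tree_avg n (\<lambda>T. of_bool (e \<in> T))"
    by simp
  ultimately show ?thesis
    by (simp only: tree_avg_count)
qed

lemma tree_avg_disjoint:
  assumes "n \<ge> 4" "e \<in> Kn n" "f \<in> Kn n" "e \<inter> f = {}"
  shows "tree_avg n (\<lambda>T. of_bool (e \<in> T \<and> f \<in> T)) \<le> 4 / (n * (real n - 3))"
proof -
  have "n * (n - 3) * tree_count n {e, f} \<le> 4 * card (trees n)"
    using assms by (intro tree_count_disjoint) auto
  then have "real (n * (n - 3) * tree_count n {e, f}) \<le> real (4 * card (trees n))"
    by (rule of_nat_mono)
  then have "tree_avg n (\<lambda>T. of_bool ({e, f} \<subseteq> T)) \<le> real 4 / real (n * (n - 3))"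
    using assms(1) by (intro tree_avg_count_le) simp_all
  then show ?thesis
    using assms(1) by simp
qed

lemma tree_avg_pair:
  assumes "n \<ge> 6" "e \<in> Kn n" "f \<in> Kn n" "e \<noteq> f"
  shows "tree_avg n (\<lambda>T. of_bool (e \<in> T \<and> f \<in> T)) \<le> 8 / (n * n)"
proof (cases "e \<inter> f = {}")
  case True
  have "4 / (n * (real n - 3)) \<le> 8 / (n * n)"
    using assms(1) by (simp add: field_simps)
  then show ?thesis
    using tree_avg_disjoint[of n e f] True assms by simp
next
  case False
  then obtain v where v: "v \<in> e" "v \<in> f" by blast
  obtain x where x: "e = {v, x}" "x \<noteq> v"
    using v(1) assms(2) by (elim Kn_pairE) auto
  obtain y where y: "f = {v, y}" "y \<noteq> v"
    using v(2) assms(3) by (elim Kn_pairE) auto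
  have "n * n * tree_count n {{v, x}, {v, y}} \<le> 8 * card (trees n)"
    using assms x y by (intro tree_count_adjacent) auto
  then have "real (n * n * tree_count n {e, f}) \<le> real (8 * card (trees n))"
    unfolding x y by (rule of_nat_mono)
  then have "tree_avg n (\<lambda>T. of_bool ({e, f} \<subseteq> T)) \<le> real 8 / real (n * n)"
    using assms(1) by (intro tree_avg_count_le) simp_all
  then show ?thesis
    by simp
qed

text \<open>
  In the union bound below, the other edges of \<open>A\<close> cost at most \<open>card A * 8 / n\<^sup>2 \<le> 1 / n\<close> of the
  probability \<open>2 / n\<close> that \<open>e\<close> is offered.
\<close>
lemma tree_avg_only:
  assumes "n \<ge> 6" "A \<subseteq> Kn n" "8 * card A \<le> n" "e \<in> A"
  shows "1 / n \<le> tree_avg n (\<lambda>T. of_bool (T \<inter> A = {e}))"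
proof -
  have fA: "finite A" using assms(2) finite_Kn finite_subset by blast
  have "2 / n - (\<Sum>f\<in>A - {e}. 8 / (real n * n)) \<le>
      2 / n - (\<Sum>f\<in>A - {e}. tree_avg n (\<lambda>T. of_bool (e \<in> T \<and> f \<in> T)))"
    using assms by (intro diff_left_mono sum_mono tree_avg_pair) auto
  also have "\<dots> = tree_avg n (\<lambda>T. of_bool (e \<in> T) - (\<Sum>f\<in>A - {e}. of_bool (e \<in> T \<and> f \<in> T)))"
    using tree_avg_edge[of n e] assms by (simp only: tree_avg_diff tree_avg_sum) auto
  also have "\<dots> \<le> tree_avg n (\<lambda>T. of_bool (T \<inter> A = {e}))"
  proof (rule tree_avg_mono)
    fix T
    show "of_bool (e \<in> T) - (\<Sum>f\<in>A - {e}. of_bool (e \<in> T \<and> f \<in> T)) \<le> (of_bool (T \<inter> A = {e}) :: real)"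
    proof (cases "e \<in> T \<and> T \<inter> A \<noteq> {e}")
      case True
      then obtain f where f: "f \<in> A - {e}" "f \<in> T"
        using assms(4) by auto
      have "(of_bool (e \<in> T \<and> f \<in> T) :: real) \<le> (\<Sum>f\<in>A - {e}. of_bool (e \<in> T \<and> f \<in> T))"
        using f fA by (intro member_le_sum) auto
      then show ?thesis using True f by simp
    next
      case False
      have "(0::real) \<le> (\<Sum>f\<in>A - {e}. of_bool (e \<in> T \<and> f \<in> T))"
        by (intro sum_nonneg) auto
      then show ?thesis using False by (auto simp del: sum_of_bool_eq)
    qed
  qed
  finally have "2 / n - real (card (A - {e})) * (8 / (real n * n)) \<le> tree_avg n (\<lambda>T. of_bool (T \<inter> A = {e}))"
    by simp
  moreover have "real (card (A - {e})) * (8 / (real n * n)) \<le> 1 / n"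
  proof -
    have "card (A - {e}) \<le> card A" using fA by (intro card_mono) auto
    then have "real (8 * card (A - {e})) \<le> real n"
      using assms(3) by (intro of_nat_mono) linarith
    then show ?thesis
      using assms(1) by (simp add: field_simps)
  qed
  ultimately show ?thesis by (simp add: field_simps)
qed

text \<open>
  The events of \<open>tree_avg_only\<close> for the edges of a subset with \<open>n div 8\<close> elements are disjoint, and each
  of them has probability at least \<open>1 / n\<close>.
\<close>
lemma tree_avg_hit:
  assumes "n \<ge> 8" "A \<subseteq> Kn n" "n \<le> 8 * card A"
  shows "1 / 16 \<le> tree_avg n (\<lambda>T. of_bool (T \<inter> A \<noteq> {}))"
proof -
  have "n div 8 \<le> card A"
    using assms(3) by linarith
  then obtain B where B: "B \<subseteq> A" "card B = n div 8" "finite B"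
    by (rule obtain_subset_with_card_n)
  have n16: "n \<le> 16 * (n div 8)"
    using assms(1) by presburger
  have "1 / 16 \<le> (\<Sum>e\<in>B. 1 / real n)"
  proof -
    have "real n \<le> real (16 * (n div 8))" using n16 by (rule of_nat_mono)
    then have "real n \<le> 16 * real (card B)" using B(2) by simp
    then show ?thesis
      using assms(1) by (simp add: field_simps)
  qed
  also have "\<dots> \<le> (\<Sum>e\<in>B. tree_avg n (\<lambda>T. of_bool (T \<inter> B = {e})))"
    using B assms by (intro sum_mono tree_avg_only) auto
  also have "\<dots> = tree_avg n (\<lambda>T. \<Sum>e\<in>B. of_bool (T \<inter> B = {e}))"
    by (rule tree_avg_sum[symmetric])
  also have "\<dots> \<le> tree_avg n (\<lambda>T. of_bool (T \<inter> A \<noteq> {}))"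
  proof (rule tree_avg_mono)
    fix T
    show "(\<Sum>e\<in>B. of_bool (T \<inter> B = {e})) \<le> (of_bool (T \<inter> A \<noteq> {}) :: real)"
    proof (cases "\<exists>e\<in>B. T \<inter> B = {e}")
      case True
      then obtain e where e: "e \<in> B" "T \<inter> B = {e}" by blast
      then have "(\<Sum>f\<in>B. of_bool (T \<inter> B = {f})) = (\<Sum>f\<in>B. of_bool (f = e) :: real)"
        by (intro sum.cong) auto
      also have "\<dots> = 1"
        using e B(3) by (simp add: of_bool_def if_distrib sum.delta)
      finally show ?thesis
        using e B(1) by auto
    next
      case False
      then have "(\<Sum>f\<in>B. of_bool (T \<inter> B = {f})) = (0::real)"
        by (intro sum.neutral) auto
      then show ?thesis by (simp del: sum_of_bool_eq)
    qed
  qed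
  finally show ?thesis .
qed

lemma card_incident_Kn:
  assumes "A \<subseteq> Kn n"
  shows "card {e \<in> A. v \<in> e} \<le> n"
proof -
  have "{e \<in> A. v \<in> e} \<subseteq> (\<lambda>w. {v, w}) ` {1..n}"
  proof
    fix e assume "e \<in> {e \<in> A. v \<in> e}"
    then have "e \<in> Kn n" "v \<in> e" using assms by auto
    then show "e \<in> (\<lambda>w. {v, w}) ` {1..n}"
      by (elim Kn_pairE) (auto simp: insert_commute)
  qed
  then have "card {e \<in> A. v \<in> e} \<le> card ((\<lambda>w. {v, w}) ` {1..n})"
    by (intro card_mono) auto
  also have "\<dots> \<le> card {1..n}" by (rule card_image_le) simp
  finally show ?thesis by simp
qed

text \<open>
  Chebyshev's inequality for the number of edges of \<open>A\<close> in the tree.  Pairs of disjoint edges are almost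
  uncorrelated, and an edge is adjacent to at most \<open>2 * n\<close> others, so the variance is of the order of
  the mean.
\<close>
lemma tree_avg_miss:
  assumes "n \<ge> 6" "A \<subseteq> Kn n" "A \<noteq> {}"
  shows "tree_avg n (\<lambda>T. of_bool (T \<inter> A = {})) \<le> 8 * n / card A"
proof -
  have fA: "finite A" using assms(2) finite_Kn finite_subset by blast
  define M where "M = real (card A)"
  define N where "N = real n"
  define X where "X = (\<lambda>T. \<Sum>e\<in>A. of_bool (e \<in> T) :: real)"
  define p where "p = tree_avg n (\<lambda>T. of_bool (T \<inter> A = {}))"
  have M: "M > 0" using fA assms(3) by (simp add: M_def card_gt_0_iff)
  have N: "N \<ge> 6" using assms(1) by (simp add: N_def)
  have EX: "tree_avg n X = M * (2 / N)"
    using tree_avg_edge[of n] assms(1,2) unfolding X_def tree_avg_sum M_def N_def by (simp add: subset_iff)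
  have row: "(\<Sum>f\<in>A. tree_avg n (\<lambda>T. of_bool (e \<in> T \<and> f \<in> T))) \<le> 18 / N + M * (4 / (N * (N - 3)))"
    if e: "e \<in> A" for e
  proof -
    define B where "B = {f \<in> A. e \<inter> f \<noteq> {}}"
    have eK: "e \<in> Kn n" using e assms(2) by auto
    obtain a b where ab: "e = {a, b}" using eK by (rule Kn_pairE)
    have "card B \<le> card ({f \<in> A. a \<in> f} \<union> {f \<in> A. b \<in> f})"
      using fA ab by (intro card_mono) (auto simp: B_def)
    also have "\<dots> \<le> card {f \<in> A. a \<in> f} + card {f \<in> A. b \<in> f}"
      by (rule card_Un_le)
    also have "\<dots> \<le> n + n"
      by (intro add_mono card_incident_Kn[OF assms(2)])
    finally have cB: "real (card B) \<le> 2 * N" by (simp add: N_def)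
    have eB: "e \<in> B" "B \<subseteq> A" "finite B" using e fA ab by (auto simp: B_def)
    have "(\<Sum>f\<in>A. tree_avg n (\<lambda>T. of_bool (e \<in> T \<and> f \<in> T))) =
       (\<Sum>f\<in>A - B. tree_avg n (\<lambda>T. of_bool (e \<in> T \<and> f \<in> T))) +
       ((\<Sum>f\<in>B - {e}. tree_avg n (\<lambda>T. of_bool (e \<in> T \<and> f \<in> T))) + tree_avg n (\<lambda>T. of_bool (e \<in> T)))"
      using sum.subset_diff[OF eB(2) fA, of "\<lambda>f. tree_avg n (\<lambda>T. of_bool (e \<in> T \<and> f \<in> T))"]
        sum.remove[OF eB(3,1), of "\<lambda>f. tree_avg n (\<lambda>T. of_bool (e \<in> T \<and> f \<in> T))"] by simp
    also have "\<dots> \<le> (\<Sum>f\<in>A - B. 4 / (N * (N - 3))) + ((\<Sum>f\<in>B - {e}. 8 / (N * N)) + 2 / N)"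
    proof (intro add_mono sum_mono)
      fix f assume "f \<in> A - B"
      then show "tree_avg n (\<lambda>T. of_bool (e \<in> T \<and> f \<in> T)) \<le> 4 / (N * (N - 3))"
        using tree_avg_disjoint[of n e f] eK assms(1,2) by (auto simp: B_def N_def)
    next
      fix f assume "f \<in> B - {e}"
      then show "tree_avg n (\<lambda>T. of_bool (e \<in> T \<and> f \<in> T)) \<le> 8 / (N * N)"
        using tree_avg_pair[of n e f] eK assms(1,2) by (auto simp: B_def N_def)
    next
      show "tree_avg n (\<lambda>T. of_bool (e \<in> T)) \<le> 2 / N"
        using tree_avg_edge[of n e] eK assms(1) by (simp add: N_def)
    qed
    also have "\<dots> = real (card (A - B)) * (4 / (N * (N - 3))) + (real (card (B - {e})) * (8 / (N * N)) + 2 / N)"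
      by simp
    also have "\<dots> \<le> M * (4 / (N * (N - 3))) + ((2 * N) * (8 / (N * N)) + 2 / N)"
    proof (intro add_mono mult_right_mono)
      show "real (card (A - B)) \<le> M"
        unfolding M_def using fA by (intro of_nat_mono card_mono) auto
      have "card (B - {e}) \<le> card B"
        using eB by (intro card_mono) auto
      then show "real (card (B - {e})) \<le> 2 * N"
        using cB by linarith
    qed (use N in auto)
    also have "\<dots> = 18 / N + M * (4 / (N * (N - 3)))"
      using N by (simp add: field_simps)
    finally show ?thesis .
  qed
  have sq: "X T * X T = (\<Sum>e\<in>A. \<Sum>f\<in>A. of_bool (e \<in> T \<and> f \<in> T))" for T
    unfolding X_def sum_product by (intro sum.cong refl) auto
  have EXX: "tree_avg n (\<lambda>T. X T * X T) \<le> M * (18 / N + M * (4 / (N * (N - 3))))"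
  proof -
    have "tree_avg n (\<lambda>T. X T * X T) = (\<Sum>e\<in>A. \<Sum>f\<in>A. tree_avg n (\<lambda>T. of_bool (e \<in> T \<and> f \<in> T)))"
      unfolding sq tree_avg_sum ..
    also have "\<dots> \<le> (\<Sum>e\<in>A. 18 / N + M * (4 / (N * (N - 3))))"
      using row by (rule sum_mono)
    also have "\<dots> = M * (18 / N + M * (4 / (N * (N - 3))))"
      by (simp add: M_def)
    finally show ?thesis .
  qed
  \<comment> \<open>The mean of \<open>X\<close>; on the event that no edge of \<open>A\<close> is present, \<open>X\<close> deviates from it by \<open>?\<mu>\<close>.\<close>
  let ?\<mu> = "M * (2 / N)"
  have "?\<mu>\<^sup>2 * p = tree_avg n (\<lambda>T. ?\<mu>\<^sup>2 * of_bool (T \<inter> A = {}))"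
    unfolding p_def tree_avg_mult ..
  also have "\<dots> \<le> tree_avg n (\<lambda>T. (X T * X T + ?\<mu>\<^sup>2) - (2 * ?\<mu>) * X T)"
  proof (rule tree_avg_mono)
    fix T
    have *: "(X T * X T + ?\<mu>\<^sup>2) - (2 * ?\<mu>) * X T = (X T - ?\<mu>)\<^sup>2"
      by (simp add: power2_eq_square algebra_simps)
    show "?\<mu>\<^sup>2 * of_bool (T \<inter> A = {}) \<le> (X T * X T + ?\<mu>\<^sup>2) - (2 * ?\<mu>) * X T"
    proof (cases "T \<inter> A = {}")
      case True
      then have "X T = 0"
        unfolding X_def by (intro sum.neutral) auto
      then show ?thesis by simp
    next
      case False
      then show ?thesis unfolding * by simp
    qed
  qed
  also have "\<dots> = tree_avg n (\<lambda>T. X T * X T) + ?\<mu>\<^sup>2 - 2 * ?\<mu> * tree_avg n X"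
    by (simp only: tree_avg_diff tree_avg_add tree_avg_mult tree_avg_const)
  also have "\<dots> = tree_avg n (\<lambda>T. X T * X T) - ?\<mu>\<^sup>2"
    unfolding EX by (simp add: power2_eq_square)
  also have "\<dots> \<le> M * (18 / N + M * (4 / (N * (N - 3)))) - ?\<mu>\<^sup>2"
    using EXX by simp
  also have "\<dots> = 18 * M / N + 12 * (M / (N * N)) * (M / (N - 3))"
    using N by (simp add: field_simps power2_eq_square)
  also have "\<dots> \<le> 18 * M / N + 12 * (1 / 2) * (M / (N - 3))"
  proof -
    have "card A \<le> card (Kn n)"
      using assms(2) by (intro card_mono) auto
    then have "2 * card A \<le> n * (n - 1)"
      using two_choose_two[of n] by (simp add: card_Kn)
    also have "\<dots> \<le> n * n" by simp
    finally have "2 * M \<le> N * N"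
      unfolding M_def N_def by (metis of_nat_le_iff of_nat_mult of_nat_numeral)
    then have "M / (N * N) \<le> 1 / 2"
      using N by (simp add: field_simps)
    then show ?thesis
      using M N by (intro add_mono mult_right_mono mult_left_mono) auto
  qed
  also have "\<dots> \<le> 18 * M / N + 12 * M / N"
    using M N by (simp add: field_simps)
  finally have "?\<mu>\<^sup>2 * p \<le> 30 * M / N"
    using N by (simp add: field_simps)
  then have "p * (4 * M * M / (N * N)) \<le> 30 * M / N"
    by (simp add: power2_eq_square mult_ac)
  then have "p * (4 * M) \<le> 30 * N"
    using M N by (simp add: field_simps)
  then have "p * M \<le> 8 * N"
    using N by linarith
  then show ?thesis
    using M unfolding p_def M_def N_def by (simp add: field_simps)
qed

section \<open>The optimal failure probability\<close>

definition offer :: "nat set set \<Rightarrow> nat set option \<Rightarrow> nat set set" where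
  "offer E c = (case c of None \<Rightarrow> E | Some e \<Rightarrow> insert e E)"

lemma offer_simps [simp]: "offer E None = E" "offer E (Some e) = insert e E"
  by (simp_all add: offer_def)

definition moves :: "nat set set \<Rightarrow> nat set option set" where
  "moves T = insert None (Some ` T)"

text \<open>
  The smallest probability, over all strategies, that the set of built edges is outside the target \<open>Q\<close>
  after \<open>t\<close> more rounds.
\<close>
primrec fail :: "nat \<Rightarrow> nat set set set \<Rightarrow> nat \<Rightarrow> nat set set \<Rightarrow> real" where
  "fail n Q 0 E = of_bool (E \<notin> Q)"
| "fail n Q (Suc t) E = tree_avg n (\<lambda>T. Min ((\<lambda>c. fail n Q t (offer E c)) ` moves T))"

lemma finite_moves: "T \<in> trees n \<Longrightarrow> finite (moves T)"
  using finite_tree by (auto simp: moves_def)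

lemma moves_nonempty: "moves T \<noteq> {}" "None \<in> moves T"
  by (auto simp: moves_def)

text \<open>
  Upper bounds on \<open>fail\<close> come from exhibiting one move per offered tree.
\<close>
lemma fail_Suc_leI:
  assumes "\<And>T. T \<in> trees n \<Longrightarrow> \<exists>c\<in>moves T. fail n Q t (offer E c) \<le> g T"
  shows "fail n Q (Suc t) E \<le> tree_avg n g"
  unfolding fail.simps
proof (rule tree_avg_mono)
  fix T assume T: "T \<in> trees n"
  then obtain c where "c \<in> moves T" "fail n Q t (offer E c) \<le> g T"
    using assms by blast
  then show "Min ((\<lambda>c. fail n Q t (offer E c)) ` moves T) \<le> g T"
    using finite_moves[OF T] by (intro Min.coboundedI[THEN order_trans, of _ "fail n Q t (offer E c)"]) auto
qed

lemma fail_nonneg: "0 \<le> fail n Q t E"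
proof (induction t arbitrary: E)
  case (Suc t)
  have "tree_avg n (\<lambda>T. 0) \<le> fail n Q (Suc t) E"
    unfolding fail.simps
  proof (rule tree_avg_mono)
    fix T assume T: "T \<in> trees n"
    show "0 \<le> Min ((\<lambda>c. fail n Q t (offer E c)) ` moves T)"
      using Suc finite_moves[OF T] moves_nonempty by (subst Min_ge_iff) auto
  qed
  then show ?case by simp
qed simp

lemma fail_Suc_le: "fail n Q (Suc t) E \<le> fail n Q t E"
proof -
  have "fail n Q (Suc t) E \<le> tree_avg n (\<lambda>T. fail n Q t E)"
    by (rule fail_Suc_leI) (use moves_nonempty(2) in force)
  then show ?thesis by simp
qed

lemma fail_antimono: "s \<le> t \<Longrightarrow> fail n Q t E \<le> fail n Q s E"
  by (rule lift_Suc_antimono_le[of "\<lambda>t. fail n Q t E"]) (rule fail_Suc_le)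

lemma fail_le_1: "fail n Q t E \<le> 1"
  using fail_antimono[of 0 t n Q E] by (cases "E \<in> Q") auto

lemma fail_reached: "E \<in> Q \<Longrightarrow> fail n Q t E = 0"
  using fail_antimono[of 0 t n Q E] fail_nonneg[of n Q t E] by simp

text \<open>
  Builder first aims at \<open>Q'\<close> and, from wherever that leads, at \<open>Q\<close>.
\<close>
lemma fail_compose:
  assumes "\<And>E'. E' \<in> Q' \<Longrightarrow> fail n Q t E' \<le> \<epsilon>" "0 \<le> \<epsilon>"
  shows "fail n Q (s + t) E \<le> fail n Q' s E + \<epsilon>"
proof (induction s arbitrary: E)
  case 0
  then show ?case
    using assms fail_le_1[of n Q t E] by (cases "E \<in> Q'") auto
next
  case (Suc s)
  have "fail n Q (Suc (s + t)) E \<le>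
      tree_avg n (\<lambda>T. Min ((\<lambda>c. fail n Q' s (offer E c)) ` moves T) + \<epsilon>)"
  proof (rule fail_Suc_leI)
    fix T assume T: "T \<in> trees n"
    have "Min ((\<lambda>c. fail n Q' s (offer E c)) ` moves T) \<in> (\<lambda>c. fail n Q' s (offer E c)) ` moves T"
      using finite_moves[OF T] moves_nonempty by (intro Min_in) auto
    then obtain c where "c \<in> moves T" "Min ((\<lambda>c. fail n Q' s (offer E c)) ` moves T) = fail n Q' s (offer E c)"
      by auto
    then show "\<exists>c\<in>moves T. fail n Q (s + t) (offer E c) \<le> Min ((\<lambda>c. fail n Q' s (offer E c)) ` moves T) + \<epsilon>"
      using Suc.IH[of "offer E c"] by (intro bexI[of _ c]) auto
  qed
  then show ?case
    by (simp add: tree_avg_add)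
qed

lemma prob_bind_pmf:
  "measure_pmf.prob (bind_pmf M f) A = measure_pmf.expectation M (\<lambda>x. measure_pmf.prob (f x) A)"
proof -
  have "ennreal (measure_pmf.prob (bind_pmf M f) A) = (\<integral>\<^sup>+x. ennreal (measure_pmf.prob (f x) A) \<partial>M)"
    by (simp add: measure_pmf.emeasure_eq_measure[symmetric])
  also have "\<dots> = ennreal (measure_pmf.expectation M (\<lambda>x. measure_pmf.prob (f x) A))"
    by (intro nn_integral_eq_integral measure_pmf.integrable_const_bound[where B = 1]) auto
  finally show ?thesis
    by (simp add: integral_nonneg_AE)
qed

text \<open>
  Plans for \<open>t\<close> rounds in total and plays optimally in each of them; afterwards no edge is chosen, so
  that additional rounds do no harm.
\<close>
definition best_strategy :: "nat \<Rightarrow> nat set set set \<Rightarrow> nat \<Rightarrow> strategy" where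
  "best_strategy n Q t h T =
     (if T \<in> trees n \<and> length h < t
      then (SOME c. c \<in> moves T \<and>
        fail n Q (t - Suc (length h)) (offer (edges (built_graph n h)) c) =
          Min ((\<lambda>c. fail n Q (t - Suc (length h)) (offer (edges (built_graph n h)) c)) ` moves T))
      else None)"

lemma best_strategy_move:
  assumes "T \<in> trees n" "length h < t"
  shows "best_strategy n Q t h T \<in> moves T"
    and "fail n Q (t - Suc (length h)) (offer (edges (built_graph n h)) (best_strategy n Q t h T)) =
          Min ((\<lambda>c. fail n Q (t - Suc (length h)) (offer (edges (built_graph n h)) c)) ` moves T)"
proof -
  let ?f = "\<lambda>c. fail n Q (t - Suc (length h)) (offer (edges (built_graph n h)) c)"
  have "Min (?f ` moves T) \<in> ?f ` moves T"
    using finite_moves[OF assms(1)] moves_nonempty by (intro Min_in) auto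
  then have ex: "\<exists>c. c \<in> moves T \<and> ?f c = Min (?f ` moves T)"
    by fastforce
  from someI_ex[OF ex] show "best_strategy n Q t h T \<in> moves T"
    and "?f (best_strategy n Q t h T) = Min (?f ` moves T)"
    using assms by (simp_all add: best_strategy_def)
qed

lemma valid_best_strategy: "valid_strategy n (best_strategy n Q t)"
  unfolding valid_strategy_def
proof (intro allI ballI impI)
  fix h T e assume T: "T \<in> trees n" and e: "best_strategy n Q t h T = Some e"
  then have "length h < t"
    by (auto simp: best_strategy_def split: if_splits)
  then show "e \<in> T"
    using best_strategy_move(1)[OF T, of h t Q] e by (auto simp: moves_def)
qed

lemma edges_built_graph_snoc:
  "edges (built_graph n (h @ [(T, c)])) = offer (edges (built_graph n h)) c"
  by (cases c) (auto simp: built_graph_def)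

lemma prob_best_strategy:
  assumes "t \<le> length h + m"
  shows "measure_pmf.prob (replicate_pmf m (pmf_of_set (trees n)))
      {Ts. edges (built_graph n (play (best_strategy n Q t) h Ts)) \<notin> Q}
    \<le> fail n Q (t - length h) (edges (built_graph n h))"
  using assms
proof (induction m arbitrary: h)
  case 0
  then show ?case
    by (simp add: measure_return_pmf indicator_def)
next
  case (Suc m)
  let ?\<sigma> = "best_strategy n Q t" and ?E = "edges (built_graph n h)" and ?D = "pmf_of_set (trees n)"
  define next_h where "next_h = (\<lambda>T. h @ [(T, ?\<sigma> h T)])"
  define bad where "bad = (\<lambda>h. {Ts. edges (built_graph n (play ?\<sigma> h Ts)) \<notin> Q})"
  have "measure_pmf.prob (replicate_pmf (Suc m) ?D) (bad h) =
      measure_pmf.expectation ?D (\<lambda>T. measure_pmf.prob (map_pmf (\<lambda>Ts. T # Ts) (replicate_pmf m ?D)) (bad h))"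
    by (simp add: prob_bind_pmf map_pmf_def)
  also have "\<dots> = measure_pmf.expectation ?D (\<lambda>T. measure_pmf.prob (replicate_pmf m ?D) (bad (next_h T)))"
    by (simp add: bad_def next_h_def vimage_def)
  also have "\<dots> = tree_avg n (\<lambda>T. measure_pmf.prob (replicate_pmf m ?D) (bad (next_h T)))"
    by (simp add: integral_pmf_of_set tree_avg_def)
  also have "\<dots> \<le> tree_avg n (\<lambda>T. fail n Q (t - Suc (length h)) (offer ?E (?\<sigma> h T)))"
  proof (rule tree_avg_mono)
    fix T
    show "measure_pmf.prob (replicate_pmf m ?D) (bad (next_h T)) \<le> fail n Q (t - Suc (length h)) (offer ?E (?\<sigma> h T))"
      using Suc.IH[of "next_h T"] Suc.prems
      unfolding bad_def next_h_def edges_built_graph_snoc by simp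
  qed
  also have "\<dots> \<le> fail n Q (t - length h) ?E"
  proof (cases "length h < t")
    case True
    then obtain d where d: "t - length h = Suc d" "t - Suc (length h) = d"
      by (metis Suc_diff_Suc)
    show ?thesis
      unfolding d fail.simps
      by (rule tree_avg_mono) (use best_strategy_move(2)[of _ n h t Q] True d in simp)
  next
    case False
    then have "?\<sigma> h T = None" for T
      by (simp add: best_strategy_def)
    then show ?thesis
      using False by simp
  qed
  finally show ?case
    by (simp add: bad_def)
qed

section \<open>Greedy building\<close>

text \<open>
  Builder takes any missing edge of \<open>A\<close> that is offered.  For the number \<open>M\<close> of missing edges the quantity
  \<open>(1 / x) ^ (M - k)\<close> shrinks in expectation by the factor \<open>1 - p * (1 - x)\<close> per round as long as \<open>k\<close> or
  more edges are missing; this is a Chernoff bound for the number of successful rounds with a free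
  parameter \<open>x\<close>.
\<close>
lemma fail_drift:
  assumes "finite A" "0 < x" "x < 1" "p \<le> 1" "0 \<le> p"
    and hit: "\<And>B. B \<subseteq> A \<Longrightarrow> k \<le> card B \<Longrightarrow> p \<le> tree_avg n (\<lambda>T. of_bool (T \<inter> B \<noteq> {}))"
  shows "fail n {E. card (A - E) < k} t E \<le> (1 - p * (1 - x)) ^ t * (1 / x) ^ (card (A - E) - k)"
proof (induction t arbitrary: E)
  case 0
  have "1 \<le> (1 / x) ^ (card (A - E) - k)"
    using assms(2,3) by (intro one_le_power) (simp add: field_simps)
  then show ?case
    by (auto intro: order_trans)
next
  case (Suc t)
  let ?Q = "{E. card (A - E) < k}"
  define \<rho> where "\<rho> = 1 - p * (1 - x)"
  define W where "W = (1 / x) ^ (card (A - E) - k)"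
  have "p * (1 - x) \<le> 1"
    using assms(2-5) by (intro mult_le_one) auto
  then have \<rho>: "0 \<le> \<rho>" by (simp add: \<rho>_def)
  have W: "0 \<le> W" using assms(2) by (simp add: W_def)
  show ?case
  proof (cases "card (A - E) < k")
    case True
    then show ?thesis
      using fail_reached[of E ?Q n "Suc t"] \<rho> W
      by (simp add: \<rho>_def W_def del: fail.simps)
  next
    case False
    let ?B = "A - E"
    have "fail n ?Q (Suc t) E \<le> tree_avg n (\<lambda>T. (\<rho> ^ t * W) * (1 - (1 - x) * of_bool (T \<inter> ?B \<noteq> {})))"
    proof (rule fail_Suc_leI)
      fix T
      show "\<exists>c\<in>moves T. fail n ?Q t (offer E c) \<le> (\<rho> ^ t * W) * (1 - (1 - x) * of_bool (T \<inter> ?B \<noteq> {}))"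
      proof (cases "T \<inter> ?B = {}")
        case True
        then show ?thesis
          using Suc.IH[of E] by (intro bexI[of _ None]) (auto simp: \<rho>_def W_def moves_def)
      next
        case hit: False
        then obtain e where e: "e \<in> T" "e \<in> ?B" by blast
        have less: "card (A - insert e E) = card ?B - 1"
          using e assms(1) by (metis Diff_insert card_Diff_singleton)
        have "fail n ?Q t (insert e E) \<le> \<rho> ^ t * W * x"
        proof (cases "card ?B = k")
          case True
          moreover have "card ?B > 0"
            using e assms(1) by (auto simp: card_gt_0_iff)
          ultimately have "insert e E \<in> ?Q"
            using less by simp
          then show ?thesis
            using fail_reached[of "insert e E" ?Q n t] \<rho> W assms(2) by simp
        next
          case ne: False
          define d where "d = card ?B - k - 1"
          have d: "card ?B - k = Suc d" "card (A - insert e E) - k = d"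
            unfolding d_def less using False ne by linarith+
          have "fail n ?Q t (insert e E) \<le> \<rho> ^ t * (1 / x) ^ d"
            using Suc.IH[of "insert e E"] unfolding d \<rho>_def .
          also have "(1 / x) ^ d = W * x"
            unfolding W_def d using assms(2) by simp
          finally show ?thesis by (simp add: mult_ac)
        qed
        then show ?thesis
          using e hit by (intro bexI[of _ "Some e"]) (auto simp: moves_def)
      qed
    qed
    also have "\<dots> = (\<rho> ^ t * W) * (1 - (1 - x) * tree_avg n (\<lambda>T. of_bool (T \<inter> ?B \<noteq> {})))"
      by (simp only: tree_avg_mult tree_avg_diff tree_avg_const)
    also have "\<dots> \<le> (\<rho> ^ t * W) * (1 - (1 - x) * p)"
      using hit[of ?B] False assms(3) \<rho> W
      by (intro mult_left_mono diff_left_mono mult_nonneg_nonneg) auto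
    also have "\<dots> = \<rho> ^ Suc t * W"
      by (simp add: \<rho>_def mult_ac)
    finally show ?thesis
      by (simp only: \<rho>_def W_def)
  qed
qed

section \<open>Comparison with independent coupons\<close>

text \<open>
  The expected value of \<open>b\<close> at the set of coupons of \<open>A\<close> that are still missing after \<open>t\<close> draws,
  each of them uniform among \<open>n\<close> coupons of which \<open>A\<close> contains \<open>card A\<close>.
\<close>
primrec coupon :: "nat \<Rightarrow> ('a set \<Rightarrow> real) \<Rightarrow> nat \<Rightarrow> 'a set \<Rightarrow> real" where
  "coupon n b 0 A = b A"
| "coupon n b (Suc t) A = (1 - card A / n) * coupon n b t A + (\<Sum>e\<in>A. coupon n b t (A - {e})) / n"

lemma coupon_Suc_diff:
  "coupon n b (Suc t) A = coupon n b t A + (\<Sum>e\<in>A. 1 / n * (coupon n b t (A - {e}) - coupon n b t A))"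
  by (simp add: sum_subtractf sum_distrib_left[symmetric] sum_divide_distrib[symmetric] diff_divide_distrib left_diff_distrib)

lemma coupon_nonneg:
  assumes "\<And>A. A \<subseteq> F \<Longrightarrow> 0 \<le> b A" "card F \<le> n" "finite F" "A \<subseteq> F"
  shows "0 \<le> coupon n b t A"
  using assms(4)
proof (induction t arbitrary: A)
  case (Suc t)
  have "card A \<le> n"
    using card_mono[OF assms(3) Suc.prems] assms(2) by linarith
  then have "0 \<le> 1 - real (card A) / n"
    by (cases "n = 0") (auto simp: field_simps)
  moreover have "0 \<le> (\<Sum>e\<in>A. coupon n b t (A - {e}))"
    using Suc.prems by (intro sum_nonneg Suc.IH) auto
  ultimately show ?case
    unfolding coupon.simps using Suc.IH[OF Suc.prems]
    by (intro add_nonneg_nonneg mult_nonneg_nonneg divide_nonneg_nonneg of_nat_0_le_iff)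
next
  case 0
  show ?case using assms(1)[OF 0] by simp
qed

text \<open>
  Monotonicity lets the exact collection probability \<open>1 / n\<close> of the coupons replace the merely larger one
  of the edges, and lets a stage start from the full set of watched edges.
\<close>
lemma coupon_mono:
  assumes b: "\<And>A B. A \<subseteq> B \<Longrightarrow> B \<subseteq> F \<Longrightarrow> b A \<le> b B" and F: "card F \<le> n" "finite F" "n > 0"
    and "A \<subseteq> B" "B \<subseteq> F"
  shows "coupon n b t A \<le> coupon n b t B"
  using assms(5,6)
proof (induction t arbitrary: A B)
  case (Suc t)
  let ?g = "coupon n b t"
  have fin: "finite A" "finite B"
    using finite_subset[OF Suc.prems(2) F(2)] finite_subset[OF Suc.prems(1)] by simp_all
  have cB: "card B \<le> n" using card_mono[OF F(2) Suc.prems(2)] F(1) by linarith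
  have "(1 - card A / n) * ?g A + (\<Sum>e\<in>A. ?g (A - {e})) / n =
     (1 - card B / n) * ?g A + (\<Sum>e\<in>B - A. ?g A) / n + (\<Sum>e\<in>A. ?g (A - {e})) / n"
    using Suc.prems(1) fin F(3) card_mono[OF fin(2) Suc.prems(1)]
    by (simp add: card_Diff_subset field_simps)
  also have "\<dots> \<le> (1 - card B / n) * ?g B + (\<Sum>e\<in>B - A. ?g (B - {e})) / n + (\<Sum>e\<in>A. ?g (B - {e})) / n"
    using Suc.prems cB F(3)
    by (intro add_mono mult_left_mono divide_right_mono sum_mono Suc.IH) (auto simp: divide_le_eq_1)
  also have "\<dots> = (1 - card B / n) * ?g B + (\<Sum>e\<in>B. ?g (B - {e})) / n"
    using sum.subset_diff[OF Suc.prems(1) fin(2), of "\<lambda>e. ?g (B - {e})"]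
    by (simp add: add_divide_distrib)
  finally show ?case by simp
next
  case 0
  show ?case using b[OF 0] by simp
qed

text \<open>
  Builder takes a missing edge of \<open>F\<close> when it is the only one offered.  By \<open>tree_avg_only\<close> every missing
  edge then has at least the chance of a coupon, and collecting more only lowers \<open>b\<close>.
\<close>
lemma fail_le_coupon:
  assumes "n \<ge> 6" "F \<subseteq> Kn n" "8 * card F \<le> n"
    and mono: "\<And>A B. A \<subseteq> B \<Longrightarrow> B \<subseteq> F \<Longrightarrow> b A \<le> b B"
    and nonneg: "\<And>A. A \<subseteq> F \<Longrightarrow> 0 \<le> b A"
    and bad: "\<And>E. E0 \<subseteq> E \<Longrightarrow> E \<notin> Q \<Longrightarrow> 1 \<le> b (F - E)"
    and "E0 \<subseteq> E"
  shows "fail n Q t E \<le> coupon n b t (F - E)"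
  using assms(7)
proof (induction t arbitrary: E)
  case 0
  then show ?case
    using bad[of E] nonneg[of "F - E"] by auto
next
  case (Suc t)
  have fF: "finite F" using assms(2) finite_Kn finite_subset by blast
  define A where "A = F - E"
  let ?g = "coupon n b t"
  have fA: "finite A" "A \<subseteq> F" "8 * card A \<le> n"
    using fF assms(3) card_mono[OF fF, of A] by (auto simp: A_def)
  have dec: "?g (A - {e}) \<le> ?g A" for e
    using mono assms(1,3) fF fA(2) by (intro coupon_mono[where F = F]) auto
  have "fail n Q (Suc t) E \<le> tree_avg n (\<lambda>T. ?g A + (\<Sum>e\<in>A. (?g (A - {e}) - ?g A) * of_bool (T \<inter> A = {e})))"
  proof (rule fail_Suc_leI)
    fix T
    show "\<exists>c\<in>moves T. fail n Q t (offer E c) \<le> ?g A + (\<Sum>e\<in>A. (?g (A - {e}) - ?g A) * of_bool (T \<inter> A = {e}))"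
    proof (cases "\<exists>e\<in>A. T \<inter> A = {e}")
      case True
      then obtain e where e: "e \<in> A" "T \<inter> A = {e}" by blast
      have "(\<Sum>f\<in>A. (?g (A - {f}) - ?g A) * of_bool (T \<inter> A = {f})) = (\<Sum>f\<in>A. if f = e then ?g (A - {f}) - ?g A else 0)"
        using e by (intro sum.cong) auto
      also have "\<dots> = ?g (A - {e}) - ?g A"
        using e fA by simp
      finally have "?g A + (\<Sum>f\<in>A. (?g (A - {f}) - ?g A) * of_bool (T \<inter> A = {f})) = ?g (A - {e})"
        by linarith
      also have "A - {e} = F - insert e E"
        by (auto simp: A_def)
      finally have "?g A + (\<Sum>f\<in>A. (?g (A - {f}) - ?g A) * of_bool (T \<inter> A = {f})) = ?g (F - insert e E)" .
      moreover have "fail n Q t (insert e E) \<le> ?g (F - insert e E)"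
        using Suc.prems by (intro Suc.IH) auto
      ultimately have "fail n Q t (offer E (Some e)) \<le> ?g A + (\<Sum>f\<in>A. (?g (A - {f}) - ?g A) * of_bool (T \<inter> A = {f}))"
        by (simp only: offer_simps)
      moreover have "Some e \<in> moves T"
        using e(2) by (auto simp: moves_def)
      ultimately show ?thesis by blast
    next
      case False
      then have "(\<Sum>e\<in>A. (?g (A - {e}) - ?g A) * of_bool (T \<inter> A = {e})) = 0"
        by (intro sum.neutral) auto
      then have "fail n Q t (offer E None) \<le> ?g A + (\<Sum>f\<in>A. (?g (A - {f}) - ?g A) * of_bool (T \<inter> A = {f}))"
        using Suc.IH[OF Suc.prems] by (simp only: offer_simps A_def add_0_right)
      then show ?thesis
        using moves_nonempty(2) by blast
    qed
  qed
  also have "\<dots> = ?g A + (\<Sum>e\<in>A. (?g (A - {e}) - ?g A) * tree_avg n (\<lambda>T. of_bool (T \<inter> A = {e})))"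
    by (simp only: tree_avg_add tree_avg_const tree_avg_sum tree_avg_mult)
  also have "\<dots> \<le> ?g A + (\<Sum>e\<in>A. (?g (A - {e}) - ?g A) * (1 / n))"
    using assms(1,2) fA dec
    by (intro add_left_mono sum_mono mult_left_mono_neg tree_avg_only) auto
  also have "\<dots> = coupon n b (Suc t) A"
    unfolding coupon_Suc_diff by (simp add: mult.commute)
  finally show ?case
    by (simp only: A_def)
qed

text \<open>
  The expectation of \<open>b\<close> at a random subset of \<open>A\<close> that contains each element independently with
  probability \<open>q\<close>.
\<close>
definition bern_exp :: "real \<Rightarrow> ('a set \<Rightarrow> real) \<Rightarrow> 'a set \<Rightarrow> real" where
  "bern_exp q b A = (\<Sum>B\<in>Pow A. q ^ card B * (1 - q) ^ card (A - B) * b B)"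

lemma sum_Pow_insert:
  assumes "finite A" "x \<notin> A"
  shows "sum g (Pow (insert x A)) = sum g (Pow A) + (\<Sum>B\<in>Pow A. g (insert x B))"
proof -
  have "inj_on (insert x) (Pow A)"
    using assms by (auto simp: inj_on_def)
  moreover have "Pow A \<inter> insert x ` Pow A = {}"
    using assms by auto
  ultimately show ?thesis
    using assms by (simp add: Pow_insert sum.union_disjoint sum.reindex)
qed

lemma bern_exp_superset:
  assumes "finite A" "S \<subseteq> A"
  shows "bern_exp q (\<lambda>B. of_bool (S \<subseteq> B)) A = q ^ card S"
proof -
  have "bern_exp q (\<lambda>B. of_bool (S \<subseteq> B)) A =
      (\<Sum>B\<in>Pow A. (\<Prod>a\<in>B. q) * (\<Prod>a\<in>A - B. if a \<in> S then 0 else 1 - q))"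
    unfolding bern_exp_def
  proof (rule sum.cong)
    fix B assume "B \<in> Pow A"
    then have B: "B \<subseteq> A" "finite (A - B)" using assms(1) by auto
    show "q ^ card B * (1 - q) ^ card (A - B) * of_bool (S \<subseteq> B) =
        (\<Prod>a\<in>B. q) * (\<Prod>a\<in>A - B. if a \<in> S then 0 else 1 - q)"
    proof (cases "S \<subseteq> B")
      case True
      then have "(\<Prod>a\<in>A - B. if a \<in> S then 0 else 1 - q) = (\<Prod>a\<in>A - B. 1 - q)"
        by (intro prod.cong) auto
      then show ?thesis using True by simp
    next
      case False
      then have "\<exists>a\<in>A - B. (if a \<in> S then 0 else 1 - q) = 0"
        using assms(2) by auto
      then have "(\<Prod>a\<in>A - B. if a \<in> S then 0 else 1 - q) = 0"
        using B(2) by (intro prod_zero)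
      then show ?thesis using False by simp
    qed
  qed simp
  also have "\<dots> = (\<Prod>a\<in>A. q + (if a \<in> S then 0 else 1 - q))"
    by (rule prod_add[OF assms(1), symmetric])
  also have "\<dots> = (\<Prod>a\<in>A. if a \<in> S then q else 1)"
    by (intro prod.cong) auto
  also have "\<dots> = q ^ card S"
    using assms by (simp add: prod.If_cases Int_absorb1)
  finally show ?thesis .
qed

text \<open>
  Moebius inversion on the lattice of subsets.  It reduces linear identities between functionals of \<open>b\<close>
  to the functions \<open>\<lambda>A. of_bool (S \<subseteq> A)\<close>.
\<close>
lemma set_function_expansion:
  fixes b :: "'a set \<Rightarrow> real"
  assumes "finite F"
  shows "\<exists>c. \<forall>A\<subseteq>F. b A = (\<Sum>S\<in>Pow F. c S * of_bool (S \<subseteq> A))"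
  using assms
proof (induction F arbitrary: b rule: finite_induct)
  case empty
  show ?case by (rule exI[of _ "\<lambda>_. b {}"]) auto
next
  case (insert x F)
  from insert.IH[of b] obtain c where c: "\<forall>A\<subseteq>F. b A = (\<Sum>S\<in>Pow F. c S * of_bool (S \<subseteq> A))" by blast
  from insert.IH[of "\<lambda>A. b (insert x A) - b A"] obtain d
    where d: "\<forall>A\<subseteq>F. b (insert x A) - b A = (\<Sum>S\<in>Pow F. d S * of_bool (S \<subseteq> A))" by blast
  define h where "h = (\<lambda>S. if x \<in> S then d (S - {x}) else c S)"
  have "b A = (\<Sum>S\<in>Pow (insert x F). h S * of_bool (S \<subseteq> A))" if A: "A \<subseteq> insert x F" for A
  proof -
    have sub: "A - {x} \<subseteq> F" using A by auto
    have "(\<Sum>S\<in>Pow (insert x F). h S * of_bool (S \<subseteq> A)) =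
        (\<Sum>S\<in>Pow F. h S * of_bool (S \<subseteq> A)) + (\<Sum>S\<in>Pow F. h (insert x S) * of_bool (insert x S \<subseteq> A))"
      using insert.hyps by (rule sum_Pow_insert)
    also have "(\<Sum>S\<in>Pow F. h S * of_bool (S \<subseteq> A)) = (\<Sum>S\<in>Pow F. c S * of_bool (S \<subseteq> A - {x}))"
      using insert.hyps by (intro sum.cong) (auto simp: h_def)
    also have "\<dots> = b (A - {x})"
      using c[rule_format, OF sub] by (rule sym)
    also have "(\<Sum>S\<in>Pow F. h (insert x S) * of_bool (insert x S \<subseteq> A)) =
        (\<Sum>S\<in>Pow F. of_bool (x \<in> A) * (d S * of_bool (S \<subseteq> A - {x})))"
    proof (rule sum.cong)
      fix S assume "S \<in> Pow F"
      then have "x \<notin> S" using insert.hyps by auto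
      then show "h (insert x S) * of_bool (insert x S \<subseteq> A) = of_bool (x \<in> A) * (d S * of_bool (S \<subseteq> A - {x}))"
        by (auto simp: h_def)
    qed simp
    also have "\<dots> = of_bool (x \<in> A) * (b (insert x (A - {x})) - b (A - {x}))"
      unfolding sum_distrib_left[symmetric] d[rule_format, OF sub] ..
    also have "b (A - {x}) + \<dots> = b A"
      by (cases "x \<in> A") (auto simp: insert_absorb)
    finally show ?thesis ..
  qed
  then show ?case by blast
qed

lemma coupon_cong:
  assumes "\<And>B. B \<subseteq> A \<Longrightarrow> b B = b' B"
  shows "coupon n b t A = coupon n b' t A"
  using assms
proof (induction t arbitrary: A)
  case (Suc t)
  have "coupon n b t (A - {e}) = coupon n b' t (A - {e})" for e
    using Suc.prems by (intro Suc.IH) auto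
  then show ?case
    using Suc.IH[of A] Suc.prems by simp
qed simp

lemma coupon_lincomb:
  "coupon n (\<lambda>A. \<Sum>i\<in>I. c i * f i A) t A = (\<Sum>i\<in>I. c i * coupon n (f i) t A)"
proof (induction t arbitrary: A)
  case (Suc t)
  have "(\<Sum>e\<in>A. \<Sum>i\<in>I. c i * coupon n (f i) t (A - {e})) = (\<Sum>i\<in>I. c i * (\<Sum>e\<in>A. coupon n (f i) t (A - {e})))"
    by (subst sum.swap) (simp add: sum_distrib_left)
  then show ?case
    by (simp add: Suc.IH sum_distrib_left sum_divide_distrib sum.distrib[symmetric] algebra_simps)
qed simp

lemma coupon_superset:
  assumes "finite A" "n > 0"
  shows "coupon n (\<lambda>B. of_bool (S \<subseteq> B)) t A = of_bool (S \<subseteq> A) * (1 - card S / n) ^ t"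
  using assms(1)
proof (induction t arbitrary: A)
  case (Suc t)
  show ?case
  proof (cases "S \<subseteq> A")
    case True
    have "(\<Sum>e\<in>A. coupon n (\<lambda>B. of_bool (S \<subseteq> B)) t (A - {e})) =
        (\<Sum>e\<in>A. if e \<in> A - S then (1 - card S / n) ^ t else 0)"
      using True Suc by (intro sum.cong) auto
    also have "\<dots> = (\<Sum>e\<in>A - S. (1 - card S / n) ^ t)"
      using Suc.prems by (intro sum.mono_neutral_cong_right) auto
    also have "\<dots> = (real (card A) - real (card S)) * (1 - card S / n) ^ t"
      using True Suc.prems card_mono[OF Suc.prems True] finite_subset[OF True Suc.prems]
      by (simp add: card_Diff_subset)
    finally have "coupon n (\<lambda>B. of_bool (S \<subseteq> B)) (Suc t) A =
       (1 - card A / n) * (1 - card S / n) ^ t + (real (card A) - real (card S)) * (1 - card S / n) ^ t / n"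
      using True Suc by simp
    also have "\<dots> = (1 - card S / n) * (1 - card S / n) ^ t"
      using assms(2) by (simp add: field_simps)
    finally show ?thesis using True by simp
  next
    case False
    then have "(\<Sum>e\<in>A. coupon n (\<lambda>B. of_bool (S \<subseteq> B)) t (A - {e})) = 0"
      using Suc by (intro sum.neutral) auto
    then show ?thesis using False Suc by simp
  qed
qed simp

text \<open>
  With a Poisson number of draws the coupons become independent.  By \<open>set_function_expansion\<close> it is
  enough that a given set \<open>S\<close> is completely missing with probability
  \<open>exp (- \<tau>) ^ card S\<close>, which is the exponential series.
\<close>
lemma poissonized_coupon:
  assumes "finite A" "n > 0" "\<tau> \<ge> 0"
  shows "(\<lambda>t. (\<tau> * n) ^ t / fact t * exp (- (\<tau> * n)) * coupon n b t A) sums bern_exp (exp (- \<tau>)) b A"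
proof -
  obtain c where c: "\<forall>B\<subseteq>A. b B = (\<Sum>S\<in>Pow A. c S * of_bool (S \<subseteq> B))"
    using set_function_expansion[OF assms(1)] by blast
  have cp: "coupon n b t A = (\<Sum>S\<in>Pow A. c S * (1 - card S / n) ^ t)" for t
  proof -
    have "coupon n b t A = coupon n (\<lambda>B. \<Sum>S\<in>Pow A. c S * of_bool (S \<subseteq> B)) t A"
      by (rule coupon_cong) (rule c[rule_format])
    also have "\<dots> = (\<Sum>S\<in>Pow A. c S * (of_bool (S \<subseteq> A) * (1 - card S / n) ^ t))"
      using assms by (simp only: coupon_lincomb coupon_superset)
    also have "\<dots> = (\<Sum>S\<in>Pow A. c S * (1 - card S / n) ^ t)"
      by (intro sum.cong) auto
    finally show ?thesis .
  qed
  have be: "bern_exp q b A = (\<Sum>S\<in>Pow A. c S * q ^ card S)" for q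
  proof -
    have "bern_exp q b A = (\<Sum>B\<in>Pow A. \<Sum>S\<in>Pow A. c S * (q ^ card B * (1 - q) ^ card (A - B) * of_bool (S \<subseteq> B)))"
      unfolding bern_exp_def
    proof (rule sum.cong)
      fix B assume "B \<in> Pow A"
      then have "b B = (\<Sum>S\<in>Pow A. c S * of_bool (S \<subseteq> B))"
        using c by blast
      then show "q ^ card B * (1 - q) ^ card (A - B) * b B =
          (\<Sum>S\<in>Pow A. c S * (q ^ card B * (1 - q) ^ card (A - B) * of_bool (S \<subseteq> B)))"
        by (simp only: sum_distrib_left mult_ac)
    qed simp
    also have "\<dots> = (\<Sum>S\<in>Pow A. c S * bern_exp q (\<lambda>B. of_bool (S \<subseteq> B)) A)"
      unfolding bern_exp_def by (subst sum.swap) (simp add: sum_distrib_left)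
    also have "\<dots> = (\<Sum>S\<in>Pow A. c S * q ^ card S)"
      using bern_exp_superset[OF assms(1)] by (intro sum.cong) auto
    finally show ?thesis .
  qed
  have "(\<lambda>t. \<Sum>S\<in>Pow A. c S * (exp (- (\<tau> * n)) * ((\<tau> * n * (1 - card S / n)) ^ t / fact t)))
      sums (\<Sum>S\<in>Pow A. c S * (exp (- (\<tau> * n)) * exp (\<tau> * n * (1 - card S / n))))"
    using exp_converges[where 'a = real]
    by (intro sums_sum sums_mult) (simp add: scaleR_conv_of_real divide_inverse mult.commute)
  also have "(\<Sum>S\<in>Pow A. c S * (exp (- (\<tau> * n)) * exp (\<tau> * n * (1 - card S / n)))) = bern_exp (exp (- \<tau>)) b A"
    unfolding be
  proof (rule sum.cong)
    fix S :: "'a set"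
    have "exp (- (\<tau> * n)) * exp (\<tau> * n * (1 - card S / n)) = exp (real (card S) * (- \<tau>))"
      using assms(2) by (simp add: exp_add[symmetric] field_simps)
    then show "c S * (exp (- (\<tau> * n)) * exp (\<tau> * n * (1 - card S / n))) = c S * exp (- \<tau>) ^ card S"
      by (simp only: exp_of_nat_mult)
  qed simp
  also have "(\<lambda>t. \<Sum>S\<in>Pow A. c S * (exp (- (\<tau> * n)) * ((\<tau> * n * (1 - card S / n)) ^ t / fact t))) =
      (\<lambda>t. (\<tau> * n) ^ t / fact t * exp (- (\<tau> * n)) * coupon n b t A)"
    unfolding cp by (intro ext) (simp add: sum_distrib_left power_mult_distrib mult_ac sum_divide_distrib)
  finally show ?thesis .
qed

text \<open>
  The total mass and the mean of the Poisson distribution in one series; the form is the one needed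
  for a Markov bound with threshold \<open>c\<close>.
\<close>
lemma poisson_mean_sums:
  fixes x :: real
  shows "(\<lambda>t. x ^ t / fact t * exp (- x) * (1 - real t / c)) sums (1 - x / c)"
proof -
  have e: "(\<lambda>t. x ^ t / fact t) sums exp x"
    using exp_converges[of x] by (simp add: scaleR_conv_of_real divide_inverse mult.commute)
  have "(\<lambda>t. real (Suc t) * (x ^ Suc t / fact (Suc t))) sums (x * exp x)"
  proof -
    have "real (Suc t) * (x ^ Suc t / fact (Suc t)) = x * (x ^ t / fact t)" for t
      by (simp del: of_nat_Suc add: field_simps)
    then show ?thesis using sums_mult[OF e, of x] by simp
  qed
  then have m: "(\<lambda>t. real t * (x ^ t / fact t)) sums (x * exp x)"
    using sums_Suc_iff[of "\<lambda>t. real t * (x ^ t / fact t)"] by simp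
  have "(\<lambda>t. exp (- x) * (x ^ t / fact t) - exp (- x) / c * (real t * (x ^ t / fact t))) sums
      (exp (- x) * exp x - exp (- x) / c * (x * exp x))"
    by (intro sums_diff sums_mult e m)
  moreover have "exp (- x) * exp x - exp (- x) / c * (x * exp x) = 1 - x / c"
    by (simp add: exp_minus)
  moreover have "(\<lambda>t. exp (- x) * (x ^ t / fact t) - exp (- x) / c * (real t * (x ^ t / fact t))) =
      (\<lambda>t. x ^ t / fact t * exp (- x) * (1 - real t / c))"
    by (intro ext) (simp add: right_diff_distrib mult_ac diff_divide_distrib)
  ultimately show ?thesis by simp
qed

text \<open>
  More draws only help, so the value after \<open>t\<close> draws is at most the Poissonized value divided by the
  probability that the Poisson number is at most \<open>t\<close>.  That probability is at least \<open>1 / 2\<close> by Markov's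
  inequality.  The proof bounds \<open>g s\<close> below by \<open>g t * (1 - s / (t + 1))\<close>, which is \<open>g t\<close> up to a factor in \<open>[0, 1]\<close>
  for \<open>s \<le> t\<close> and nonpositive beyond.
\<close>
lemma coupon_le_bern_exp:
  assumes "finite A" "card A \<le> n" "n > 0" "0 \<le> \<tau>" "2 * \<tau> * n \<le> t + 1"
    and mono: "\<And>B C. B \<subseteq> C \<Longrightarrow> C \<subseteq> A \<Longrightarrow> b B \<le> b C"
    and nonneg: "\<And>B. B \<subseteq> A \<Longrightarrow> 0 \<le> b B"
  shows "coupon n b t A \<le> 2 * bern_exp (exp (- \<tau>)) b A"
proof -
  let ?x = "\<tau> * n"
  define g where "g = (\<lambda>s. coupon n b s A)"
  have g0: "0 \<le> g s" for s
    unfolding g_def using assms by (intro coupon_nonneg[where F = A]) auto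
  have "g (Suc s) \<le> g s" for s
  proof -
    have "coupon n b s (A - {e}) \<le> coupon n b s A" for e
      using mono assms by (intro coupon_mono[where F = A]) auto
    then have "(\<Sum>e\<in>A. 1 / n * (coupon n b s (A - {e}) - coupon n b s A)) \<le> 0"
      by (intro sum_nonpos mult_nonneg_nonpos) auto
    then show ?thesis
      unfolding g_def coupon_Suc_diff by simp
  qed
  then have dec: "g s' \<le> g s" if "s \<le> s'" for s s'
    using lift_Suc_antimono_le[of g] that by blast
  have lower: "g t * (1 - real s / (t + 1)) \<le> g s" for s
  proof (cases "s \<le> t")
    case True
    have "g t * (1 - real s / (t + 1)) \<le> g t * 1"
      using g0 by (intro mult_left_mono) auto
    then show ?thesis using dec[OF True] by simp
  next
    case False
    then have "1 - real s / (t + 1) \<le> 0" by (simp add: field_simps)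
    then show ?thesis
      using g0[of t] g0[of s] mult_nonneg_nonpos[of "g t"] by (meson order_trans)
  qed
  have s1: "(\<lambda>s. g t * (?x ^ s / fact s * exp (- ?x) * (1 - real s / (t + 1)))) sums (g t * (1 - ?x / (t + 1)))"
    by (rule sums_mult[OF poisson_mean_sums])
  have s2: "(\<lambda>s. ?x ^ s / fact s * exp (- ?x) * g s) sums bern_exp (exp (- \<tau>)) b A"
    unfolding g_def by (rule poissonized_coupon[OF assms(1,3,4)])
  have "g t * (1 - ?x / (t + 1)) \<le> bern_exp (exp (- \<tau>)) b A"
  proof (rule sums_le[OF _ s1 s2])
    fix s
    have "0 \<le> ?x ^ s / fact s * exp (- ?x)"
      using assms(4) by simp
    from mult_left_mono[OF lower[of s] this]
    show "g t * (?x ^ s / fact s * exp (- ?x) * (1 - real s / (t + 1))) \<le> ?x ^ s / fact s * exp (- ?x) * g s"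
      by (simp only: mult_ac)
  qed
  moreover have "g t * (1 / 2) \<le> g t * (1 - ?x / (t + 1))"
    using assms(5) g0 by (intro mult_left_mono) (auto simp: field_simps)
  ultimately have "g t * (1 / 2) \<le> bern_exp (exp (- \<tau>)) b A"
    by (rule order_trans[rotated])
  then show ?thesis
    by (simp add: g_def)
qed

lemma bern_exp_one: "finite A \<Longrightarrow> bern_exp q (\<lambda>_. 1) A = 1"
  using bern_exp_superset[of A "{}" q] by simp

lemma bern_exp_Un:
  assumes "finite A" "finite B" "A \<inter> B = {}"
    and "\<And>X Y. X \<subseteq> A \<Longrightarrow> Y \<subseteq> B \<Longrightarrow> h (X \<union> Y) = f X * g Y"
  shows "bern_exp q h (A \<union> B) = bern_exp q f A * bern_exp q g B"
proof -
  have "bern_exp q f A * bern_exp q g B =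
      (\<Sum>(X, Y)\<in>Pow A \<times> Pow B. (q ^ card X * (1 - q) ^ card (A - X) * f X) * (q ^ card Y * (1 - q) ^ card (B - Y) * g Y))"
    unfolding bern_exp_def sum_product sum.cartesian_product ..
  also have "\<dots> = (\<Sum>Z\<in>Pow (A \<union> B). q ^ card Z * (1 - q) ^ card (A \<union> B - Z) * h Z)"
  proof (rule sum.reindex_bij_witness[of _ "\<lambda>Z. (Z \<inter> A, Z \<inter> B)" "\<lambda>(X, Y). X \<union> Y"])
    fix p assume "p \<in> Pow A \<times> Pow B"
    then obtain X Y where p: "p = (X, Y)" "X \<subseteq> A" "Y \<subseteq> B" by auto
    have fin: "finite X" "finite Y" "finite (A - X)" "finite (B - Y)"
      using p assms finite_subset by auto
    have c1: "card (X \<union> Y) = card X + card Y"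
      using p assms fin by (intro card_Un_disjoint) auto
    have "A \<union> B - (X \<union> Y) = (A - X) \<union> (B - Y)"
      using p assms by auto
    then have c2: "card (A \<union> B - (X \<union> Y)) = card (A - X) + card (B - Y)"
      using assms fin by (simp add: card_Un_disjoint disjoint_iff)
    show "q ^ card (case p of (X, Y) \<Rightarrow> X \<union> Y) * (1 - q) ^ card (A \<union> B - (case p of (X, Y) \<Rightarrow> X \<union> Y)) *
        h (case p of (X, Y) \<Rightarrow> X \<union> Y) =
        (case p of (X, Y) \<Rightarrow> q ^ card X * (1 - q) ^ card (A - X) * f X * (q ^ card Y * (1 - q) ^ card (B - Y) * g Y))"
      using assms(4)[OF p(2,3)] by (simp add: p(1) c1 c2 power_add mult_ac)
  qed (use assms in auto)
  finally show ?thesis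
    by (simp add: bern_exp_def)
qed

lemma bern_exp_meets:
  assumes "finite A"
  shows "bern_exp q (\<lambda>B. of_bool (A \<inter> B \<noteq> {})) A = 1 - (1 - q) ^ card A"
proof -
  have "bern_exp q (\<lambda>B. of_bool (A \<inter> B \<noteq> {})) A + bern_exp q (\<lambda>B. of_bool (B = {})) A = bern_exp q (\<lambda>_. 1) A"
    unfolding bern_exp_def sum.distrib[symmetric] by (intro sum.cong) auto
  moreover have "bern_exp q (\<lambda>B. of_bool (B = {})) A = (1 - q) ^ card A"
  proof -
    have "bern_exp q (\<lambda>B. of_bool (B = {})) A = (\<Sum>B\<in>Pow A. if B = {} then (1 - q) ^ card A else 0)"
      unfolding bern_exp_def by (intro sum.cong) auto
    then show ?thesis using assms by simp
  qed
  ultimately show ?thesis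
    using bern_exp_one[OF assms, of q] by simp
qed

lemma bern_exp_disjoint_family:
  assumes "finite I" "finite A" "\<And>i. i \<in> I \<Longrightarrow> St i \<subseteq> A" "disjoint_family_on St I"
  shows "bern_exp q (\<lambda>B. \<Prod>i\<in>I. of_bool (St i \<inter> B \<noteq> {})) A = (\<Prod>i\<in>I. 1 - (1 - q) ^ card (St i))"
  using assms
proof (induction I arbitrary: A rule: finite_induct)
  case empty
  then show ?case by (simp add: bern_exp_one)
next
  case (insert i I)
  have sub1: "St i \<subseteq> A"
    using insert.prems(2) by blast
  have sub2: "St j \<subseteq> A - St i" if "j \<in> I" for j
  proof -
    have "St j \<inter> St i = {}"
      using insert.prems(3) insert.hyps that by (auto simp: disjoint_family_on_def)
    then show "St j \<subseteq> A - St i"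
      using insert.prems(2)[of j] that by blast
  qed
  have "bern_exp q (\<lambda>B. \<Prod>i\<in>insert i I. of_bool (St i \<inter> B \<noteq> {})) (St i \<union> (A - St i)) =
      bern_exp q (\<lambda>B. of_bool (St i \<inter> B \<noteq> {})) (St i) * bern_exp q (\<lambda>B. \<Prod>i\<in>I. of_bool (St i \<inter> B \<noteq> {})) (A - St i)"
  proof (rule bern_exp_Un)
    fix X Y assume XY: "X \<subseteq> St i" "Y \<subseteq> A - St i"
    have "St i \<inter> (X \<union> Y) = St i \<inter> X" using XY by auto
    moreover have "(\<Prod>j\<in>I. of_bool (St j \<inter> (X \<union> Y) \<noteq> {}) :: real) = (\<Prod>j\<in>I. of_bool (St j \<inter> Y \<noteq> {}))"
    proof (rule prod.cong)
      fix j assume "j \<in> I"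
      then have "St j \<inter> (X \<union> Y) = St j \<inter> Y" using sub2[of j] XY by auto
      then show "(of_bool (St j \<inter> (X \<union> Y) \<noteq> {}) :: real) = of_bool (St j \<inter> Y \<noteq> {})" by simp
    qed simp
    ultimately show "(\<Prod>j\<in>insert i I. of_bool (St j \<inter> (X \<union> Y) \<noteq> {})) =
        of_bool (St i \<inter> X \<noteq> {}) * (\<Prod>j\<in>I. of_bool (St j \<inter> Y \<noteq> {}) :: real)"
      using insert.hyps by simp
  qed (use finite_subset[OF sub1 insert.prems(1)] insert.prems(1) in auto)
  also have "St i \<union> (A - St i) = A" using sub1 by auto
  finally show ?case
    using insert.IH[of "A - St i"] insert.hyps insert.prems(1) sub2 bern_exp_meets[of "St i" q]
      finite_subset[OF sub1 insert.prems(1)] disjoint_family_on_mono[OF subset_insertI insert.prems(3)]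
    by simp
qed

text \<open>
  The tool for all phases that wait for specific edges: a failure must be witnessed by a configuration
  \<open>c\<close> of disjoint edge sets none of which is complete, and the bound is the union over configurations of
  the product of the probabilities for independent edges, up to the factor 2.
\<close>
lemma fail_le_product:
  assumes "n \<ge> 6" "F \<subseteq> Kn n" "8 * card F \<le> n" "0 \<le> \<tau>" "2 * \<tau> * n \<le> t + 1"
    and I: "finite \<C>" "\<And>c. c \<in> \<C> \<Longrightarrow> finite (I c)"
    and St: "\<And>c i. c \<in> \<C> \<Longrightarrow> i \<in> I c \<Longrightarrow> St c i \<subseteq> F" "\<And>c. c \<in> \<C> \<Longrightarrow> disjoint_family_on (St c) (I c)"
    and bad: "\<And>E. E0 \<subseteq> E \<Longrightarrow> E \<notin> Q \<Longrightarrow> \<exists>c\<in>\<C>. \<forall>i\<in>I c. \<not> St c i \<subseteq> E"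
  shows "fail n Q t E0 \<le> 2 * (\<Sum>c\<in>\<C>. \<Prod>i\<in>I c. 1 - (1 - exp (- \<tau>)) ^ card (St c i))"
proof -
  have fF: "finite F" using assms(2) finite_Kn finite_subset by blast
  define b1 where "b1 = (\<lambda>c B. \<Prod>i\<in>I c. of_bool (St c i \<inter> B \<noteq> {}) :: real)"
  define b where "b = (\<lambda>B. \<Sum>c\<in>\<C>. 1 * b1 c B)"
  have b1_mono: "b1 c A \<le> b1 c B" if "A \<subseteq> B" for A B c
    unfolding b1_def using that by (intro prod_mono) auto
  have b1_nonneg: "0 \<le> b1 c A" for A c
    unfolding b1_def by (intro prod_nonneg) auto
  have b_mono: "b A \<le> b B" if "A \<subseteq> B" for A B
    unfolding b_def using b1_mono[OF that] by (intro sum_mono) auto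
  have b_nonneg: "0 \<le> b A" for A
    unfolding b_def using b1_nonneg by (intro sum_nonneg) auto
  have "1 \<le> b (F - E)" if E: "E0 \<subseteq> E" "E \<notin> Q" for E
  proof -
    obtain c where c: "c \<in> \<C>" "\<forall>i\<in>I c. \<not> St c i \<subseteq> E"
      using bad[OF E] by blast
    have "b1 c (F - E) = (\<Prod>i\<in>I c. 1)"
      unfolding b1_def
    proof (rule prod.cong)
      fix i assume i: "i \<in> I c"
      then have "St c i \<inter> (F - E) \<noteq> {}"
        using c(2) St(1)[OF c(1) i] by blast
      then show "of_bool (St c i \<inter> (F - E) \<noteq> {}) = (1 :: real)" by simp
    qed simp
    then have "1 = 1 * b1 c (F - E)" by simp
    also have "\<dots> \<le> b (F - E)"
      unfolding b_def using c(1) I(1) b1_nonneg by (intro member_le_sum) auto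
    finally show ?thesis .
  qed
  then have "fail n Q t E0 \<le> coupon n b t (F - E0)"
    using assms(1-3) b_mono b_nonneg by (intro fail_le_coupon) auto
  also have "\<dots> \<le> coupon n b t F"
    using assms(1,3) b_mono fF by (intro coupon_mono[where F = F]) auto
  also have "\<dots> = (\<Sum>c\<in>\<C>. 1 * coupon n (b1 c) t F)"
    unfolding b_def by (rule coupon_lincomb)
  also have "\<dots> \<le> (\<Sum>c\<in>\<C>. 2 * bern_exp (exp (- \<tau>)) (b1 c) F)"
  proof (rule sum_mono)
    fix c
    show "1 * coupon n (b1 c) t F \<le> 2 * bern_exp (exp (- \<tau>)) (b1 c) F"
      unfolding mult_1 using assms(1,3-5) fF b1_mono b1_nonneg by (intro coupon_le_bern_exp) auto
  qed
  also have "\<dots> = 2 * (\<Sum>c\<in>\<C>. bern_exp (exp (- \<tau>)) (b1 c) F)"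
    by (simp add: sum_distrib_left)
  also have "(\<Sum>c\<in>\<C>. bern_exp (exp (- \<tau>)) (b1 c) F) = (\<Sum>c\<in>\<C>. \<Prod>i\<in>I c. 1 - (1 - exp (- \<tau>)) ^ card (St c i))"
    unfolding b1_def using I(2) St fF by (intro sum.cong bern_exp_disjoint_family) auto
  finally show ?thesis .
qed

section \<open>Repairing an embedding by exchanges\<close>

text \<open>
  The vertices in \<open>U\<close>, called defective below, are vertices of the host; edges of the copy that meet them
  may be missing.
\<close>
definition near_copy :: "nat \<Rightarrow> nat set set \<Rightarrow> nat \<Rightarrow> nat set set set" where
  "near_copy n D m = {E. \<exists>\<pi> U. \<pi> permutes {1..n} \<and> U \<subseteq> {1..n} \<and> card U \<le> m \<and>
     (\<forall>e\<in>D. \<pi> ` e \<inter> U = {} \<longrightarrow> \<pi> ` e \<in> E)}"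

definition nb :: "nat set set \<Rightarrow> nat \<Rightarrow> nat set" where
  "nb D v = {w. {v, w} \<in> D}"

lemma nb_sym: "w \<in> nb D v \<longleftrightarrow> v \<in> nb D w"
  by (simp add: nb_def insert_commute)

lemma nb_Kn:
  assumes "D \<subseteq> Kn n"
  shows "nb D v \<subseteq> {1..n}" "v \<notin> nb D v" "finite (nb D v)"
proof -
  have "w \<in> {1..n} \<and> w \<noteq> v" if "w \<in> nb D v" for w
  proof -
    have "{v, w} \<in> Kn n" using that assms by (auto simp: nb_def)
    then show ?thesis using in_Kn_pair by metis
  qed
  then show "nb D v \<subseteq> {1..n}" "v \<notin> nb D v" by blast+
  then show "finite (nb D v)" using finite_subset by blast
qed

lemma card_nb:
  assumes "D \<subseteq> Kn n"
  shows "card (nb D v) = card {e \<in> D. v \<in> e}"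
proof (rule bij_betw_same_card[of "\<lambda>w. {v, w}"], rule bij_betw_imageI)
  show "inj_on (\<lambda>w. {v, w}) (nb D v)"
    by (auto simp: inj_on_def doubleton_eq_iff)
  show "(\<lambda>w. {v, w}) ` nb D v = {e \<in> D. v \<in> e}"
  proof (intro equalityI subsetI)
    fix e assume e: "e \<in> {e \<in> D. v \<in> e}"
    then have "e \<in> Kn n" using assms by blast
    then obtain a b where "e = {a, b}" by (rule Kn_pairE)
    then have "e = {v, if v = a then b else a}"
      using e by auto
    then show "e \<in> (\<lambda>w. {v, w}) ` nb D v"
      using e by (auto simp: nb_def)
  qed (auto simp: nb_def)
qed

lemma card_UN_le_mult:
  assumes "finite A" "\<And>a. a \<in> A \<Longrightarrow> card (f a) \<le> m"
  shows "card (\<Union>a\<in>A. f a) \<le> card A * m"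
proof -
  have "card (\<Union>a\<in>A. f a) \<le> (\<Sum>a\<in>A. card (f a))"
    using assms(1) by (rule card_UN_le)
  also have "\<dots> \<le> card A * m"
    using sum_bounded_above[of A "\<lambda>a. card (f a)" m] assms(2) by simp
  finally show ?thesis .
qed

text \<open>
  Greedy choice: each chosen vertex excludes the vertices within distance 2, at most
  \<open>1 + \<Delta> + \<Delta> * \<Delta>\<close> of them.
\<close>
lemma spread_set_exists:
  assumes D: "D \<subseteq> Kn n" and deg: "\<And>v. card (nb D v) \<le> \<Delta>" and U: "U \<subseteq> {1..n}"
    and "card U * (1 + \<Delta>) + j * (1 + \<Delta> + \<Delta> * \<Delta>) \<le> n"
  shows "\<exists>W. W \<subseteq> {1..n} - U \<and> card W = j \<and> (\<forall>z\<in>W. nb D z \<inter> U = {}) \<and>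
     (\<forall>z\<in>W. \<forall>z'\<in>W. z \<noteq> z' \<longrightarrow> z' \<notin> nb D z \<and> nb D z \<inter> nb D z' = {})"
  using assms(4)
proof (induction j)
  case 0
  show ?case by (rule exI[of _ "{}"]) simp
next
  case (Suc j)
  then obtain W where W: "W \<subseteq> {1..n} - U" "card W = j" "\<forall>z\<in>W. nb D z \<inter> U = {}"
    "\<forall>z\<in>W. \<forall>z'\<in>W. z \<noteq> z' \<longrightarrow> z' \<notin> nb D z \<and> nb D z \<inter> nb D z' = {}"
    by auto
  have fin: "finite U" "finite W"
    using finite_subset[OF U] finite_subset[OF W(1)] by auto
  let ?N = "nb D"
  \<comment> \<open>The vertices excluded by \<open>U\<close> and by the vertices chosen so far.\<close>
  define X where "X = (U \<union> (\<Union>u\<in>U. ?N u)) \<union> (W \<union> (\<Union>w\<in>W. ?N w) \<union> (\<Union>w\<in>W. \<Union>b\<in>?N w. ?N b))"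
  have c2: "card (\<Union>b\<in>?N w. ?N b) \<le> \<Delta> * \<Delta>" for w
  proof -
    have "card (\<Union>b\<in>?N w. ?N b) \<le> card (?N w) * \<Delta>"
      using nb_Kn[OF D] deg by (intro card_UN_le_mult) auto
    also have "\<dots> \<le> \<Delta> * \<Delta>" using deg by (intro mult_right_mono) auto
    finally show ?thesis .
  qed
  have "card X \<le> (card U + card (\<Union>u\<in>U. ?N u)) + (card W + card (\<Union>w\<in>W. ?N w) + card (\<Union>w\<in>W. \<Union>b\<in>?N w. ?N b))"
    unfolding X_def by (intro order_trans[OF card_Un_le] add_mono order_refl)
  also have "\<dots> \<le> (card U + card U * \<Delta>) + (card W + card W * \<Delta> + card W * (\<Delta> * \<Delta>))"
    using fin deg c2 by (intro add_mono order_refl card_UN_le_mult) auto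
  also have "\<dots> < n"
    using Suc.prems W(2) by (simp add: algebra_simps)
  finally have "card X < card {1..n}" by simp
  moreover have "finite X"
    unfolding X_def using fin nb_Kn(3)[OF D] by (intro finite_UnI finite_UN_I)
  ultimately have "\<not> {1..n} \<subseteq> X"
    using card_mono[of X "{1..n}"] by linarith
  then obtain z where z: "z \<in> {1..n}" "z \<notin> X"
    by blast
  have zU: "z \<notin> U" "z \<notin> W" "\<And>u. u \<in> U \<Longrightarrow> z \<notin> ?N u" "\<And>w. w \<in> W \<Longrightarrow> z \<notin> ?N w"
    "\<And>w b. w \<in> W \<Longrightarrow> b \<in> ?N w \<Longrightarrow> z \<notin> ?N b"
    using z(2) by (auto simp: X_def)
  show ?case
  proof (intro exI[of _ "insert z W"] conjI ballI impI)
    show "insert z W \<subseteq> {1..n} - U" using W(1) z(1) zU(1) by auto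
    show "card (insert z W) = Suc j" using fin zU(2) W(2) by simp
    show "?N x \<inter> U = {}" if "x \<in> insert z W" for x
      using that W(3) zU(3) nb_sym[of _ D z] by auto
    fix x y assume xy: "x \<in> insert z W" "y \<in> insert z W" "x \<noteq> y"
    show "y \<notin> ?N x" using xy W(4) zU(4) nb_sym[of _ D z] by auto
    have "?N z \<inter> ?N w = {}" if "w \<in> W" for w
      using zU(5)[OF that] nb_sym[of z D] by auto
    moreover have "?N x \<inter> ?N y = {}" if "x \<in> W" "y \<in> W"
      using W(4) that xy(3) by blast
    ultimately show "?N x \<inter> ?N y = {}"
      using xy by (metis Int_commute insert_iff)
  qed
qed

text \<open>
  Each vertex \<open>u\<close> of \<open>U\<close> has \<open>K\<close> private candidates \<open>Z u\<close> for an exchange.  The distance conditions ensure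
  that the neighbours of a candidate stay in place and that no vertex has two candidates as
  neighbours.
\<close>
locale candidates =
  fixes n :: nat and D :: "nat set set" and U :: "nat set" and Z :: "nat \<Rightarrow> nat set" and K \<Delta> :: nat
  assumes D: "D \<subseteq> Kn n" and deg: "card (nb D v) \<le> \<Delta>" and U: "U \<subseteq> {1..n}"
    and Z_card: "u \<in> U \<Longrightarrow> card (Z u) = K" and Z_outside: "u \<notin> U \<Longrightarrow> Z u = {}"
    and Z_sub: "Z u \<subseteq> {1..n} - U"
    and Z_disj: "z \<in> Z u \<Longrightarrow> z \<in> Z u' \<Longrightarrow> u = u'"
    and Z_nb_U: "z \<in> Z u \<Longrightarrow> v \<in> U \<Longrightarrow> v \<notin> nb D z"
    and Z_nb_Z: "z \<in> Z u \<Longrightarrow> z' \<in> Z u' \<Longrightarrow> z' \<notin> nb D z"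
    and Z_nb_nb: "z \<in> Z u \<Longrightarrow> z' \<in> Z u' \<Longrightarrow> b \<in> nb D z \<Longrightarrow> b \<in> nb D z' \<Longrightarrow> z = z'"

lemma candidates_exist:
  assumes D: "D \<subseteq> Kn n" and deg: "\<And>v. card (nb D v) \<le> \<Delta>" and U: "U \<subseteq> {1..n}"
    and le: "card U * (1 + \<Delta>) + card U * K * (1 + \<Delta> + \<Delta> * \<Delta>) \<le> n"
  shows "\<exists>Z. candidates n D U Z K \<Delta>"
proof -
  obtain W where W: "W \<subseteq> {1..n} - U" "card W = card U * K" "\<forall>z\<in>W. nb D z \<inter> U = {}"
    "\<forall>z\<in>W. \<forall>z'\<in>W. z \<noteq> z' \<longrightarrow> z' \<notin> nb D z \<and> nb D z \<inter> nb D z' = {}"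
    using spread_set_exists[OF D deg U le] by blast
  have fin: "finite U" "finite W"
    using finite_subset[OF U] finite_subset[OF W(1)] by auto
  then have "card (U \<times> {..<K}) = card W" "finite (U \<times> {..<K})"
    using W(2) by (simp_all add: card_cartesian_product)
  then obtain g where g: "bij_betw g (U \<times> {..<K}) W"
    using finite_same_card_bij fin(2) by blast
  define Z where "Z = (\<lambda>u. if u \<in> U then (\<lambda>i. g (u, i)) ` {..<K} else {})"
  have ZW: "z \<in> W" if "z \<in> Z u" for z u
    using that g by (auto simp: Z_def bij_betw_def split: if_splits)
  have inj: "g p = g q \<Longrightarrow> p \<in> U \<times> {..<K} \<Longrightarrow> q \<in> U \<times> {..<K} \<Longrightarrow> p = q" for p q
    using g by (auto simp: bij_betw_def inj_on_def)
  have "candidates n D U Z K \<Delta>"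
  proof
    show "D \<subseteq> Kn n" "U \<subseteq> {1..n}" by fact+
    show "card (nb D v) \<le> \<Delta>" for v by (rule deg)
    show "Z u = {}" if "u \<notin> U" for u using that by (simp add: Z_def)
    show "Z u \<subseteq> {1..n} - U" for u using ZW W(1) by blast
    show "card (Z u) = K" if u: "u \<in> U" for u
    proof -
      have "inj_on (\<lambda>i. g (u, i)) {..<K}"
        using inj[of "(u, _)" "(u, _)"] u by (intro inj_onI) auto
      then show ?thesis using u by (simp add: Z_def card_image)
    qed
    show "u = u'" if "z \<in> Z u" "z \<in> Z u'" for z u u'
      using that inj[of "(u, _)" "(u', _)"] by (auto simp: Z_def split: if_splits)
    show "v \<notin> nb D z" if "z \<in> Z u" "v \<in> U" for z u v
      using W(3) ZW[OF that(1)] that(2) by blast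
    show "z' \<notin> nb D z" if "z \<in> Z u" "z' \<in> Z u'" for z z' u u'
      using W(4) ZW[OF that(1)] ZW[OF that(2)] nb_Kn(2)[OF D, of z] by metis
    show "z = z'" if "z \<in> Z u" "z' \<in> Z u'" "b \<in> nb D z" "b \<in> nb D z'" for z z' u u' b
      using W(4) ZW[OF that(1)] ZW[OF that(2)] that(3,4) by blast
  qed
  then show ?thesis by (intro exI[of _ Z])
qed

context candidates
begin

lemma finite_U: "finite U"
  using U finite_subset by blast

lemma finite_Z: "finite (Z u)"
  using Z_sub[of u] finite_subset by blast

lemma nb_U_notin_Z: "u \<in> U \<Longrightarrow> b \<in> nb D u \<Longrightarrow> b \<notin> Z v"
  using Z_nb_U[of b v u] nb_sym[of b D u] by blast

lemma nb_Z_notin_U: "z \<in> Z u \<Longrightarrow> b \<in> nb D z \<Longrightarrow> b \<notin> U"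
  using Z_nb_U by blast

text \<open>
  Where vertex \<open>b\<close> can be after the stage, as far as it matters to its neighbours in \<open>U\<close>.
\<close>
definition places :: "nat \<Rightarrow> nat set" where
  "places b = insert b (Z b)"

text \<open>
  The edges needed to exchange \<open>u\<close> with \<open>z\<close>, when \<open>c b\<close> is the new place of each neighbour \<open>b\<close> in \<open>U\<close>.
  Neighbours in \<open>U\<close> that come later take care of the common edge themselves, and those with \<open>c b = b\<close>
  remain defective, so that edges at them may be missing.
\<close>
definition star :: "(nat \<Rightarrow> nat) \<Rightarrow> nat \<Rightarrow> nat \<Rightarrow> nat set set" where
  "star c u z = (\<lambda>b. {z, b}) ` (nb D u - U) \<union> (\<lambda>b. {z, c b}) ` {b \<in> nb D u \<inter> U. b < u \<and> c b \<noteq> b}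
     \<union> (\<lambda>b. {u, b}) ` nb D z"

text \<open>
  A set of controlled size that contains the edges of every star, for every choice of places.
\<close>
definition watched :: "nat set set" where
  "watched = (\<Union>u\<in>U. \<Union>z\<in>Z u. (\<lambda>b. {z, b}) ` (\<Union>b\<in>nb D u. places b) \<union> (\<lambda>b. {u, b}) ` nb D z)"

lemma watched_Kn: "watched \<subseteq> Kn n"
proof
  fix e assume "e \<in> watched"
  then obtain u z where uz: "u \<in> U" "z \<in> Z u"
    and e: "e \<in> (\<lambda>b. {z, b}) ` (\<Union>b\<in>nb D u. places b) \<union> (\<lambda>b. {u, b}) ` nb D z"
    unfolding watched_def by blast
  have z: "z \<in> {1..n}" "u \<in> {1..n}" using Z_sub[of u] U uz by auto
  from e consider b b' where "e = {z, b}" "b' \<in> nb D u" "b \<in> places b'" | b where "e = {u, b}" "b \<in> nb D z"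
    by blast
  then show "e \<in> Kn n"
  proof cases
    case 1
    have "b \<in> {1..n}"
      using 1 nb_Kn(1)[OF D, of u] Z_sub[of b'] by (auto simp: places_def)
    moreover have "z \<noteq> b"
    proof
      assume "z = b"
      then have "b' = u"
        using 1 uz Z_disj nb_U_notin_Z unfolding places_def by blast
      then show False using 1 nb_Kn(2)[OF D] by blast
    qed
    ultimately show ?thesis using z(1) 1(1) in_Kn_pair by metis
  next
    case 2
    then have "b \<in> {1..n}" "b \<noteq> u"
      using nb_Kn(1)[OF D, of z] nb_Z_notin_U[OF uz(2)] uz(1) by blast+
    then show ?thesis using z(2) 2(1) in_Kn_pair by metis
  qed
qed

lemma card_places: "card (places b) \<le> K + 1"
  unfolding places_def using card_insert_le_m1[of "K + 1" "Z b" b] Z_card[of b] Z_outside[of b]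
  by (cases "b \<in> U") auto

lemma finite_places: "finite (places b)"
  unfolding places_def using finite_Z by simp

lemma card_watched: "card watched \<le> card U * (K * (\<Delta> * (K + 2)))"
  unfolding watched_def
proof (rule card_UN_le_mult[OF finite_U])
  fix u assume u: "u \<in> U"
  have inner: "card ((\<lambda>b. {z, b}) ` (\<Union>b\<in>nb D u. places b) \<union> (\<lambda>b. {u, b}) ` nb D z) \<le> \<Delta> * (K + 2)" for z
  proof -
    have "card ((\<lambda>b. {z, b}) ` (\<Union>b\<in>nb D u. places b)) \<le> card (\<Union>b\<in>nb D u. places b)"
      using nb_Kn(3)[OF D] finite_places by (intro card_image_le) auto
    also have "\<dots> \<le> card (nb D u) * (K + 1)"
      using nb_Kn(3)[OF D] card_places by (intro card_UN_le_mult)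
    also have "\<dots> \<le> \<Delta> * (K + 1)"
      using deg by (intro mult_right_mono) auto
    finally have a: "card ((\<lambda>b. {z, b}) ` (\<Union>b\<in>nb D u. places b)) \<le> \<Delta> * (K + 1)" .
    have "card ((\<lambda>b. {u, b}) ` nb D z) \<le> \<Delta>"
      using card_image_le[OF nb_Kn(3)[OF D], of "\<lambda>b. {u, b}" z] deg[of z] by linarith
    with a have "card ((\<lambda>b. {z, b}) ` (\<Union>b\<in>nb D u. places b)) + card ((\<lambda>b. {u, b}) ` nb D z) \<le> \<Delta> * (K + 1) + \<Delta>"
      by (rule add_mono)
    then show ?thesis
      using card_Un_le[of "(\<lambda>b. {z, b}) ` (\<Union>b\<in>nb D u. places b)" "(\<lambda>b. {u, b}) ` nb D z"]
      by (simp add: algebra_simps)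
  qed
  have "card (\<Union>z\<in>Z u. (\<lambda>b. {z, b}) ` (\<Union>b\<in>nb D u. places b) \<union> (\<lambda>b. {u, b}) ` nb D z) \<le> card (Z u) * (\<Delta> * (K + 2))"
    using finite_Z inner by (rule card_UN_le_mult)
  then show "card (\<Union>z\<in>Z u. (\<lambda>b. {z, b}) ` (\<Union>b\<in>nb D u. places b) \<union> (\<lambda>b. {u, b}) ` nb D z) \<le> K * (\<Delta> * (K + 2))"
    using Z_card[OF u] by simp
qed

lemma star_watched:
  assumes "u \<in> U" "z \<in> Z u" "\<forall>b\<in>nb D u \<inter> U. c b \<in> places b"
  shows "star c u z \<subseteq> watched"
proof
  fix e assume "e \<in> star c u z"
  then consider b where "e = {z, b}" "b \<in> nb D u" "b \<in> places b"
    | b where "e = {z, c b}" "b \<in> nb D u" "c b \<in> places b" | b where "e = {u, b}" "b \<in> nb D z"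
    using assms(3) unfolding star_def by (auto simp: places_def)
  then show "e \<in> watched"
    unfolding watched_def using assms(1,2) by cases blast+
qed

lemma card_star: "card (star c u z) \<le> 2 * \<Delta>"
proof -
  let ?A = "(\<lambda>b. {z, b}) ` (nb D u - U)" and ?B = "(\<lambda>b. {z, c b}) ` {b \<in> nb D u \<inter> U. b < u \<and> c b \<noteq> b}"
    and ?C = "(\<lambda>b. {u, b}) ` nb D z"
  note fin = nb_Kn(3)[OF D]
  have "card ?B \<le> card {b \<in> nb D u \<inter> U. b < u \<and> c b \<noteq> b}"
    using fin by (intro card_image_le) auto
  also have "\<dots> \<le> card (nb D u \<inter> U)"
    using fin by (intro card_mono) auto
  finally have "card ?B \<le> card (nb D u \<inter> U)" .
  moreover have "card ?A \<le> card (nb D u - U)"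
    using fin by (intro card_image_le) auto
  moreover have "card (nb D u - U) + card (nb D u \<inter> U) = card (nb D u)"
    using fin by (metis add.commute card_Diff_subset_Int card_Int_Diff)
  moreover have "card ?C \<le> \<Delta>"
    using card_image_le[OF fin, of "\<lambda>b. {u, b}" z] deg[of z] by linarith
  moreover have "card (star c u z) \<le> card ?A + card ?B + card ?C"
    unfolding star_def by (intro order_trans[OF card_Un_le] add_mono order_refl)
  ultimately show ?thesis
    using deg[of u] by linarith
qed

text \<open>
  The two kinds of star edges: those at \<open>z\<close> avoid \<open>U\<close>, and if the other end is a candidate as well, it
  belongs to an earlier vertex; those at \<open>u\<close> meet \<open>U\<close> only there.
\<close>
lemma star_cases:
  assumes "u \<in> U" "z \<in> Z u" "\<forall>b\<in>nb D u \<inter> U. c b \<in> places b" "e \<in> star c u z"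
  obtains x where "e = {z, x}" "e \<inter> U = {}" "\<And>v. x \<in> Z v \<Longrightarrow> v < u"
    | b where "e = {u, b}" "b \<in> nb D z" "b \<notin> U"
proof -
  have zU: "z \<notin> U" using Z_sub[of u] assms(2) by auto
  from assms(4) consider b where "e = {z, b}" "b \<in> nb D u" "b \<notin> U"
    | b where "e = {z, c b}" "b \<in> nb D u" "b \<in> U" "b < u" "c b \<noteq> b" | b where "e = {u, b}" "b \<in> nb D z"
    unfolding star_def by blast
  then show thesis
  proof cases
    case (1 b)
    then show thesis
      using that(1)[of b] zU nb_U_notin_Z[OF assms(1)] by blast
  next
    case (2 b)
    then have cb: "c b \<in> Z b"
      using assms(3) by (auto simp: places_def)
    show thesis
    proof (rule that(1)[of "c b"])
      show "e \<inter> U = {}" using 2 zU cb Z_sub[of b] by auto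
      show "v < u" if "c b \<in> Z v" for v
        using Z_disj[OF that cb] 2 by simp
    qed (use 2 in simp)
  next
    case (3 b)
    then show thesis
      using that(2)[of b] nb_Z_notin_U[OF assms(2)] by blast
  qed
qed

text \<open>
  An edge determines its pair \<open>(u, z)\<close>.  If it joins two candidates, the owner is the later of the two
  vertices that they belong to; if it meets \<open>U\<close>, then \<open>z\<close> is the only candidate adjacent to the other
  end.
\<close>
lemma star_disjoint:
  assumes "u \<in> U" "z \<in> Z u" "\<forall>b\<in>nb D u \<inter> U. c b \<in> places b"
    and "u' \<in> U" "z' \<in> Z u'" "\<forall>b\<in>nb D u' \<inter> U. c b \<in> places b"
    and e: "e \<in> star c u z" "e \<in> star c u' z'"
  shows "u = u' \<and> z = z'"
proof (cases rule: star_cases[OF assms(1,2) assms(3) e(1)])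
  case (1 x)
  note one = this
  show ?thesis
  proof (cases rule: star_cases[OF assms(4,5) assms(6) e(2)])
    case (1 x')
    have "{z, x} = {z', x'}" using one(1) 1(1) by simp
    then consider "z = z'" | "z = x'" "x = z'" by (auto simp: doubleton_eq_iff)
    then show ?thesis
    proof cases
      case 1
      then show ?thesis using Z_disj assms(2,5) by blast
    next
      case 2
      then have "u' < u" "u < u'"
        using one(3) 1(3) assms(2,5) by blast+
      then show ?thesis by simp
    qed
  next
    case (2 b)
    then show ?thesis using one(2) assms(4) by blast
  qed
next
  case (2 b)
  note two = this
  show ?thesis
  proof (cases rule: star_cases[OF assms(4,5) assms(6) e(2)])
    case (1 x)
    then show ?thesis using two(1) assms(1) by blast
  next
    case (2 b')
    then have "u = u'" "b = b'"
      using two assms(1,4) by (auto simp: doubleton_eq_iff)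
    then show ?thesis
      using Z_nb_nb[OF assms(2,5)] two(2) 2(2) by blast
  qed
qed

text \<open>
  Each vertex in increasing order takes some candidate whose star is complete, given the places of the
  earlier ones, and stays where it is if there is none.
\<close>
lemma greedy_choice:
  "\<exists>c. \<forall>u. if u \<in> U \<and> (\<exists>z\<in>Z u. star c u z \<subseteq> E) then c u \<in> Z u \<and> star c u (c u) \<subseteq> E else c u = u"
proof -
  define P where "P = (\<lambda>c u y. if u \<in> U \<and> (\<exists>z\<in>Z u. star c u z \<subseteq> E) then y \<in> Z u \<and> star c u y \<subseteq> E else y = u)"
  have "\<exists>c. \<forall>u. P c u (c u)"
  proof (rule dependent_wf_choice[of less_than])
    fix f g :: "nat \<Rightarrow> nat" and u y
    assume "\<And>v. (v, u) \<in> less_than \<Longrightarrow> f v = g v"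
    then have fg: "\<And>v. v < u \<Longrightarrow> f v = g v" by simp
    have "star f u z = star g u z" for z
    proof -
      have "{b \<in> nb D u \<inter> U. b < u \<and> f b \<noteq> b} = {b \<in> nb D u \<inter> U. b < u \<and> g b \<noteq> b}"
        using fg by auto
      moreover have "(\<lambda>b. {z, f b}) ` {b \<in> nb D u \<inter> U. b < u \<and> g b \<noteq> b} = (\<lambda>b. {z, g b}) ` {b \<in> nb D u \<inter> U. b < u \<and> g b \<noteq> b}"
        using fg by (intro image_cong) auto
      ultimately show ?thesis by (simp only: star_def)
    qed
    then show "P f u y = P g u y" by (simp only: P_def)
  next
    fix u :: nat and f :: "nat \<Rightarrow> nat"
    show "\<exists>y. P f u y" unfolding P_def by auto
  qed simp
  then show ?thesis by (simp only: P_def)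
qed

text \<open>
  The new embedding exchanges every repaired vertex with its candidate.  The image of an edge between
  two repaired vertices lies in the star of the larger one, the image of an edge with one moving end lies
  in the star of that exchange, and edges without moving ends stay where they are.
\<close>
lemma swap_embedding:
  assumes c: "\<And>u. if u \<in> U \<and> (\<exists>z\<in>Z u. star c u z \<subseteq> E) then c u \<in> Z u \<and> star c u (c u) \<subseteq> E else c u = u"
    and good: "\<And>e. e \<in> D \<Longrightarrow> e \<inter> U = {} \<Longrightarrow> e \<in> E"
  shows "E \<in> near_copy n D (card {u \<in> U. c u = u})"
proof -
  define V where "V = {u \<in> U. c u = u}"
  \<comment> \<open>The product of the transpositions of \<open>u\<close> and \<open>c u\<close>; it is an involution.\<close>
  define \<phi> where "\<phi> = (\<lambda>v. if v \<in> U then c v else if \<exists>u\<in>U. c u = v then THE u. u \<in> U \<and> c u = v else v)"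
  have moved: "c u \<in> Z u \<and> star c u (c u) \<subseteq> E" if "u \<in> U" "u \<notin> V" for u
    using c[of u] that by (auto simp: V_def split: if_splits)
  have cZ: "u \<notin> V \<and> v \<in> Z u" if "u \<in> U" "c u = v" "v \<notin> U" for u v
  proof -
    have "u \<notin> V" using that by (auto simp: V_def)
    then show ?thesis using moved[OF that(1)] that(2) by blast
  qed
  have uniq: "u = u'" if "u \<in> U" "u' \<in> U" "c u = v" "c u' = v" "v \<notin> U" for u u' v
    using cZ[OF that(1,3,5)] cZ[OF that(2,4,5)] Z_disj by blast
  have \<phi>U: "\<phi> u = c u" if "u \<in> U" for u
    using that by (simp add: \<phi>_def)
  have \<phi>Z: "\<phi> v = u" if "u \<in> U" "c u = v" "v \<notin> U" for u v
  proof -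
    have "(THE u. u \<in> U \<and> c u = v) = u"
    proof (rule the_equality)
      fix w assume "w \<in> U \<and> c w = v"
      then show "w = u" using uniq[of w u v] that by blast
    qed (use that in blast)
    moreover have "\<exists>u\<in>U. c u = v" using that by blast
    ultimately show ?thesis using that(3) by (simp add: \<phi>_def)
  qed
  have \<phi>other: "\<phi> v = v" if "v \<notin> U" "\<not> (\<exists>u\<in>U. c u = v)" for v
    using that by (simp add: \<phi>_def)
  have c_notin_U: "c u \<notin> U" if "u \<in> U" "u \<notin> V" for u
    using moved[OF that] Z_sub[of u] by blast
  have inv: "\<phi> (\<phi> v) = v" for v
  proof (cases "v \<in> U")
    case True
    show ?thesis
    proof (cases "v \<in> V")
      case True
      then show ?thesis using \<phi>U[of v] by (simp add: V_def)
    next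
      case False
      then show ?thesis using \<phi>Z[OF True refl c_notin_U[OF True False]] \<phi>U[OF True] by simp
    qed
  next
    case False
    then show ?thesis
    proof (cases "\<exists>u\<in>U. c u = v")
      case True
      then obtain u where u: "u \<in> U" "c u = v" by blast
      then show ?thesis using \<phi>Z[OF u False] \<phi>U[OF u(1)] by simp
    next
      case no: False
      then show ?thesis using \<phi>other[OF False no] by simp
    qed
  qed
  have "\<phi> v = v" if "v \<notin> {1..n}" for v
  proof (rule \<phi>other)
    show vU: "v \<notin> U" using that U by blast
    show "\<not> (\<exists>u\<in>U. c u = v)"
      using cZ[OF _ _ vU] Z_sub that by blast
  qed
  then have perm: "\<phi> permutes {1..n}"
    unfolding permutes_def using inv by metis
  have VU: "V \<subseteq> {1..n}" using U by (auto simp: V_def)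
  have from_U: "{\<phi> a, \<phi> b} \<in> E" if "a \<in> U" "a \<notin> V" "b \<in> nb D a" "b \<notin> V" "b \<in> U \<Longrightarrow> b < a" for a b
  proof -
    have st: "star c a (c a) \<subseteq> E" using moved[OF that(1,2)] by simp
    show ?thesis
    proof (cases "b \<in> U")
      case True
      then have "{c a, c b} \<in> star c a (c a)"
        using that unfolding star_def V_def by blast
      then show ?thesis using st \<phi>U that(1) True by auto
    next
      case False
      then have "{c a, b} \<in> star c a (c a)"
        using that unfolding star_def by blast
      moreover have "\<not> (\<exists>u\<in>U. c u = b)"
        using cZ[OF _ _ False] nb_U_notin_Z[OF that(1,3)] by blast
      ultimately show ?thesis
        using st \<phi>U[OF that(1)] \<phi>other[OF False] by auto
    qed
  qed
  have from_Z: "{\<phi> a, \<phi> b} \<in> E" if "u \<in> U" "c u = a" "a \<notin> U" "b \<in> nb D a" for a b u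
  proof -
    have u: "u \<notin> V" "a \<in> Z u" using cZ[OF that(1-3)] by blast+
    have st: "star c u a \<subseteq> E" using moved[OF that(1) u(1)] that(2) by simp
    have bU: "b \<notin> U" using nb_Z_notin_U[OF u(2) that(4)] .
    have "\<not> (\<exists>u\<in>U. c u = b)"
      using cZ[OF _ _ bU] Z_nb_Z[OF u(2)] that(4) by blast
    then have "\<phi> b = b" using \<phi>other bU by blast
    moreover have "{u, b} \<in> star c u a"
      using that(4) unfolding star_def by blast
    ultimately show ?thesis using st \<phi>Z[OF that(1-3)] by auto
  qed
  have "\<phi> ` e \<in> E" if e: "e \<in> D" "\<phi> ` e \<inter> V = {}" for e
  proof -
    obtain a b where ab: "e = {a, b}" using e(1) D Kn_pairE by blast
    have fixV: "\<phi> v = v" if "v \<in> V" for v using that \<phi>U[of v] by (simp add: V_def)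
    have aV: "a \<notin> V" "b \<notin> V" using e(2) fixV ab by fastforce+
    have nbs: "b \<in> nb D a" "a \<in> nb D b" "a \<noteq> b"
      using e(1) ab nb_Kn(2)[OF D] by (auto simp: nb_def insert_commute)
    have swap: "\<phi> ` e = {\<phi> a, \<phi> b}" "\<phi> ` e = {\<phi> b, \<phi> a}" using ab by auto
    consider "a \<in> U" "b \<in> U \<Longrightarrow> b < a" | "b \<in> U" "a \<in> U \<Longrightarrow> a < b"
      | u where "a \<notin> U" "u \<in> U" "c u = a" | u where "b \<notin> U" "u \<in> U" "c u = b"
      | "a \<notin> U" "b \<notin> U" "\<not> (\<exists>u\<in>U. c u = a)" "\<not> (\<exists>u\<in>U. c u = b)"
      using nbs(3) by (metis linorder_neqE_nat)
    then show ?thesis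
    proof cases
      case 1
      then show ?thesis using from_U[OF 1(1) aV(1) nbs(1) aV(2)] swap(1) by simp
    next
      case 2
      then show ?thesis using from_U[OF 2(1) aV(2) nbs(2) aV(1)] swap(2) by simp
    next
      case (3 u)
      then show ?thesis using from_Z[OF 3(2,3,1) nbs(1)] swap(1) by simp
    next
      case (4 u)
      then show ?thesis using from_Z[OF 4(2,3,1) nbs(2)] swap(2) by simp
    next
      case 5
      then have "\<phi> ` e = e" using \<phi>other ab by simp
      moreover have "e \<inter> U = {}" using 5 ab by simp
      ultimately show ?thesis using good[OF e(1)] by simp
    qed
  qed
  then show ?thesis
    unfolding near_copy_def V_def[symmetric] using perm VU by blast
qed

end

section \<open>The failure probability of a repair stage\<close>

lemma near_copy_mono: "m \<le> m' \<Longrightarrow> near_copy n D m \<subseteq> near_copy n D m'"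
  unfolding near_copy_def by (blast intro: order_trans)

lemma fail_target_mono: "Q' \<subseteq> Q \<Longrightarrow> fail n Q t E \<le> fail n Q' t E"
  using fail_compose[of Q' n Q 0 0 t E] by (auto simp: subset_iff)

context candidates
begin

text \<open>
  A configuration consists of \<open>k\<close> vertices that stay defective and of the places of their neighbours in
  \<open>U\<close>.  There are at most \<open>(card U choose k) * (K + 1) ^ (\<Delta> * k)\<close> of them, and each makes \<open>k * K\<close>
  disjoint stars incomplete.
\<close>
lemma fail_swap_stage:
  fixes \<tau> :: real
  assumes n: "n \<ge> 6" and le: "8 * (card U * (K * (\<Delta> * (K + 2)))) \<le> n"
    and \<tau>: "0 \<le> \<tau>" "2 * \<tau> * n \<le> t + 1" and k: "1 \<le> k"
    and good: "\<And>e. e \<in> D \<Longrightarrow> e \<inter> U = {} \<Longrightarrow> e \<in> E0"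
  shows "fail n (near_copy n D (k - 1)) t E0 \<le>
     2 * (real (card U choose k) * (real (K + 1) ^ (\<Delta> * k) * (1 - (1 - exp (- \<tau>)) ^ (2 * \<Delta>)) ^ (k * K)))"
proof -
  define nbU where "nbU = (\<lambda>S. U \<inter> (\<Union>u\<in>S. nb D u))"
  define \<C> where "\<C> = (SIGMA S:{S. S \<subseteq> U \<and> card S = k}. PiE (nbU S) places)"
  define I where "I = (\<lambda>(S, c :: nat \<Rightarrow> nat). SIGMA u:S. Z u)"
  define St where "St = (\<lambda>(S :: nat set, c) (u, z). star c u z)"
  define P where "P = 1 - (1 - exp (- \<tau>)) ^ (2 * \<Delta>)"
  have fS: "finite S" if "S \<subseteq> U" for S using that finite_U finite_subset by blast
  have fnbU: "finite (nbU S)" for S using finite_U by (simp add: nbU_def)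
  have fP: "finite (PiE (nbU S) places)" for S
    using fnbU finite_places by (intro finite_PiE)
  have f1: "finite {S. S \<subseteq> U \<and> card S = k}"
    by (rule finite_subset[of _ "Pow U"]) (use finite_U in auto)
  have f\<C>: "finite \<C>" unfolding \<C>_def using f1 fP by (intro finite_SigmaI)
  have opt: "\<forall>b\<in>nb D u \<inter> U. c b \<in> places b" if "(S, c) \<in> \<C>" "u \<in> S" for S c u
    using that unfolding \<C>_def nbU_def by (auto simp: PiE_iff)
  have C: "S \<subseteq> U" "card S = k" "c \<in> PiE (nbU S) places" if "(S, c) \<in> \<C>" for S c
    using that unfolding \<C>_def by auto
  have "fail n (near_copy n D (k - 1)) t E0 \<le> 2 * (\<Sum>p\<in>\<C>. \<Prod>i\<in>I p. 1 - (1 - exp (- \<tau>)) ^ card (St p i))"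
  proof (rule fail_le_product[where F = watched])
    show "watched \<subseteq> Kn n" by (rule watched_Kn)
    show "8 * card watched \<le> n" using card_watched le by linarith
    show "finite (I p)" if "p \<in> \<C>" for p
    proof -
      obtain S c where p: "p = (S, c)" by (cases p)
      show ?thesis unfolding p I_def prod.case using fS[OF C(1)[OF that[unfolded p]]] finite_Z by (intro finite_SigmaI)
    qed
    show "St p i \<subseteq> watched" if "p \<in> \<C>" "i \<in> I p" for p i
    proof -
      obtain S c u z where p: "p = (S, c)" "i = (u, z)" by (cases p, cases i)
      have u: "u \<in> S" "z \<in> Z u" using that(2) by (simp_all add: p I_def)
      show ?thesis unfolding p St_def prod.case
        using star_watched[of u z c] u C(1)[OF that(1)[unfolded p]] opt[OF that(1)[unfolded p] u(1)] by blast
    qed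
    show "disjoint_family_on (St p) (I p)" if "p \<in> \<C>" for p
      unfolding disjoint_family_on_def
    proof (intro ballI impI)
      fix i j assume ij: "i \<in> I p" "j \<in> I p" "i \<noteq> j"
      obtain S c u z u' z' where p: "p = (S, c)" "i = (u, z)" "j = (u', z')" by (cases p, cases i, cases j)
      note pC = that[unfolded p]
      have u: "u \<in> S" "z \<in> Z u" "u' \<in> S" "z' \<in> Z u'" using ij by (simp_all add: p I_def)
      have uU: "u \<in> U" "u' \<in> U" using C(1)[OF pC] u by blast+
      have "\<not> (e \<in> star c u z \<and> e \<in> star c u' z')" for e
        using star_disjoint[OF uU(1) u(2) opt[OF pC u(1)] uU(2) u(4) opt[OF pC u(3)]] ij(3) p by blast
      then show "St p i \<inter> St p j = {}" unfolding p St_def prod.case by blast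
    qed
    fix E assume E: "E0 \<subseteq> E" "E \<notin> near_copy n D (k - 1)"
    obtain c where c: "\<And>u. if u \<in> U \<and> (\<exists>z\<in>Z u. star c u z \<subseteq> E) then c u \<in> Z u \<and> star c u (c u) \<subseteq> E else c u = u"
      using greedy_choice[of E] by blast
    have "E \<in> near_copy n D (card {u \<in> U. c u = u})"
      using swap_embedding[OF c] good E(1) by blast
    then have "\<not> card {u \<in> U. c u = u} \<le> k - 1"
      using E(2) near_copy_mono by blast
    then have "k \<le> card {u \<in> U. c u = u}" by linarith
    then obtain S where S: "S \<subseteq> {u \<in> U. c u = u}" "card S = k"
      by (rule obtain_subset_with_card_n)
    define c' where "c' = restrict c (nbU S)"
    have "c b \<in> places b" for b
      using c[of b] by (auto simp: places_def split: if_splits)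
    then have "(S, c') \<in> \<C>"
      using S by (auto simp: \<C>_def c'_def)
    moreover have "\<not> St (S, c') i \<subseteq> E" if "i \<in> I (S, c')" for i
    proof -
      obtain u z where iuz: "i = (u, z)" by (cases i)
      then have i: "i = (u, z)" "u \<in> S" "z \<in> Z u"
        using that by (simp_all add: I_def)
      have "u \<in> U" "c u = u" using i(2) S(1) by auto
      then have "\<not> star c u z \<subseteq> E"
        using c[of u] i(3) Z_sub[of u] by (auto split: if_splits)
      moreover have "star c' u z = star c u z"
      proof -
        have eq: "c' b = c b" if "b \<in> nb D u \<inter> U" for b
          using that i(2) by (auto simp: c'_def nbU_def)
        have "{b \<in> nb D u \<inter> U. b < u \<and> c' b \<noteq> b} = {b \<in> nb D u \<inter> U. b < u \<and> c b \<noteq> b}"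
          using eq by auto
        moreover have "(\<lambda>b. {z, c' b}) ` {b \<in> nb D u \<inter> U. b < u \<and> c b \<noteq> b} = (\<lambda>b. {z, c b}) ` {b \<in> nb D u \<inter> U. b < u \<and> c b \<noteq> b}"
          using eq by (intro image_cong) auto
        ultimately show ?thesis by (simp only: star_def)
      qed
      ultimately show ?thesis by (simp add: i(1) St_def)
    qed
    ultimately show "\<exists>p\<in>\<C>. \<forall>i\<in>I p. \<not> St p i \<subseteq> E" by blast
  qed (use n \<tau> f\<C> in simp_all)
  also have "(\<Sum>p\<in>\<C>. \<Prod>i\<in>I p. 1 - (1 - exp (- \<tau>)) ^ card (St p i)) \<le> (\<Sum>p\<in>\<C>. P ^ (k * K))"
  proof (rule sum_mono)
    fix p assume p: "p \<in> \<C>"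
    obtain S c where pSc: "p = (S, c)" by (cases p)
    note S = C(1,2)[OF p[unfolded pSc]]
    have card_I: "card (I p) = k * K"
    proof -
      have "card (I p) = (\<Sum>u\<in>S. card (Z u))"
        unfolding pSc I_def prod.case using fS[OF S(1)] finite_Z by simp
      also have "\<dots> = (\<Sum>u\<in>S. K)"
        using S(1) Z_card by (intro sum.cong) auto
      finally show ?thesis using S(2) by simp
    qed
    have q: "0 \<le> 1 - exp (- \<tau>)" "1 - exp (- \<tau>) \<le> 1" using \<tau>(1) by auto
    have "(\<Prod>i\<in>I p. 1 - (1 - exp (- \<tau>)) ^ card (St p i)) \<le> (\<Prod>i\<in>I p. P)"
    proof (rule prod_mono)
      fix i :: "nat \<times> nat"
      obtain u z where i: "i = (u, z)" by (cases i)
      have "card (St p i) \<le> 2 * \<Delta>"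
        unfolding i pSc St_def prod.case by (rule card_star)
      then have "(1 - exp (- \<tau>)) ^ (2 * \<Delta>) \<le> (1 - exp (- \<tau>)) ^ card (St p i)"
        using q by (intro power_decreasing)
      then show "0 \<le> 1 - (1 - exp (- \<tau>)) ^ card (St p i) \<and> 1 - (1 - exp (- \<tau>)) ^ card (St p i) \<le> P"
        using power_le_one[OF q] by (simp add: P_def)
    qed
    then show "(\<Prod>i\<in>I p. 1 - (1 - exp (- \<tau>)) ^ card (St p i)) \<le> P ^ (k * K)"
      by (simp add: card_I)
  qed
  also have "\<dots> = real (card \<C>) * P ^ (k * K)" by simp
  also have "\<dots> \<le> real ((card U choose k) * (K + 1) ^ (\<Delta> * k)) * P ^ (k * K)"
  proof (intro mult_right_mono of_nat_mono)
    have "card \<C> = (\<Sum>S\<in>{S. S \<subseteq> U \<and> card S = k}. card (PiE (nbU S) places))"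
      unfolding \<C>_def using f1 fP by simp
    also have "\<dots> \<le> (\<Sum>S\<in>{S. S \<subseteq> U \<and> card S = k}. (K + 1) ^ (\<Delta> * k))"
    proof (rule sum_mono)
      fix S assume "S \<in> {S. S \<subseteq> U \<and> card S = k}"
      then have S: "S \<subseteq> U" "card S = k" by auto
      have "card (nbU S) \<le> card (\<Union>u\<in>S. nb D u)"
        unfolding nbU_def using fS[OF S(1)] nb_Kn(3)[OF D] by (intro card_mono) auto
      also have "\<dots> \<le> card S * \<Delta>"
        using fS[OF S(1)] deg by (rule card_UN_le_mult)
      finally have c: "card (nbU S) \<le> \<Delta> * k" using S(2) by (simp add: mult.commute)
      have "card (PiE (nbU S) places) = (\<Prod>b\<in>nbU S. card (places b))"
        using fnbU by (rule card_PiE)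
      also have "\<dots> \<le> (\<Prod>b\<in>nbU S. K + 1)"
        using card_places by (intro prod_mono) auto
      also have "\<dots> = (K + 1) ^ card (nbU S)" by simp
      also have "\<dots> \<le> (K + 1) ^ (\<Delta> * k)" using c by (intro power_increasing) auto
      finally show "card (PiE (nbU S) places) \<le> (K + 1) ^ (\<Delta> * k)" .
    qed
    also have "\<dots> = (card U choose k) * (K + 1) ^ (\<Delta> * k)"
      using n_subsets[OF finite_U, of k] by simp
    finally show "card \<C> \<le> (card U choose k) * (K + 1) ^ (\<Delta> * k)" .
    show "0 \<le> P ^ (k * K)"
      unfolding P_def using \<tau>(1) power_le_one[of "1 - exp (- \<tau>)" "2 * \<Delta>"] by (intro zero_le_power) auto
  qed
  finally show ?thesis
    unfolding P_def by (simp only: of_nat_mult of_nat_power mult_ac)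
qed

end

text \<open>
  The repair for an arbitrary current embedding: transporting \<open>D\<close> along it reduces to the identity
  embedding.
\<close>
lemma stage:
  fixes \<tau> :: real
  assumes n: "n \<ge> 6" and D: "D \<subseteq> Kn n" and deg: "\<And>v. card {e \<in> D. v \<in> e} \<le> \<Delta>" and \<Delta>: "1 \<le> \<Delta>" "\<Delta> \<le> K"
    and le: "8 * (m * (K * (\<Delta> * (K + 2)))) \<le> n"
    and \<tau>: "0 \<le> \<tau>" "2 * \<tau> * n \<le> t + 1" and k: "1 \<le> k"
    and E: "E \<in> near_copy n D m"
  shows "fail n (near_copy n D (k - 1)) t E \<le>
     2 * (real (m choose k) * (real (K + 1) ^ \<Delta> * (1 - (1 - exp (- \<tau>)) ^ (2 * \<Delta>)) ^ K) ^ k)"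
proof -
  obtain \<pi> U where \<pi>: "\<pi> permutes {1..n}" and U: "U \<subseteq> {1..n}" "card U \<le> m"
    and good: "\<And>e. e \<in> D \<Longrightarrow> \<pi> ` e \<inter> U = {} \<Longrightarrow> \<pi> ` e \<in> E"
    using E unfolding near_copy_def by blast
  define D' where "D' = (`) \<pi> ` D"
  have inj: "inj \<pi>" using permutes_inj[OF \<pi>] .
  have D': "D' \<subseteq> Kn n" unfolding D'_def using image_in_Kn[OF \<pi>] D by blast
  have deg': "card (nb D' v) \<le> \<Delta>" for v
  proof -
    obtain w where w: "v = \<pi> w" using permutes_surj[OF \<pi>] by (metis surj_def)
    have "{e \<in> D'. v \<in> e} = (`) \<pi> ` {e \<in> D. w \<in> e}"
    proof (intro equalityI subsetI)
      fix e assume "e \<in> {e \<in> D'. v \<in> e}"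
      then obtain f where "f \<in> D" "e = \<pi> ` f" "\<pi> w \<in> \<pi> ` f"
        unfolding D'_def w by blast
      then show "e \<in> (`) \<pi> ` {e \<in> D. w \<in> e}"
        using inj_image_mem_iff[OF inj] by blast
    qed (auto simp: D'_def w)
    moreover have "card ((`) \<pi> ` {e \<in> D. w \<in> e}) \<le> card {e \<in> D. w \<in> e}"
      using D finite_subset[OF D finite_Kn] by (intro card_image_le) auto
    ultimately show ?thesis
      using deg[of w] card_nb[OF D', of v] by simp
  qed
  have "card U * (1 + \<Delta>) + card U * K * (1 + \<Delta> + \<Delta> * \<Delta>) \<le> n"
  proof -
    have "1 + \<Delta> \<le> 2 * (K * (\<Delta> * (K + 2)))"
    proof -
      have "1 * (\<Delta> * 2) \<le> K * (\<Delta> * (K + 2))"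
        using \<Delta> by (intro mult_le_mono) auto
      then show ?thesis using \<Delta> by linarith
    qed
    moreover have "K * (1 + \<Delta> + \<Delta> * \<Delta>) \<le> 3 * (K * (\<Delta> * (K + 2)))"
    proof -
      have "1 \<le> \<Delta> * \<Delta>" "\<Delta> \<le> \<Delta> * \<Delta>" using \<Delta> by auto
      then have "1 + \<Delta> + \<Delta> * \<Delta> \<le> 3 * (\<Delta> * \<Delta>)" by linarith
      also have "\<dots> \<le> 3 * (\<Delta> * (K + 2))" using \<Delta> by (intro mult_le_mono) auto
      finally have "K * (1 + \<Delta> + \<Delta> * \<Delta>) \<le> K * (3 * (\<Delta> * (K + 2)))" by (rule mult_le_mono2)
      then show ?thesis by (simp only: mult_ac)
    qed
    ultimately have "(1 + \<Delta>) + K * (1 + \<Delta> + \<Delta> * \<Delta>) \<le> 8 * (K * (\<Delta> * (K + 2)))" by linarith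
    then have "card U * ((1 + \<Delta>) + K * (1 + \<Delta> + \<Delta> * \<Delta>)) \<le> m * (8 * (K * (\<Delta> * (K + 2))))"
      using U(2) by (intro mult_le_mono)
    also have "\<dots> = 8 * (m * (K * (\<Delta> * (K + 2))))" by simp
    also note le
    finally show ?thesis by (simp only: distrib_left mult.assoc)
  qed
  then obtain Z where "candidates n D' U Z K \<Delta>"
    using candidates_exist[OF D' deg' U(1)] by blast
  then interpret cand: candidates n D' U Z K \<Delta> .
  have sub: "near_copy n D' (k - 1) \<subseteq> near_copy n D (k - 1)"
  proof
    fix E' assume "E' \<in> near_copy n D' (k - 1)"
    then obtain \<rho> V where \<rho>: "\<rho> permutes {1..n}" "V \<subseteq> {1..n}" "card V \<le> k - 1"
      and g: "\<And>e. e \<in> D' \<Longrightarrow> \<rho> ` e \<inter> V = {} \<Longrightarrow> \<rho> ` e \<in> E'"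
      unfolding near_copy_def by blast
    have "(\<rho> \<circ> \<pi>) permutes {1..n}" using \<pi> \<rho>(1) by (rule permutes_compose)
    moreover have "(\<rho> \<circ> \<pi>) ` e \<in> E'" if "e \<in> D" "(\<rho> \<circ> \<pi>) ` e \<inter> V = {}" for e
      using g[of "\<pi> ` e"] that by (simp add: D'_def image_comp)
    ultimately show "E' \<in> near_copy n D (k - 1)"
      unfolding near_copy_def using \<rho>(2,3) by blast
  qed
  have le': "8 * (card U * (K * (\<Delta> * (K + 2)))) \<le> n"
    using le U(2) by (meson le_trans mult_le_mono1 mult_le_mono2)
  let ?P = "1 - (1 - exp (- \<tau>)) ^ (2 * \<Delta>)"
  have P: "0 \<le> ?P" using \<tau>(1) power_le_one[of "1 - exp (- \<tau>)" "2 * \<Delta>"] by auto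
  have "fail n (near_copy n D (k - 1)) t E \<le> fail n (near_copy n D' (k - 1)) t E"
    by (rule fail_target_mono[OF sub])
  also have "\<dots> \<le> 2 * (real (card U choose k) * (real (K + 1) ^ (\<Delta> * k) * ?P ^ (k * K)))"
    by (rule cand.fail_swap_stage[OF n le' \<tau> k]) (use good D'_def in blast)
  also have "\<dots> \<le> 2 * (real (m choose k) * (real (K + 1) ^ (\<Delta> * k) * ?P ^ (k * K)))"
    using binomial_right_mono[OF U(2), of k] P by (intro mult_left_mono mult_right_mono) auto
  also have "real (K + 1) ^ (\<Delta> * k) * ?P ^ (k * K) = (real (K + 1) ^ \<Delta> * ?P ^ K) ^ k"
    by (simp only: power_mult_distrib power_mult[symmetric] mult.commute[of k K])
  finally show ?thesis .
qed

text \<open>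
  Builder waits for the last edges of the current copy and declares one end of each edge that is still
  missing defective.  Here the configurations are the sets of \<open>k\<close> missing edges.
\<close>
lemma identity_stage:
  fixes \<tau> :: real
  assumes n: "n \<ge> 6" and D: "D \<subseteq> Kn n" and le: "8 * card (D - E) \<le> n"
    and \<tau>: "0 \<le> \<tau>" "2 * \<tau> * n \<le> t + 1" and k: "1 \<le> k"
  shows "fail n (near_copy n D (k - 1)) t E \<le> 2 * (real (card (D - E) choose k) * exp (- \<tau>) ^ k)"
proof -
  have fD: "finite D" using D finite_Kn finite_subset by blast
  define \<C> where "\<C> = {S. S \<subseteq> D - E \<and> card S = k}"
  have "fail n (near_copy n D (k - 1)) t E \<le>
      2 * (\<Sum>S\<in>\<C>. \<Prod>e\<in>S. 1 - (1 - exp (- \<tau>)) ^ card ((\<lambda>S e. {e}) S e))"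
  proof (rule fail_le_product[where F = "D - E"])
    show "finite \<C>"
      unfolding \<C>_def by (rule finite_subset[of _ "Pow D"]) (use fD in auto)
    show "finite S" if "S \<in> \<C>" for S
      using that fD finite_subset[of S D] by (auto simp: \<C>_def)
    fix E' assume E': "E \<subseteq> E'" "E' \<notin> near_copy n D (k - 1)"
    have "\<not> card (D - E') \<le> k - 1"
    proof
      assume c: "card (D - E') \<le> k - 1"
      define U where "U = (\<lambda>e. SOME v. v \<in> e) ` (D - E')"
      have some: "(SOME v. v \<in> e) \<in> e" "(SOME v. v \<in> e) \<in> {1..n}" if "e \<in> D" for e
      proof -
        have "e \<in> Kn n" using D that by blast
        then obtain a b where ab: "e = {a, b}" "a \<noteq> b" "a \<in> {1..n}" "b \<in> {1..n}"
          by (rule Kn_pairE)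
        then show "(SOME v. v \<in> e) \<in> e" by (intro someI[of "\<lambda>v. v \<in> e" a]) simp
        then show "(SOME v. v \<in> e) \<in> {1..n}" using ab by auto
      qed
      have "U \<subseteq> {1..n}" using some by (auto simp: U_def)
      moreover have "card U \<le> k - 1"
        unfolding U_def using c fD card_image_le[of "D - E'" "\<lambda>e. SOME v. v \<in> e"] by simp
      moreover have "\<forall>e\<in>D. id ` e \<inter> U = {} \<longrightarrow> id ` e \<in> E'"
        using some by (auto simp: U_def)
      ultimately have "E' \<in> near_copy n D (k - 1)"
        unfolding near_copy_def using permutes_id by blast
      then show False using E'(2) by simp
    qed
    then have "k \<le> card (D - E')" by linarith
    then obtain S where S: "S \<subseteq> D - E'" "card S = k"
      by (rule obtain_subset_with_card_n)
    then have "S \<in> \<C>" using E'(1) by (auto simp: \<C>_def)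
    moreover have "\<forall>e\<in>S. \<not> {e} \<subseteq> E'" using S by auto
    ultimately show "\<exists>S\<in>\<C>. \<forall>e\<in>S. \<not> {e} \<subseteq> E'" by blast
  qed (use n D le \<tau> in \<open>auto simp: disjoint_family_on_def \<C>_def\<close>)
  also have "(\<Sum>S\<in>\<C>. \<Prod>e\<in>S. 1 - (1 - exp (- \<tau>)) ^ card ((\<lambda>S e. {e}) S e)) = (\<Sum>S\<in>\<C>. exp (- \<tau>) ^ k)"
    by (intro sum.cong) (auto simp: \<C>_def)
  also have "\<dots> = real (card (D - E) choose k) * exp (- \<tau>) ^ k"
    unfolding \<C>_def using n_subsets[of "D - E" k] fD by simp
  finally show ?thesis .
qed

section \<open>The greedy phases\<close>

text \<open>
  From \<open>fact k \<ge> (k / e) ^ k\<close>, which is read off the exponential series.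
\<close>
lemma choose_le_exp_power:
  assumes "k \<ge> 1"
  shows "real (m choose k) \<le> (exp 1 * m / k) ^ k"
proof -
  have "real ((m choose k) * fact k) \<le> real (m ^ k)"
    using binomial_fact_pow[of m k] by (rule of_nat_mono)
  then have a: "real (m choose k) * fact k \<le> real m ^ k"
    by simp
  have e: "(\<lambda>i. real k ^ i / fact i) sums exp (real k)"
    using exp_converges[of "real k"] by (simp add: scaleR_conv_of_real divide_inverse mult.commute)
  have "(\<Sum>i\<in>{k}. real k ^ i / fact i) \<le> (\<Sum>i. real k ^ i / fact i)"
    using e by (intro sum_le_suminf) (auto simp: sums_iff)
  then have "real k ^ k / fact k \<le> exp (real k)"
    using e by (simp add: sums_iff)
  then have b: "real k ^ k \<le> exp 1 ^ k * fact k"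
    by (simp add: exp_of_nat_mult[symmetric] field_simps)
  have "real (m choose k) * real k ^ k \<le> real (m choose k) * (exp 1 ^ k * fact k)"
    using b by (rule mult_left_mono) simp
  also have "\<dots> = exp 1 ^ k * (real (m choose k) * fact k)" by simp
  also have "\<dots> \<le> exp 1 ^ k * real m ^ k"
    using a by (rule mult_left_mono) simp
  finally have "real (m choose k) * real k ^ k \<le> (exp 1 * m) ^ k"
    by (simp add: power_mult_distrib)
  then show ?thesis
    using assms by (simp add: power_divide field_simps)
qed

lemma choose_mult_power_le:
  assumes "k \<ge> 1" "0 \<le> \<phi>" "exp 1 * (real m / k) * \<phi> \<le> c"
  shows "real (m choose k) * \<phi> ^ k \<le> c ^ k"
proof -
  have "real (m choose k) * \<phi> ^ k \<le> (exp 1 * m / k) ^ k * \<phi> ^ k"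
    using choose_le_exp_power[OF assms(1)] assms(2) by (intro mult_right_mono) auto
  also have "\<dots> = (exp 1 * (real m / k) * \<phi>) ^ k"
    by (subst power_mult_distrib[symmetric]) simp
  also have "\<dots> \<le> c ^ k"
    using assms(2,3) by (intro power_mono) auto
  finally show ?thesis .
qed

lemma handshake_le:
  assumes D: "D \<subseteq> Kn n" and deg: "\<And>v. card {e \<in> D. v \<in> e} \<le> \<Delta>"
  shows "2 * card D \<le> \<Delta> * n"
proof -
  have fD: "finite D" using D finite_Kn finite_subset by blast
  have "2 * card D = (\<Sum>e\<in>D. card e)"
    using D by (simp add: Kn_eq subset_iff)
  also have "\<dots> = (\<Sum>e\<in>D. \<Sum>v\<in>{1..n}. if v \<in> e then 1 else 0)"
  proof (rule sum.cong)
    fix e assume "e \<in> D"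
    then have "e \<subseteq> {1..n}" using D by (auto simp: Kn_eq)
    then show "card e = (\<Sum>v\<in>{1..n}. if v \<in> e then 1 else 0)"
      by (simp add: sum.If_cases Int_absorb1)
  qed simp
  also have "\<dots> = (\<Sum>v\<in>{1..n}. \<Sum>e\<in>D. if v \<in> e then 1 else 0)"
    by (rule sum.swap)
  also have "\<dots> = (\<Sum>v\<in>{1..n}. card {e \<in> D. v \<in> e})"
    using fD by (simp add: sum.If_cases Int_def)
  also have "\<dots> \<le> (\<Sum>v\<in>{1..n}. \<Delta>)"
    using deg by (rule sum_mono)
  finally show ?thesis by (simp add: mult.commute)
qed

text \<open>
  While \<open>128 * y\<^sup>2 * n\<close> edges are missing, where \<open>y\<close> is the fourth root of \<open>\<Delta>\<close>, a round fails with probability at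
  most \<open>x\<^sup>2\<close> for \<open>x = 1 / (4 * y)\<close>.  An excess of the fraction \<open>4 * x\<close> over \<open>\<Delta> * n / 2\<close> rounds then absorbs all
  failures, by \<open>fail_drift\<close> with this \<open>x\<close>.
\<close>
lemma greedy_bulk:
  fixes y :: real
  assumes n: "n \<ge> 6" and D: "D \<subseteq> Kn n" and M: "2 * card D \<le> \<Delta> * n" and y: "y \<ge> 1" "y ^ 4 = \<Delta>"
    and t: "(1 + 1 / y) * (real \<Delta> * real n / 2) \<le> t" "t \<le> (1 + 1 / y) * (real \<Delta> * real n / 2) + 1"
    and k: "128 * y\<^sup>2 * n \<le> k"
  shows "fail n {E. card (D - E) < k} t {} \<le> exp (1 - n / 4)"
proof -
  define x where "x = 1 / (4 * y)"
  have x: "0 < x" "x \<le> 1 / 4" "4 * x = 1 / y" using y(1) by (auto simp: x_def field_simps)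
  have fD: "finite D" using D finite_Kn finite_subset by blast
  have "0 < 128 * y\<^sup>2 * real n" using y(1) n by (intro mult_pos_pos) auto
  then have k0: "0 < k" using k by linarith
  have "fail n {E. card (D - E) < k} t {} \<le> (1 - (1 - x\<^sup>2) * (1 - x)) ^ t * (1 / x) ^ (card (D - {}) - k)"
  proof (rule fail_drift[OF fD])
    fix B assume B: "B \<subseteq> D" "k \<le> card B"
    have BK: "B \<subseteq> Kn n" "B \<noteq> {}" using B D k0 by auto
    have "tree_avg n (\<lambda>T. of_bool (T \<inter> B = {})) \<le> 8 * n / card B"
      using tree_avg_miss[OF n BK] by simp
    also have "\<dots> \<le> 8 * n / (128 * y\<^sup>2 * n)"
    proof (rule divide_left_mono)
      show "128 * y\<^sup>2 * n \<le> card B" using k B(2) by linarith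
      show "0 < real (card B) * (128 * y\<^sup>2 * real n)"
        using \<open>0 < 128 * y\<^sup>2 * real n\<close> k0 B(2) by (intro mult_pos_pos[OF _ \<open>0 < 128 * y\<^sup>2 * real n\<close>]) auto
    qed simp
    also have "\<dots> = x\<^sup>2"
      using n y(1) by (simp add: x_def power2_eq_square field_simps)
    finally have "tree_avg n (\<lambda>T. of_bool (T \<inter> B = {})) \<le> x\<^sup>2" .
    moreover have "tree_avg n (\<lambda>T. of_bool (T \<inter> B \<noteq> {})) = tree_avg n (\<lambda>T. 1 - of_bool (T \<inter> B = {}))"
      by (intro tree_avg_cong) auto
    ultimately show "1 - x\<^sup>2 \<le> tree_avg n (\<lambda>T. of_bool (T \<inter> B \<noteq> {}))"
      by (simp add: tree_avg_diff)
  qed (use x in \<open>auto simp: power2_eq_square mult_le_one\<close>)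
  also have "\<dots> \<le> (x * (1 + x)) ^ t * (1 / x) ^ card D"
  proof (intro mult_mono power_mono power_increasing)
    show "1 - (1 - x\<^sup>2) * (1 - x) \<le> x * (1 + x)"
      using x by (simp add: power2_eq_square algebra_simps)
    show "0 \<le> 1 - (1 - x\<^sup>2) * (1 - x)"
      using x by (simp add: power2_eq_square mult_le_one)
  qed (use x in auto)
  also have "\<dots> \<le> exp (1 - n / 4)"
  proof -
    have Mt: "real (card D) \<le> real \<Delta> * real n / 2"
    proof -
      have "real (2 * card D) \<le> real (\<Delta> * n)" using M by (rule of_nat_mono)
      then show ?thesis by simp
    qed
    have "real \<Delta> * real n / 2 \<le> (1 + 1 / y) * (real \<Delta> * real n / 2)"
      using y(1) by (simp add: algebra_simps)
    then have le: "card D \<le> t" using Mt t(1) by linarith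
    have "(x * (1 + x)) ^ t * (1 / x) ^ card D = x ^ (t - card D) * (1 + x) ^ t"
    proof -
      have "x ^ t = x ^ (t - card D) * x ^ card D"
        using le by (simp add: power_add[symmetric])
      then have "x ^ t * (1 / x) ^ card D = x ^ (t - card D) * (x * (1 / x)) ^ card D"
        by (simp only: power_mult_distrib mult.assoc)
      then have h: "x ^ t * (1 / x) ^ card D = x ^ (t - card D)"
        using x(1) by simp
      have "(x * (1 + x)) ^ t * (1 / x) ^ card D = (x ^ t * (1 / x) ^ card D) * (1 + x) ^ t"
        by (simp only: power_mult_distrib mult_ac)
      then show ?thesis by (simp only: h)
    qed
    also have "\<dots> \<le> exp (-1) ^ (t - card D) * exp x ^ t"
    proof (intro mult_mono power_mono)
      have "exp (1::real) \<le> 4" using exp_le by linarith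
      then have "1 / 4 \<le> exp (-1 :: real)" by (simp add: exp_minus field_simps)
      then show "x \<le> exp (-1)" using x(2) by linarith
    qed (use x in auto)
    also have "\<dots> = exp (x * t - (real t - card D))"
      using le by (simp add: exp_of_nat_mult[symmetric] exp_add[symmetric] of_nat_diff mult.commute)
    also have "x * t - (real t - card D) \<le> 1 - n / 4"
    proof -
      have "x * t \<le> x * ((1 + 4 * x) * (real \<Delta> * real n / 2) + 1)"
        using t(2) x by (intro mult_left_mono) auto
      also have "\<dots> \<le> x * ((1 + 1) * (real \<Delta> * real n / 2) + 1)"
        using x by (intro mult_left_mono add_mono mult_right_mono) auto
      finally have a: "x * t \<le> x * (real \<Delta> * real n) + x" by (simp add: algebra_simps)
      have "4 * x * (real \<Delta> * real n / 2) \<le> real t - card D"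
        using t(1) Mt unfolding x(3) by (simp add: algebra_simps)
      then have b: "2 * (x * (real \<Delta> * real n)) \<le> real t - card D" by simp
      have "1 / 4 \<le> x * \<Delta>"
      proof -
        have "x * real \<Delta> = y ^ 3 / 4"
          using y by (simp add: x_def y(2)[symmetric] power_numeral_reduce field_simps)
        moreover have "1 \<le> y ^ 3" using y(1) by (rule one_le_power)
        ultimately show ?thesis by simp
      qed
      then have "1 / 4 * n \<le> x * real \<Delta> * real n" by (intro mult_right_mono) auto
      then have c: "n / 4 \<le> x * (real \<Delta> * real n)" by (simp add: mult_ac)
      show ?thesis using a b c x(2) by linarith
    qed
    finally show ?thesis by simp
  qed
  finally show ?thesis .
qed

text \<open>
  From a multiple of \<open>n\<close> down to \<open>n / 8\<close> missing edges every round succeeds with probability at least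
  \<open>1 / 16\<close>, so a number of rounds proportional to the number of missing edges suffices.
\<close>
lemma greedy_middle:
  fixes y :: real
  assumes n: "n \<ge> 8" and D: "D \<subseteq> Kn n" and y: "y \<ge> 1"
    and t: "4128 * y\<^sup>2 * n \<le> t" and E: "card (D - E) \<le> 128 * y\<^sup>2 * n"
  shows "fail n {E. card (D - E) < n div 8 + 1} t E \<le> exp (- real n)"
proof -
  have fD: "finite D" using D finite_Kn finite_subset by blast
  have "fail n {E. card (D - E) < n div 8 + 1} t E \<le> (1 - 1 / 16 * (1 - 1 / 2)) ^ t * (1 / (1 / 2)) ^ (card (D - E) - (n div 8 + 1))"
  proof (rule fail_drift[OF fD])
    fix B assume "B \<subseteq> D" "n div 8 + 1 \<le> card B"
    then show "1 / 16 \<le> tree_avg n (\<lambda>T. of_bool (T \<inter> B \<noteq> {}))"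
      using n D by (intro tree_avg_hit) auto
  qed auto
  also have "\<dots> \<le> exp (- (1 / 32)) ^ t * exp 1 ^ card (D - E)"
  proof (rule mult_mono)
    have "1 - 1 / 16 * (1 - 1 / 2) \<le> exp (- (1 / 32 :: real))"
      using exp_ge_add_one_self[of "- (1 / 32 :: real)"] by simp
    then show "(1 - 1 / 16 * (1 - 1 / 2)) ^ t \<le> exp (- (1 / 32 :: real)) ^ t"
      by (intro power_mono) auto
    have "(1 / (1 / 2)) ^ (card (D - E) - (n div 8 + 1)) \<le> (2 :: real) ^ card (D - E)"
      by (simp add: power_increasing)
    also have "\<dots> \<le> exp 1 ^ card (D - E)"
      using exp_ge_add_one_self[of "1 :: real"] by (intro power_mono) auto
    finally show "(1 / (1 / 2)) ^ (card (D - E) - (n div 8 + 1)) \<le> exp (1 :: real) ^ card (D - E)" .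
  qed auto
  also have "\<dots> = exp (real (card (D - E)) - t / 32)"
    by (simp add: exp_of_nat_mult[symmetric] exp_add[symmetric])
  also have "real (card (D - E)) - t / 32 \<le> - real n"
  proof -
    have "1 * real n \<le> y\<^sup>2 * n" using y by (intro mult_right_mono) auto
    then show ?thesis using E t by simp
  qed
  finally show ?thesis by simp
qed

section \<open>The schedule of the repair stages\<close>

text \<open>
  The growth of the number of candidates by \<open>16 ^ \<Delta>\<close> per stage outweighs the decline of the probability
  that a star is completed, which is \<open>(1 / 4) ^ (\<Delta> * i)\<close> in stage \<open>i \<ge> 1\<close>.
\<close>
definition cand_size :: "nat \<Rightarrow> nat \<Rightarrow> nat" where
  "cand_size \<Delta> i = 100 * \<Delta>\<^sup>2 * 16 ^ (\<Delta> * i)"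

text \<open>
  An upper bound for the fraction of defective vertices at the beginning of stage \<open>i\<close>, chosen so that the
  watched edges are at most \<open>n / 8\<close> in number.
\<close>
definition defect :: "nat \<Rightarrow> nat \<Rightarrow> real" where
  "defect \<Delta> i = 1 / (8 * real \<Delta> * real (cand_size \<Delta> i) * (real (cand_size \<Delta> i) + 2))"

definition defect_nat :: "nat \<Rightarrow> nat \<Rightarrow> nat \<Rightarrow> nat" where
  "defect_nat n \<Delta> i = nat \<lfloor>defect \<Delta> i * n\<rfloor>"

lemma cand_size_pos: "1 \<le> \<Delta> \<Longrightarrow> 100 \<le> cand_size \<Delta> i"
proof -
  assume "1 \<le> \<Delta>"
  then have "100 * 1 * 1 \<le> cand_size \<Delta> i"
    unfolding cand_size_def by (intro mult_le_mono) auto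
  then show ?thesis by simp
qed

lemma cand_size_ge:
  assumes "1 \<le> \<Delta>"
  shows "100 * real \<Delta> ^ 2 * (1 + real i) \<le> cand_size \<Delta> i" "\<Delta> \<le> cand_size \<Delta> i"
    "100 * real \<Delta> ^ 2 * (1 + real i) \<le> 100 * real \<Delta> ^ 2 * 4 ^ (\<Delta> * i)"
proof -
  have b: "1 + real i \<le> c ^ (\<Delta> * i)" if "c \<ge> 2" for c :: real
  proof -
    have "1 + real i \<le> (1 + 1) ^ i" using Bernoulli_inequality[of 1 i] by simp
    also have "\<dots> \<le> c ^ i" using that by (intro power_mono) auto
    also have "\<dots> \<le> c ^ (\<Delta> * i)" using assms that by (intro power_increasing) auto
    finally show ?thesis .
  qed
  show "100 * real \<Delta> ^ 2 * (1 + real i) \<le> cand_size \<Delta> i"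
    unfolding cand_size_def using mult_left_mono[OF b[of 16], of "100 * real \<Delta> ^ 2"] by simp
  show "100 * real \<Delta> ^ 2 * (1 + real i) \<le> 100 * real \<Delta> ^ 2 * 4 ^ (\<Delta> * i)"
    using mult_left_mono[OF b[of 4], of "100 * real \<Delta> ^ 2"] by simp
  have "1 * \<Delta> * 1 \<le> cand_size \<Delta> i"
    unfolding cand_size_def using assms by (intro mult_le_mono) (auto simp: power2_eq_square)
  then show "\<Delta> \<le> cand_size \<Delta> i" by simp
qed

lemma cand_size_power_le:
  assumes "1 \<le> \<Delta>"
  shows "real (cand_size \<Delta> i + 1) ^ \<Delta> \<le> exp (5 * real \<Delta> + 2 * real \<Delta> ^ 2 + 3 * real \<Delta> ^ 2 * i)"
proof -
  have e2: "2 \<le> exp (1::real)" using exp_ge_add_one_self[of "1 :: real"] by simp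
  have e: "(27 / 10 :: real) \<le> exp 1" using e_approx_32 by (simp add: abs_if split: if_splits)
  have "(101 :: real) \<le> (27 / 10) ^ 5" "(16 :: real) \<le> (27 / 10) ^ 3" by (simp_all add: power_numeral_reduce)
  then have c: "(101 :: real) \<le> exp 5" "(16 :: real) \<le> exp 3"
    using power_mono[OF e, of 5] power_mono[OF e, of 3] by (simp_all add: exp_of_nat_mult[symmetric])
  have d: "real \<Delta> \<le> exp \<Delta>" using exp_ge_add_one_self[of "real \<Delta>"] by linarith
  have one: "1 \<le> \<Delta>\<^sup>2 * 16 ^ (\<Delta> * i)" using assms by simp
  have "real (cand_size \<Delta> i + 1) \<le> 101 * real \<Delta> ^ 2 * 16 ^ (\<Delta> * i)"
  proof -
    have "cand_size \<Delta> i + 1 \<le> 101 * (\<Delta>\<^sup>2 * 16 ^ (\<Delta> * i))"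
      using one unfolding cand_size_def by simp
    then have "real (cand_size \<Delta> i + 1) \<le> real (101 * (\<Delta>\<^sup>2 * 16 ^ (\<Delta> * i)))" by (rule of_nat_mono)
    then show ?thesis by simp
  qed
  also have "\<dots> \<le> exp 5 * exp \<Delta> ^ 2 * exp 3 ^ (\<Delta> * i)"
    using c d by (intro mult_mono power_mono) auto
  also have "\<dots> = exp (5 + 2 * real \<Delta> + 3 * (real \<Delta> * i))"
    by (simp add: exp_of_nat_mult[symmetric] exp_add[symmetric] mult_ac)
  finally have "real (cand_size \<Delta> i + 1) ^ \<Delta> \<le> exp (5 + 2 * real \<Delta> + 3 * (real \<Delta> * i)) ^ \<Delta>"
    by (intro power_mono) auto
  also have "\<dots> = exp (real \<Delta> * (5 + 2 * real \<Delta> + 3 * (real \<Delta> * i)))"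
    by (simp add: exp_of_nat_mult)
  also have "real \<Delta> * (5 + 2 * real \<Delta> + 3 * (real \<Delta> * i)) = 5 * real \<Delta> + 2 * real \<Delta> ^ 2 + 3 * real \<Delta> ^ 2 * i"
    by (simp add: algebra_simps power2_eq_square)
  finally show ?thesis .
qed

text \<open>
  The left-hand side collects the logarithms of all losses of a stage, namely the required improvement
  \<open>8 * 256 ^ \<Delta>\<close> and the number of configurations; the right-hand side is what the candidates gain.
\<close>
lemma exponent_le:
  assumes "1 \<le> \<Delta>"
  shows "3 + 6 * real \<Delta> + (5 * real \<Delta> + 2 * real \<Delta> ^ 2 + 3 * real \<Delta> ^ 2 * i) \<le> 100 * real \<Delta> ^ 2 * (1 + real i)"
proof -
  define d q where "d = real \<Delta>" and "q = d ^ 2"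
  have "1 \<le> d" using assms by (simp add: d_def)
  then have "1 \<le> q" "d \<le> q"
    unfolding q_def using one_le_power[of d 2] power_increasing[of 1 2 d] by simp_all
  moreover have "0 \<le> q * i" using \<open>1 \<le> q\<close> by simp
  ultimately have "3 + 6 * d + (5 * d + 2 * q + 3 * (q * i)) \<le> 100 * q + 100 * (q * i)"
    by linarith
  then show ?thesis
    by (simp add: d_def q_def algebra_simps)
qed

text \<open>
  With \<open>q = 1 / (16 * \<Delta>)\<close> a star of \<open>2 * \<Delta>\<close> edges is incomplete with probability at most \<open>2 * \<Delta> * q\<close>.
\<close>
lemma long_stage_miss:
  assumes "1 \<le> \<Delta>"
  shows "1 - (1 - exp (- ln (16 * real \<Delta>))) ^ (2 * \<Delta>) \<le> 1 / 8" "0 \<le> ln (16 * real \<Delta>)"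
    "0 \<le> 1 - (1 - exp (- ln (16 * real \<Delta>))) ^ (2 * \<Delta>)"
proof -
  have e: "exp (- ln (16 * real \<Delta>)) = 1 / (16 * real \<Delta>)"
    using assms by (simp add: exp_minus inverse_eq_divide)
  have s: "1 / (16 * real \<Delta>) \<le> 1" using assms by simp
  have "1 + real (2 * \<Delta>) * (- (1 / (16 * real \<Delta>))) \<le> (1 + - (1 / (16 * real \<Delta>))) ^ (2 * \<Delta>)"
    using s by (intro Bernoulli_inequality) auto
  moreover have "real (2 * \<Delta>) * (- (1 / (16 * real \<Delta>))) = - (1 / 8)" using assms by simp
  ultimately show "1 - (1 - exp (- ln (16 * real \<Delta>))) ^ (2 * \<Delta>) \<le> 1 / 8"
    unfolding e by simp
  show "0 \<le> ln (16 * real \<Delta>)" using assms by simp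
  show "0 \<le> 1 - (1 - exp (- ln (16 * real \<Delta>))) ^ (2 * \<Delta>)"
    unfolding e using s assms power_le_one[of "1 - 1 / (16 * real \<Delta>)" "2 * \<Delta>"] by simp
qed

text \<open>
  The duration of stage \<open>i\<close> in units of \<open>2 * n\<close> rounds.  An edge is collected with probability
  \<open>1 - 1 / (16 * \<Delta>)\<close> in stage 0 and with probability \<open>(1 / 2) ^ i\<close> in stage \<open>i \<ge> 1\<close>.
\<close>
definition stage_rate :: "nat \<Rightarrow> nat \<Rightarrow> real" where
  "stage_rate \<Delta> i = (if i = 0 then ln (16 * real \<Delta>) else - ln (1 - (1 / 2) ^ i))"

lemma stage_rate_nonneg: "1 \<le> \<Delta> \<Longrightarrow> 0 \<le> stage_rate \<Delta> i"
  using power_le_one[of "1 / 2 :: real" i] power_strict_mono[of "1 / 2 :: real" 1 i]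
  by (auto simp: stage_rate_def)

lemma stage_rate_le: "i \<ge> 1 \<Longrightarrow> stage_rate \<Delta> i \<le> 2 * (1 / 2) ^ i"
proof -
  assume i: "i \<ge> 1"
  let ?x = "(1 / 2 :: real) ^ i"
  have x: "0 \<le> ?x" "?x \<le> 1 / 2" using i power_decreasing[of 1 i "1 / 2 :: real"] by auto
  have "- ?x - 2 * ?x\<^sup>2 \<le> ln (1 - ?x)" using x by (rule ln_one_minus_pos_lower_bound)
  moreover have "?x\<^sup>2 \<le> ?x * (1 / 2)" unfolding power2_eq_square using x by (intro mult_left_mono) auto
  ultimately show ?thesis using i unfolding stage_rate_def by simp
qed

text \<open>
  In stage \<open>i \<ge> 1\<close> a star is complete with probability at least \<open>(1 / 4) ^ (\<Delta> * i)\<close>, while there are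
  \<open>100 * \<Delta>\<^sup>2 * 16 ^ (\<Delta> * i)\<close> candidates.
\<close>
lemma stage_miss_power_le:
  assumes "1 \<le> \<Delta>"
  shows "(1 - (1 - exp (- stage_rate \<Delta> i)) ^ (2 * \<Delta>)) ^ cand_size \<Delta> i \<le> exp (- (100 * real \<Delta> ^ 2 * 4 ^ (\<Delta> * i)))"
    "0 \<le> 1 - (1 - exp (- stage_rate \<Delta> i)) ^ (2 * \<Delta>)"
proof -
  show nn: "0 \<le> 1 - (1 - exp (- stage_rate \<Delta> i)) ^ (2 * \<Delta>)"
    using stage_rate_nonneg[OF assms, of i] power_le_one[of "1 - exp (- stage_rate \<Delta> i)" "2 * \<Delta>"] by auto
  show "(1 - (1 - exp (- stage_rate \<Delta> i)) ^ (2 * \<Delta>)) ^ cand_size \<Delta> i \<le> exp (- (100 * real \<Delta> ^ 2 * 4 ^ (\<Delta> * i)))"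
  proof (cases "i = 0")
    case True
    have "1 / 8 \<le> exp (- 1 :: real)"
      using exp_le by (simp add: exp_minus field_simps)
    then have "1 - (1 - exp (- stage_rate \<Delta> i)) ^ (2 * \<Delta>) \<le> exp (- 1)"
      using long_stage_miss(1)[OF assms] True by (simp add: stage_rate_def)
    then have "(1 - (1 - exp (- stage_rate \<Delta> i)) ^ (2 * \<Delta>)) ^ cand_size \<Delta> i \<le> exp (- 1) ^ cand_size \<Delta> i"
      using nn by (intro power_mono)
    also have "\<dots> = exp (- (100 * real \<Delta> ^ 2 * 4 ^ (\<Delta> * i)))"
      using True by (simp add: exp_of_nat_mult[symmetric] cand_size_def)
    finally show ?thesis .
  next
    case False
    have lt: "(1 / 2 :: real) ^ i < 1" using False by (simp add: power_less_one_iff)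
    have e: "1 - exp (- stage_rate \<Delta> i) = (1 / 2) ^ i"
      using False lt by (simp add: stage_rate_def)
    have p: "((1 / 2 :: real) ^ i) ^ (2 * \<Delta>) = (1 / 4) ^ (\<Delta> * i)"
      by (simp add: power_mult[symmetric] mult.commute[of i] mult.assoc power_mult[of "1 / 2 :: real" 2] power2_eq_square)
    have "1 - (1 - exp (- stage_rate \<Delta> i)) ^ (2 * \<Delta>) \<le> exp (- ((1 / 4) ^ (\<Delta> * i)))"
      unfolding e p using exp_ge_add_one_self[of "- ((1 / 4 :: real) ^ (\<Delta> * i))"] by simp
    then have "(1 - (1 - exp (- stage_rate \<Delta> i)) ^ (2 * \<Delta>)) ^ cand_size \<Delta> i \<le> exp (- ((1 / 4) ^ (\<Delta> * i))) ^ cand_size \<Delta> i"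
      using nn by (intro power_mono)
    also have "\<dots> = exp (- (real (cand_size \<Delta> i) * (1 / 4) ^ (\<Delta> * i)))"
      by (simp add: exp_of_nat_mult[symmetric])
    also have "real (cand_size \<Delta> i) * (1 / 4) ^ (\<Delta> * i) = 100 * real \<Delta> ^ 2 * 4 ^ (\<Delta> * i)"
      by (simp add: cand_size_def power_mult_distrib[symmetric] mult.assoc)
    finally show ?thesis .
  qed
qed

lemma stage_vertex_fail:
  assumes "1 \<le> \<Delta>"
  shows "8 * 256 ^ \<Delta> * (real (cand_size \<Delta> i + 1) ^ \<Delta> * (1 - (1 - exp (- stage_rate \<Delta> i)) ^ (2 * \<Delta>)) ^ cand_size \<Delta> i) \<le> 1"
proof -
  let ?X = "5 * real \<Delta> + 2 * real \<Delta> ^ 2 + 3 * real \<Delta> ^ 2 * i"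
  have e: "(27 / 10 :: real) \<le> exp 1" using e_approx_32 by (simp add: abs_if split: if_splits)
  have "(8 :: real) \<le> (27 / 10) ^ 3" "(256 :: real) \<le> (27 / 10) ^ 6" by (simp_all add: power_numeral_reduce)
  then have c: "(8 :: real) \<le> exp 3" "(256 :: real) \<le> exp 6"
    using power_mono[OF e, of 3] power_mono[OF e, of 6] by (simp_all add: exp_of_nat_mult[symmetric])
  have "8 * 256 ^ \<Delta> * (real (cand_size \<Delta> i + 1) ^ \<Delta> * (1 - (1 - exp (- stage_rate \<Delta> i)) ^ (2 * \<Delta>)) ^ cand_size \<Delta> i)
     \<le> exp 3 * exp 6 ^ \<Delta> * (exp ?X * exp (- (100 * real \<Delta> ^ 2 * 4 ^ (\<Delta> * i))))"
    using c cand_size_power_le[OF assms] stage_miss_power_le[OF assms]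
    by (intro mult_mono power_mono mult_nonneg_nonneg zero_le_power) auto
  also have "\<dots> = exp (3 + 6 * real \<Delta> + ?X - 100 * real \<Delta> ^ 2 * 4 ^ (\<Delta> * i))"
    by (simp add: exp_of_nat_mult[symmetric] exp_add[symmetric] mult_ac)
  also have "\<dots> \<le> exp 0"
    using exponent_le[OF assms, of i] cand_size_ge(3)[OF assms, of i] by (intro exp_mono) linarith
  finally show ?thesis by simp
qed

lemma last_stage_vertex_fail:
  assumes "1 \<le> \<Delta>"
  shows "real (cand_size \<Delta> i + 1) ^ \<Delta> * (1 - (1 - exp (- ln (16 * real \<Delta>))) ^ (2 * \<Delta>)) ^ cand_size \<Delta> i \<le> exp (- real (cand_size \<Delta> i))"
proof -
  let ?X = "5 * real \<Delta> + 2 * real \<Delta> ^ 2 + 3 * real \<Delta> ^ 2 * i"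
  have "exp (2 :: real) \<le> 8"
  proof -
    have "exp (1::real) \<le> 14 / 5" using e_approx_32 by (simp add: abs_if split: if_splits)
    then have "exp (1::real) ^ 2 \<le> (14 / 5) ^ 2" by (intro power_mono) auto
    also have "\<dots> \<le> (8::real)" by (simp add: power2_eq_square)
    finally show ?thesis by (simp add: exp_of_nat_mult[symmetric])
  qed
  then have "1 / 8 \<le> exp (- 2 :: real)"
    by (simp add: exp_minus field_simps)
  then have "1 - (1 - exp (- ln (16 * real \<Delta>))) ^ (2 * \<Delta>) \<le> exp (- 2)"
    using long_stage_miss(1)[OF assms] by linarith
  then have "real (cand_size \<Delta> i + 1) ^ \<Delta> * (1 - (1 - exp (- ln (16 * real \<Delta>))) ^ (2 * \<Delta>)) ^ cand_size \<Delta> i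
      \<le> exp ?X * exp (- 2) ^ cand_size \<Delta> i"
    using cand_size_power_le[OF assms] long_stage_miss(3)[OF assms]
    by (intro mult_mono power_mono zero_le_power) auto
  also have "\<dots> = exp (?X - 2 * real (cand_size \<Delta> i))"
    by (simp add: exp_of_nat_mult[symmetric] exp_add[symmetric] mult_ac)
  also have "\<dots> \<le> exp (- real (cand_size \<Delta> i))"
    using exponent_le[OF assms, of i] cand_size_ge(1)[OF assms, of i] by (intro exp_mono) linarith
  finally show ?thesis .
qed

lemma defect_pos: "1 \<le> \<Delta> \<Longrightarrow> 0 < defect \<Delta> i"
  using cand_size_pos[of \<Delta> i] unfolding defect_def by simp

lemma defect_ratio:
  assumes "1 \<le> \<Delta>"
  shows "defect \<Delta> i \<le> 256 ^ \<Delta> * defect \<Delta> (Suc i)"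
proof -
  let ?K = "real (cand_size \<Delta> i)" and ?K' = "real (cand_size \<Delta> (Suc i))"
  have K': "?K' = 16 ^ \<Delta> * ?K"
    by (simp add: cand_size_def power_add)
  have K: "?K \<ge> 100" using cand_size_pos[OF assms, of i] by simp
  have one: "1 \<le> (16 :: real) ^ \<Delta>" by simp
  have "?K' * (?K' + 2) \<le> (16 ^ \<Delta> * ?K) * (16 ^ \<Delta> * (?K + 2))"
    unfolding K' using K one by (intro mult_left_mono) (auto simp: distrib_left)
  also have "\<dots> = 256 ^ \<Delta> * (?K * (?K + 2))"
    by (simp add: power_mult_distrib[symmetric] mult_ac)
  finally have le: "?K' * (?K' + 2) \<le> 256 ^ \<Delta> * (?K * (?K + 2))" .
  have pos: "0 < ?K * (?K + 2)" "0 < ?K' * (?K' + 2)"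
    using K cand_size_pos[OF assms, of "Suc i"] by (auto intro!: mult_pos_pos)
  have "1 / (?K * (?K + 2)) \<le> 256 ^ \<Delta> * (1 / (?K' * (?K' + 2)))"
    using le pos by (simp add: divide_le_eq le_divide_eq mult_ac)
  then have "1 / (8 * real \<Delta>) * (1 / (?K * (?K + 2))) \<le> 1 / (8 * real \<Delta>) * (256 ^ \<Delta> * (1 / (?K' * (?K' + 2))))"
    by (intro mult_left_mono) auto
  then show ?thesis
    unfolding defect_def by (simp add: mult_ac)
qed

lemma defect_nat_bounds:
  assumes "1 \<le> \<Delta>"
  shows "real (defect_nat n \<Delta> i) \<le> defect \<Delta> i * n" "defect \<Delta> i * n \<le> real (defect_nat n \<Delta> i + 1)"
    "8 * (defect_nat n \<Delta> i * (cand_size \<Delta> i * (\<Delta> * (cand_size \<Delta> i + 2)))) \<le> n"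
proof -
  have nn: "0 \<le> defect \<Delta> i * n" using defect_pos[OF assms, of i] by simp
  then show a: "real (defect_nat n \<Delta> i) \<le> defect \<Delta> i * n"
    unfolding defect_nat_def by (simp add: of_nat_nat)
  show "defect \<Delta> i * n \<le> real (defect_nat n \<Delta> i + 1)"
    unfolding defect_nat_def using nn by (simp add: of_nat_nat) linarith
  define W where "W = 8 * real \<Delta> * real (cand_size \<Delta> i) * (real (cand_size \<Delta> i) + 2)"
  have W: "0 < W"
    unfolding W_def using cand_size_pos[OF assms, of i] assms by (intro mult_pos_pos) auto
  have "real (defect_nat n \<Delta> i) * W \<le> defect \<Delta> i * n * W"
    using a W by (intro mult_right_mono) auto
  also have "\<dots> = n"
    using W unfolding defect_def W_def[symmetric] by simp
  finally have "real (8 * (defect_nat n \<Delta> i * (cand_size \<Delta> i * (\<Delta> * (cand_size \<Delta> i + 2))))) \<le> real n"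
    by (simp add: W_def algebra_simps)
  then show "8 * (defect_nat n \<Delta> i * (cand_size \<Delta> i * (\<Delta> * (cand_size \<Delta> i + 2)))) \<le> n"
    by (simp only: of_nat_le_iff)
qed

text \<open>
  The factor \<open>256 ^ \<Delta>\<close> between consecutive values of \<open>defect\<close> is compensated by \<open>stage_vertex_fail\<close>, with
  enough room for a geometric bound on the probability that too many vertices stay defective.
\<close>
lemma short_stage:
  assumes n: "n \<ge> 6" and D: "D \<subseteq> Kn n" and deg: "\<And>v. card {e \<in> D. v \<in> e} \<le> \<Delta>" and \<Delta>: "1 \<le> \<Delta>"
    and E: "E \<in> near_copy n D (defect_nat n \<Delta> i)" and t: "2 * stage_rate \<Delta> i * n \<le> t"
  shows "fail n (near_copy n D (defect_nat n \<Delta> (Suc i))) t E \<le> 2 * (1 / 2) ^ (defect_nat n \<Delta> (Suc i) + 1)"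
proof -
  define k where "k = defect_nat n \<Delta> (Suc i) + 1"
  define m where "m = defect_nat n \<Delta> i"
  define \<phi> where "\<phi> = real (cand_size \<Delta> i + 1) ^ \<Delta> * (1 - (1 - exp (- stage_rate \<Delta> i)) ^ (2 * \<Delta>)) ^ cand_size \<Delta> i"
  have \<phi>0: "0 \<le> \<phi>"
    unfolding \<phi>_def using stage_miss_power_le(2)[OF \<Delta>, of i] by (intro mult_nonneg_nonneg zero_le_power) auto
  have k: "1 \<le> k" by (simp add: k_def)
  have "fail n (near_copy n D (k - 1)) t E \<le> 2 * (real (m choose k) * \<phi> ^ k)"
    unfolding \<phi>_def m_def
    using n D deg \<Delta> cand_size_ge(2)[OF \<Delta>] defect_nat_bounds(3)[OF \<Delta>] stage_rate_nonneg[OF \<Delta>] t k E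
    by (intro stage) auto
  also have "real (m choose k) * \<phi> ^ k \<le> (1 / 2) ^ k"
  proof (rule choose_mult_power_le[OF k \<phi>0])
    have "real m \<le> defect \<Delta> i * n" unfolding m_def by (rule defect_nat_bounds[OF \<Delta>])
    also have "\<dots> \<le> (256 ^ \<Delta> * defect \<Delta> (Suc i)) * n"
      using defect_ratio[OF \<Delta>] by (intro mult_right_mono) auto
    also have "\<dots> = 256 ^ \<Delta> * (defect \<Delta> (Suc i) * n)" by simp
    also have "\<dots> \<le> 256 ^ \<Delta> * real k"
      unfolding k_def using defect_nat_bounds(2)[OF \<Delta>] by (intro mult_left_mono) auto
    finally have r: "real m / k \<le> 256 ^ \<Delta>" using k by (simp add: divide_le_eq)
    have "exp 1 * (real m / k) * \<phi> \<le> 4 * 256 ^ \<Delta> * \<phi>"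
      using r \<phi>0 exp_le by (intro mult_mono) auto
    also have "\<dots> \<le> 1 / 2"
      using stage_vertex_fail[OF \<Delta>, of i] unfolding \<phi>_def by simp
    finally show "exp 1 * (real m / k) * \<phi> \<le> 1 / 2" .
  qed
  finally show ?thesis by (simp add: k_def)
qed

lemma last_stage:
  assumes n: "n \<ge> 6" and D: "D \<subseteq> Kn n" and deg: "\<And>v. card {e \<in> D. v \<in> e} \<le> \<Delta>" and \<Delta>: "1 \<le> \<Delta>"
    and E: "E \<in> near_copy n D (defect_nat n \<Delta> i)" and t: "2 * ln (16 * real \<Delta>) * n \<le> t"
  shows "fail n (near_copy n D 0) t E \<le> 2 * (n * exp (- real (cand_size \<Delta> i)))"
proof -
  let ?\<phi> = "real (cand_size \<Delta> i + 1) ^ \<Delta> * (1 - (1 - exp (- ln (16 * real \<Delta>))) ^ (2 * \<Delta>)) ^ cand_size \<Delta> i"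
  have "fail n (near_copy n D (1 - 1)) t E \<le> 2 * (real (defect_nat n \<Delta> i choose 1) * ?\<phi> ^ 1)"
    using n D deg \<Delta> cand_size_ge(2)[OF \<Delta>] defect_nat_bounds(3)[OF \<Delta>] long_stage_miss(2)[OF \<Delta>] t E
    by (intro stage) auto
  also have "\<dots> \<le> 2 * (n * exp (- real (cand_size \<Delta> i)))"
  proof -
    have "8 * (defect_nat n \<Delta> i * 1) \<le> 8 * (defect_nat n \<Delta> i * (cand_size \<Delta> i * (\<Delta> * (cand_size \<Delta> i + 2))))"
      using \<Delta> cand_size_pos[OF \<Delta>, of i] by (intro mult_le_mono) auto
    also have "\<dots> \<le> n" by (rule defect_nat_bounds(3)[OF \<Delta>])
    finally have "real (defect_nat n \<Delta> i) \<le> n" by simp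
    moreover have "0 \<le> ?\<phi>"
      using long_stage_miss(3)[OF \<Delta>] by (intro mult_nonneg_nonneg zero_le_power) auto
    ultimately show ?thesis
      using last_stage_vertex_fail[OF \<Delta>, of i] by (intro mult_left_mono) (auto intro!: mult_mono)
  qed
  finally show ?thesis by simp
qed

text \<open>
  The \<open>R\<close> stages of decreasing length, followed by a stage after which no vertex is defective.
\<close>
lemma stage_chain:
  assumes n: "n \<ge> 6" and D: "D \<subseteq> Kn n" and deg: "\<And>v. card {e \<in> D. v \<in> e} \<le> \<Delta>" and \<Delta>: "1 \<le> \<Delta>"
    and t: "\<And>i. 2 * stage_rate \<Delta> i * n \<le> t i" "2 * ln (16 * real \<Delta>) * n \<le> t'"
    and \<delta>: "\<And>i. i < R \<Longrightarrow> 2 * (1 / 2) ^ (defect_nat n \<Delta> (Suc i) + 1) \<le> \<delta>"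
    and E: "E \<in> near_copy n D (defect_nat n \<Delta> 0)"
  shows "fail n (near_copy n D 0) ((\<Sum>i<R. t i) + t') E \<le> R * \<delta> + 2 * (n * exp (- real (cand_size \<Delta> R)))"
proof -
  have "fail n (near_copy n D (defect_nat n \<Delta> r)) (\<Sum>i<r. t i) E \<le> r * \<delta>" if "r \<le> R" for r
    using that
  proof (induction r)
    case 0
    then show ?case using E by simp
  next
    case (Suc r)
    have d0: "0 \<le> \<delta>" using \<delta>[of r] Suc.prems by (meson Suc_le_lessD less_eq_real_def order_trans zero_le_divide_1_iff zero_le_mult_iff zero_le_numeral zero_le_power)
    have "fail n (near_copy n D (defect_nat n \<Delta> (Suc r))) ((\<Sum>i<r. t i) + t r) E
       \<le> fail n (near_copy n D (defect_nat n \<Delta> r)) (\<Sum>i<r. t i) E + \<delta>"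
    proof (rule fail_compose)
      fix E' assume "E' \<in> near_copy n D (defect_nat n \<Delta> r)"
      then have "fail n (near_copy n D (defect_nat n \<Delta> (Suc r))) (t r) E' \<le> 2 * (1 / 2) ^ (defect_nat n \<Delta> (Suc r) + 1)"
        using n D deg \<Delta> t by (intro short_stage) auto
      then show "fail n (near_copy n D (defect_nat n \<Delta> (Suc r))) (t r) E' \<le> \<delta>"
        using \<delta>[of r] Suc.prems by linarith
    qed (rule d0)
    then show ?case using Suc by (simp add: algebra_simps)
  qed
  then have a: "fail n (near_copy n D (defect_nat n \<Delta> R)) (\<Sum>i<R. t i) E \<le> R * \<delta>" by simp
  have "fail n (near_copy n D 0) ((\<Sum>i<R. t i) + t') E \<le>
      fail n (near_copy n D (defect_nat n \<Delta> R)) (\<Sum>i<R. t i) E + 2 * (n * exp (- real (cand_size \<Delta> R)))"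
    using n D deg \<Delta> t(2) by (intro fail_compose last_stage) auto
  then show ?thesis using a by linarith
qed

lemma cand_size_mono: "i \<le> j \<Longrightarrow> cand_size \<Delta> i \<le> cand_size \<Delta> j"
  unfolding cand_size_def by (intro mult_le_mono2 power_increasing) auto

lemma defect_antimono:
  assumes "1 \<le> \<Delta>" "i \<le> j"
  shows "defect \<Delta> j \<le> defect \<Delta> i"
proof -
  let ?W = "\<lambda>i. 8 * real \<Delta> * real (cand_size \<Delta> i) * (real (cand_size \<Delta> i) + 2)"
  have "0 < ?W i" using cand_size_pos[OF assms(1), of i] assms(1) by (intro mult_pos_pos) auto
  moreover have "?W i \<le> ?W j" using cand_size_mono[OF assms(2)] by (intro mult_mono) auto
  ultimately show ?thesis
    unfolding defect_def by (rule frac_le[OF zero_le_one order_refl])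
qed

text \<open>
  After a stage with fewer than \<open>l\<close> candidates the bound on the number of defective vertices is still
  large.  For \<open>l = 2 * ln n\<close> this makes
  the failure probability \<open>2 * (1 / 2) ^ k\<close> of a stage negligible.  The hypothesis forces
  \<open>10 * \<Delta> \<le> sqrt l\<close>, hence \<open>256 ^ \<Delta>\<close> is subpolynomial in \<open>n\<close>.
\<close>
lemma defect_lower_bound:
  fixes l :: real
  assumes "1 \<le> \<Delta>" "cand_size \<Delta> i < l" "1 \<le> l"
  shows "1 \<le> defect \<Delta> (Suc i) * (24 * l\<^sup>2 * exp (sqrt l))"
proof -
  let ?K = "real (cand_size \<Delta> (Suc i))"
  have e: "(27 / 10 :: real) \<le> exp 1" using e_approx_32 by (simp add: abs_if split: if_splits)
  have "(256 :: real) \<le> (27 / 10) ^ 6" by (simp add: power_numeral_reduce)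
  then have c: "(256 :: real) \<le> exp 6"
    using power_mono[OF e, of 6] by (simp add: exp_of_nat_mult[symmetric])
  have d: "real \<Delta> \<le> exp \<Delta>" using exp_ge_add_one_self[of "real \<Delta>"] by linarith
  have "100 * real \<Delta> ^ 2 * (1 + real i) \<le> l"
    using cand_size_ge(1)[OF assms(1), of i] assms(2) by linarith
  moreover have "100 * real \<Delta> ^ 2 * 1 \<le> 100 * real \<Delta> ^ 2 * (1 + real i)"
    by (intro mult_left_mono) auto
  ultimately have "(10 * real \<Delta>)\<^sup>2 \<le> l" by (simp add: power_mult_distrib)
  then have s: "10 * real \<Delta> \<le> sqrt l" by (rule real_le_rsqrt)
  have "?K = 16 ^ \<Delta> * real (cand_size \<Delta> i)"
    by (simp add: cand_size_def power_add)
  then have K: "?K \<le> 16 ^ \<Delta> * l" "100 \<le> ?K"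
    using assms(2) cand_size_pos[OF assms(1), of "Suc i"] by simp_all
  have "8 * real \<Delta> * ?K * (?K + 2) \<le> 8 * real \<Delta> * ?K * (3 * ?K)"
    using K by (intro mult_left_mono) auto
  also have "\<dots> = 24 * real \<Delta> * ?K ^ 2" by (simp add: power2_eq_square)
  also have "\<dots> \<le> 24 * real \<Delta> * (16 ^ \<Delta> * l) ^ 2"
    using K by (intro mult_left_mono power_mono) auto
  also have "\<dots> = 24 * l\<^sup>2 * (real \<Delta> * 256 ^ \<Delta>)"
    by (simp add: power_mult_distrib power_mult[symmetric] mult.commute[of \<Delta>] power_mult[of "16 :: real" 2])
  also have "\<dots> \<le> 24 * l\<^sup>2 * (exp \<Delta> * exp 6 ^ \<Delta>)"
    using c d by (intro mult_left_mono mult_mono power_mono) auto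
  also have "exp \<Delta> * exp 6 ^ \<Delta> = exp (7 * real \<Delta>)"
    by (simp add: exp_of_nat_mult[symmetric] exp_add[symmetric])
  also have "24 * l\<^sup>2 * exp (7 * real \<Delta>) \<le> 24 * l\<^sup>2 * exp (sqrt l)"
    using s by (intro mult_left_mono exp_mono) auto
  finally have le: "8 * real \<Delta> * ?K * (?K + 2) \<le> 24 * l\<^sup>2 * exp (sqrt l)" .
  have "0 < 8 * real \<Delta> * ?K * (?K + 2)" using assms(1) K by (intro mult_pos_pos) auto
  then show ?thesis using le unfolding defect_def by simp
qed

lemma defect_0_lower_bound:
  assumes "1 \<le> \<Delta>"
  shows "1 \<le> defect \<Delta> 0 * (81600 * real \<Delta> ^ 5)"
proof -
  have q: "1 \<le> real \<Delta> ^ 2" using assms one_le_power[of "real \<Delta>" 2] by simp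
  have "8 * real \<Delta> * real (cand_size \<Delta> 0) * (real (cand_size \<Delta> 0) + 2) = 8 * real \<Delta> * (100 * real \<Delta> ^ 2) * (100 * real \<Delta> ^ 2 + 2)"
    by (simp add: cand_size_def)
  also have "\<dots> \<le> 8 * real \<Delta> * (100 * real \<Delta> ^ 2) * (102 * real \<Delta> ^ 2)"
    using q by (intro mult_left_mono) auto
  also have "\<dots> = 81600 * real \<Delta> ^ 5"
    by (simp add: power_numeral_reduce)
  finally have le: "8 * real \<Delta> * real (cand_size \<Delta> 0) * (real (cand_size \<Delta> 0) + 2) \<le> 81600 * real \<Delta> ^ 5" .
  have "0 < 8 * real \<Delta> * real (cand_size \<Delta> 0) * (real (cand_size \<Delta> 0) + 2)"
    using assms cand_size_pos[OF assms, of 0] by (intro mult_pos_pos) auto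
  then show ?thesis using le unfolding defect_def by simp
qed

text \<open>
  Waiting \<open>2 * \<tau> * n\<close> rounds leaves each edge missing with probability \<open>exp (- \<tau>)\<close>, where \<open>\<tau>\<close> exceeds
  \<open>ln (1 / defect \<Delta> 0)\<close> by \<open>2 * y\<^sup>2 + 1\<close>, that is, by \<open>2 * sqrt \<Delta> + 1\<close>.  If \<open>\<Delta>\<close> is at most of the order of
  \<open>(ln n)\<^sup>2\<close>, the probability bound is small because \<open>k\<close> is large; for larger \<open>\<Delta>\<close> it is small because \<open>\<tau>\<close> is
  large, even for \<open>k = 1\<close>.
\<close>
lemma identity_completion:
  fixes y :: real
  assumes n: "n \<ge> 6" and D: "D \<subseteq> Kn n" and \<Delta>: "1 \<le> \<Delta>" and y: "1 \<le> y" "y ^ 4 = \<Delta>"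
    and E: "card (D - E) < n div 8 + 1"
    and big: "ln n * (81600 * ln n ^ 10) \<le> n"
    and t: "2 * (2 * y\<^sup>2 + 1 + ln (1 / defect \<Delta> 0)) * n \<le> t"
  shows "fail n (near_copy n D (defect_nat n \<Delta> 0)) t E \<le> 2 / n"
proof -
  define k where "k = defect_nat n \<Delta> 0 + 1"
  define \<tau> where "\<tau> = 2 * y\<^sup>2 + 1 + ln (1 / defect \<Delta> 0)"
  have \<theta>: "0 < defect \<Delta> 0" using defect_pos[OF \<Delta>] .
  have "8 * 1 * 1 * 1 \<le> 8 * real \<Delta> * real (cand_size \<Delta> 0) * (real (cand_size \<Delta> 0) + 2)"
    using \<Delta> cand_size_pos[OF \<Delta>, of 0] by (intro mult_mono) auto
  then have "1 \<le> 1 / defect \<Delta> 0" by (simp add: defect_def)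
  then have \<tau>: "0 \<le> \<tau>" unfolding \<tau>_def by simp
  have k: "1 \<le> k" by (simp add: k_def)
  have kn: "defect \<Delta> 0 * n \<le> k" unfolding k_def by (rule defect_nat_bounds(2)[OF \<Delta>])
  have M: "8 * card (D - E) \<le> n" using E by linarith
  have "fail n (near_copy n D (k - 1)) t E \<le> 2 * (real (card (D - E) choose k) * exp (- \<tau>) ^ k)"
    using n D M \<tau> t k unfolding \<tau>_def by (intro identity_stage) auto
  also have "real (card (D - E) choose k) * exp (- \<tau>) ^ k \<le> exp (- (2 * y\<^sup>2 + 1)) ^ k"
  proof (rule choose_mult_power_le[OF k])
    have "exp (- \<tau>) = exp (- (2 * y\<^sup>2 + 1)) * defect \<Delta> 0"
      using \<theta> by (simp add: \<tau>_def ln_div exp_add exp_diff exp_minus field_simps)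
    moreover have "real (card (D - E)) / k * defect \<Delta> 0 \<le> 1 / 8"
    proof -
      have "real (card (D - E)) * defect \<Delta> 0 \<le> n / 8 * defect \<Delta> 0"
        using M \<theta> by (intro mult_right_mono) auto
      also have "\<dots> \<le> k / 8" using kn by (simp add: mult.commute)
      finally show ?thesis using k by (simp add: field_simps)
    qed
    then have "exp 1 * (real (card (D - E)) / k * defect \<Delta> 0) \<le> 8 * (1 / 8)"
      using exp_le \<theta> by (intro mult_mono) auto
    then have "exp (- (2 * y\<^sup>2 + 1)) * (exp 1 * (real (card (D - E)) / k * defect \<Delta> 0)) \<le> exp (- (2 * y\<^sup>2 + 1)) * 1"
      by (intro mult_left_mono) auto
    ultimately show "exp 1 * (real (card (D - E)) / k) * exp (- \<tau>) \<le> exp (- (2 * y\<^sup>2 + 1))"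
      by (simp only: mult_ac mult_1_right)
  qed simp
  also have "exp (- (2 * y\<^sup>2 + 1)) ^ k = exp (- ((2 * y\<^sup>2 + 1) * k))"
    by (simp add: exp_of_nat_mult[symmetric] algebra_simps)
  also have "\<dots> \<le> exp (- ln n)"
  proof -
    have "ln n \<le> (2 * y\<^sup>2 + 1) * k"
    proof (cases "ln n \<le> 2 * y\<^sup>2")
      case True
      then have "ln n \<le> (2 * y\<^sup>2 + 1) * 1" by simp
      also have "\<dots> \<le> (2 * y\<^sup>2 + 1) * k" using k by (intro mult_left_mono) auto
      finally show ?thesis .
    next
      case False
      have "y\<^sup>2 \<le> ln n" using False zero_le_power2[of y] by linarith
      then have "(y\<^sup>2) ^ 10 \<le> ln n ^ 10" by (intro power_mono) auto
      moreover have "(y\<^sup>2) ^ 10 = real \<Delta> ^ 5" unfolding y(2)[symmetric] by (simp add: power_mult[symmetric])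
      ultimately have d: "real \<Delta> ^ 5 \<le> ln n ^ 10" by simp
      have "ln n * 1 \<le> ln n * (defect \<Delta> 0 * (81600 * real \<Delta> ^ 5))"
        using defect_0_lower_bound[OF \<Delta>] n by (intro mult_left_mono) auto
      also have "\<dots> \<le> ln n * (defect \<Delta> 0 * (81600 * ln n ^ 10))"
        using d \<theta> n by (intro mult_left_mono) auto
      also have "\<dots> = defect \<Delta> 0 * (ln n * (81600 * ln n ^ 10))" by simp
      also have "\<dots> \<le> defect \<Delta> 0 * n" using big \<theta> by (intro mult_left_mono) auto
      also have "\<dots> \<le> 1 * real k" using kn by simp
      also have "\<dots> \<le> (2 * y\<^sup>2 + 1) * k" by (intro mult_right_mono) auto
      finally show ?thesis by simp
    qed
    then show ?thesis by simp
  qed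
  also have "\<dots> = 1 / n" using n by (simp add: exp_minus inverse_eq_divide)
  finally show ?thesis by (simp add: k_def)
qed

section \<open>From near-copies to copies\<close>

text \<open>
  Without defective vertices the permutation in \<open>near_copy\<close> is an embedding of the whole graph.
\<close>
lemma contains_copy_if_near_copy:
  assumes H: "simple_graph H" and g: "bij_betw g (verts H) {1..n}"
    and E: "E \<in> near_copy n ((`) g ` edges H) 0"
  shows "contains_copy ({1..n}, E) H"
proof -
  define D where "D = (`) g ` edges H"
  have "E \<in> near_copy n D 0" using E by (simp only: D_def)
  then obtain \<pi> U where \<pi>: "\<pi> permutes {1..n}" and U: "U \<subseteq> {1..n}" "card U \<le> 0"
    and emb: "\<And>e. e \<in> D \<Longrightarrow> \<pi> ` e \<inter> U = {} \<Longrightarrow> \<pi> ` e \<in> E"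
    unfolding near_copy_def by blast
  have "U = {}" using U finite_subset[OF U(1)] by auto
  define \<phi> where "\<phi> = \<pi> \<circ> g"
  have \<phi>: "bij_betw \<phi> (verts H) {1..n}"
    unfolding \<phi>_def using g permutes_imp_bij[OF \<pi>] by (rule bij_betw_trans)
  have inj: "inj_on \<phi> (verts H)" using \<phi> by (rule bij_betw_imp_inj_on)
  have eH: "e \<subseteq> verts H" "card e = 2" if "e \<in> edges H" for e
    using H that by (auto simp: simple_graph_def)
  define K where "K = ({1..n}, (`) \<phi> ` edges H)"
  have "subgraph K ({1..n}, E)"
    unfolding subgraph_def simple_graph_def
  proof (intro conjI ballI)
    fix e assume "e \<in> edges K"
    then obtain e' where e': "e' \<in> edges H" "e = \<phi> ` e'" by (auto simp: K_def)
    show "e \<subseteq> verts K"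
      using e' eH(1)[OF e'(1)] bij_betw_imp_surj_on[OF \<phi>] by (auto simp: K_def)
    show "card e = 2"
      using e' eH[OF e'(1)] card_image[OF inj_on_subset[OF inj]] by simp
  next
    show "edges K \<subseteq> edges ({1..n}, E)"
    proof
      fix e assume "e \<in> edges K"
      then obtain e' where e': "e' \<in> edges H" "e = \<phi> ` e'" by (auto simp: K_def)
      then have "\<pi> ` g ` e' \<in> E" using emb[of "g ` e'"] \<open>U = {}\<close> by (simp add: D_def)
      then show "e \<in> edges ({1..n}, E)" using e'(2) by (simp add: \<phi>_def image_comp)
    qed
  qed (auto simp: K_def)
  moreover have "isomorphic_graphs H K"
    unfolding isomorphic_graphs_def
  proof (intro exI[of _ \<phi>] conjI ballI)
    show "bij_betw \<phi> (verts H) (verts K)" using \<phi> by (simp add: K_def)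
    fix u v assume uv: "u \<in> verts H" "v \<in> verts H"
    show "{u, v} \<in> edges H \<longleftrightarrow> {\<phi> u, \<phi> v} \<in> edges K"
    proof
      assume "{u, v} \<in> edges H"
      then have "\<phi> ` {u, v} \<in> (`) \<phi> ` edges H" by (rule imageI)
      then show "{\<phi> u, \<phi> v} \<in> edges K" by (simp add: K_def)
    next
      assume "{\<phi> u, \<phi> v} \<in> edges K"
      then have "{\<phi> u, \<phi> v} \<in> (`) \<phi> ` edges H" by (simp add: K_def)
      then obtain e where e: "{\<phi> u, \<phi> v} = \<phi> ` e" "e \<in> edges H" by (rule imageE)
      then have "\<phi> ` {u, v} = \<phi> ` e" by simp
      then have "{u, v} = e"
        using inj_on_image_eq_iff[OF inj _ eH(1)[OF e(2)], of "{u, v}"] uv by simp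
      then show "{u, v} \<in> edges H" using e(2) by simp
    qed
  qed
  ultimately show ?thesis unfolding contains_copy_def by blast
qed

section \<open>The total number of rounds\<close>

lemma nat_ceiling_bounds:
  assumes "0 \<le> x"
  shows "x \<le> real (nat \<lceil>x\<rceil>)" "real (nat \<lceil>x\<rceil>) \<le> x + 1"
  using assms by (auto simp: of_nat_nat)

lemma sum_half_powers_le: "(\<Sum>i<r. (1 / 2 :: real) ^ i) \<le> 2"
proof -
  have "(\<Sum>i<r. (1 / 2 :: real) ^ i) = 2 - 2 * (1 / 2) ^ r"
    by (induction r) (simp_all add: field_simps)
  then show ?thesis by simp
qed

text \<open>
  The phases in order: greedy building until \<open>128 * y\<^sup>2 * n\<close> and then \<open>n / 8\<close> edges are missing, waiting for
  the remaining edges, and the repair stages.  Each phase but the first costs at most a constant times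
  \<open>y ^ 3 * n\<close> rounds.
\<close>
lemma near_copy_reachable:
  fixes y :: real
  assumes n: "n \<ge> 8" and D: "D \<subseteq> Kn n" and deg: "\<And>v. card {e \<in> D. v \<in> e} \<le> \<Delta>" and \<Delta>: "1 \<le> \<Delta>"
    and y: "1 \<le> y" "y ^ 4 = \<Delta>"
    and big1: "4 * ln n * (24 * (2 * ln n)\<^sup>2 * exp (sqrt (2 * ln n))) \<le> n"
    and big2: "ln n * (81600 * ln n ^ 10) \<le> n"
  shows "\<exists>T. real T \<le> real \<Delta> * n / 2 + 5000 * y ^ 3 * n \<and>
     fail n (near_copy n D 0) T {} \<le> exp (1 - n / 4) + exp (- real n) + 6 / n"
proof -
  have ln1: "1 \<le> ln n"
    using n exp_le by (subst ln_ge_iff) auto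
  have lnn: "ln n \<le> n" using n ln_le_minus_one[of "real n"] by simp
  define P where "P = (\<lambda>R. 2 * ln n \<le> cand_size \<Delta> R)"
  \<comment> \<open>The first stage with at least \<open>2 * ln n\<close> candidates per vertex is replaced by the final one.\<close>
  define R where "R = (LEAST R. P R)"
  have Kge: "100 * (1 + real i) \<le> cand_size \<Delta> i" for i
  proof -
    have "100 * 1 * (1 + real i) \<le> 100 * real \<Delta> ^ 2 * (1 + real i)"
      using \<Delta> one_le_power[of "real \<Delta>" 2] by (intro mult_right_mono mult_left_mono) auto
    then show ?thesis using cand_size_ge(1)[OF \<Delta>, of i] by linarith
  qed
  have "2 * ln n \<le> 100 * (1 + real n)" using lnn by simp
  also have "\<dots> \<le> cand_size \<Delta> n" by (rule Kge)
  finally have "P n" unfolding P_def .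
  then have PR: "P R" unfolding R_def by (rule LeastI)
  have before: "cand_size \<Delta> i < 2 * ln n" if "i < R" for i
    using not_less_Least[of i P] that unfolding R_def P_def by linarith
  have Rn: "R \<le> n"
  proof (cases R)
    case (Suc r)
    have "100 * (1 + real r) \<le> cand_size \<Delta> r" by (rule Kge)
    also have "\<dots> < 2 * ln n" using before[of r] Suc by simp
    also have "\<dots> \<le> 2 * real n" using lnn by simp
    finally have h: "100 * (1 + real r) < 2 * real n" .
    have "real (Suc r) \<le> 50 * (1 + real r)" by simp
    also have "\<dots> < real n" using h by simp
    finally show ?thesis using Suc by simp
  qed simp
  define tA where "tA = nat \<lceil>(1 + 1 / y) * (real \<Delta> * n / 2)\<rceil>"
  define tB where "tB = nat \<lceil>4128 * y\<^sup>2 * n\<rceil>"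
  define tI where "tI = nat \<lceil>2 * (2 * y\<^sup>2 + 1 + ln (1 / defect \<Delta> 0)) * n\<rceil>"
  define t where "t = (\<lambda>i. nat \<lceil>2 * stage_rate \<Delta> i * n\<rceil>)"
  define t' where "t' = nat \<lceil>2 * ln (16 * real \<Delta>) * n\<rceil>"
  define k where "k = nat \<lceil>128 * y\<^sup>2 * n\<rceil>"
  have y0: "0 < y" using y by simp
  have y2: "y \<le> y\<^sup>2" "1 \<le> y\<^sup>2" "y\<^sup>2 \<le> y ^ 3" "1 \<le> y ^ 3" "y \<le> y ^ 3"
    using y power_increasing[of 1 2 y] power_increasing[of 2 3 y] power_increasing[of 1 3 y] one_le_power[of y] by simp_all
  have lny: "ln y \<le> y - 1" using y0 by (rule ln_le_minus_one)
  have ln2: "ln (2 :: real) \<le> 1" using ln_le_minus_one[of "2 :: real"] by simp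
  have ln\<Delta>: "ln (real \<Delta>) = 4 * ln y" unfolding y(2)[symmetric] using y0 by (simp add: ln_realpow)
  have ln16: "ln (16 * real \<Delta>) \<le> 4 * y"
  proof -
    have "ln (16 * real \<Delta>) = ln (2 ^ 4) + ln (real \<Delta>)" using \<Delta> by (simp add: ln_mult)
    also have "\<dots> = 4 * ln 2 + 4 * ln y" unfolding ln\<Delta> by (simp only: ln_realpow zero_less_numeral of_nat_numeral)
    finally show ?thesis using ln2 lny by linarith
  qed
  have \<theta>: "0 < defect \<Delta> 0" using defect_pos[OF \<Delta>] .
  have ln\<theta>: "ln (1 / defect \<Delta> 0) \<le> 20 * y"
  proof -
    have "1 / defect \<Delta> 0 \<le> 81600 * real \<Delta> ^ 5"
      using defect_0_lower_bound[OF \<Delta>] \<theta> by (simp add: divide_le_eq mult.commute)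
    also have "\<dots> \<le> 2 ^ 17 * real \<Delta> ^ 5" by (intro mult_right_mono) auto
    finally have "ln (1 / defect \<Delta> 0) \<le> ln (2 ^ 17 * real \<Delta> ^ 5)"
      using \<theta> by (intro ln_mono) auto
    also have "\<dots> = ln (2 ^ 17) + ln (real \<Delta> ^ 5)" using \<Delta> by (simp add: ln_mult)
    also have "\<dots> = 17 * ln 2 + 5 * ln (real \<Delta>)" using \<Delta> by (simp only: ln_realpow zero_less_numeral of_nat_numeral of_nat_0_less_iff less_eq_Suc_le One_nat_def)
    finally show ?thesis unfolding ln\<Delta> using ln2 lny by linarith
  qed
  have ln\<theta>0: "0 \<le> ln (1 / defect \<Delta> 0)"
  proof -
    have "8 * 1 * 1 * 1 \<le> 8 * real \<Delta> * real (cand_size \<Delta> 0) * (real (cand_size \<Delta> 0) + 2)"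
      using \<Delta> cand_size_pos[OF \<Delta>, of 0] by (intro mult_mono) auto
    then show ?thesis by (simp add: defect_def)
  qed
  note c = nat_ceiling_bounds
  have y\<Delta>: "real \<Delta> / y = y ^ 3" using y0 unfolding y(2)[symmetric] by (simp add: power_numeral_reduce)
  have tA: "(1 + 1 / y) * (real \<Delta> * n / 2) \<le> tA" "tA \<le> (1 + 1 / y) * (real \<Delta> * n / 2) + 1"
    unfolding tA_def using y0 by (intro c; simp)+
  have tB: "4128 * y\<^sup>2 * n \<le> tB" "tB \<le> 4128 * y\<^sup>2 * n + 1"
    unfolding tB_def by (intro c; simp)+
  have tI: "2 * (2 * y\<^sup>2 + 1 + ln (1 / defect \<Delta> 0)) * n \<le> tI" "tI \<le> 2 * (2 * y\<^sup>2 + 1 + ln (1 / defect \<Delta> 0)) * n + 1"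
    unfolding tI_def using ln\<theta>0 y2 by (intro c mult_nonneg_nonneg add_nonneg_nonneg; simp)+
  have t: "2 * stage_rate \<Delta> i * n \<le> t i" "t i \<le> 2 * stage_rate \<Delta> i * n + 1" for i
    unfolding t_def using stage_rate_nonneg[OF \<Delta>] by (intro c; simp)+
  have t': "2 * ln (16 * real \<Delta>) * n \<le> t'" "t' \<le> 2 * ln (16 * real \<Delta>) * n + 1"
    unfolding t'_def using long_stage_miss(2)[OF \<Delta>] by (intro c mult_nonneg_nonneg; simp)+
  have k: "128 * y\<^sup>2 * n \<le> k" "k \<le> 128 * y\<^sup>2 * n + 1"
    unfolding k_def by (intro c; simp)+
  have chain: "fail n (near_copy n D 0) ((\<Sum>i<R. t i) + t') E \<le> 4 / n"
    if E: "E \<in> near_copy n D (defect_nat n \<Delta> 0)" for E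
  proof -
    have "fail n (near_copy n D 0) ((\<Sum>i<R. t i) + t') E \<le> R * (2 / n ^ 2) + 2 * (n * exp (- real (cand_size \<Delta> R)))"
    proof (rule stage_chain[OF _ D deg \<Delta> _ _ _ E])
      fix i assume i: "i < R"
      then obtain r where r: "R = Suc r" "i \<le> r" by (cases R) auto
      define j where "j = defect_nat n \<Delta> (Suc i) + 1"
      have "4 * ln n * 1 \<le> 4 * ln n * (defect \<Delta> (Suc r) * (24 * (2 * ln n)\<^sup>2 * exp (sqrt (2 * ln n))))"
        using defect_lower_bound[OF \<Delta> before[of r]] r ln1 by (intro mult_left_mono) auto
      also have "\<dots> = defect \<Delta> (Suc r) * (4 * ln n * (24 * (2 * ln n)\<^sup>2 * exp (sqrt (2 * ln n))))" by simp
      also have "\<dots> \<le> defect \<Delta> (Suc r) * n"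
        using big1 defect_pos[OF \<Delta>, of "Suc r"] by (intro mult_left_mono) auto
      also have "\<dots> \<le> defect \<Delta> (Suc i) * n"
        using defect_antimono[OF \<Delta>, of "Suc i" "Suc r"] r by (intro mult_right_mono) auto
      also have "\<dots> \<le> j" unfolding j_def by (rule defect_nat_bounds(2)[OF \<Delta>])
      finally have j: "4 * ln n \<le> j" by simp
      have "(1 / 2) ^ j \<le> exp (- (1 / 2) :: real) ^ j"
        using exp_ge_add_one_self[of "- (1 / 2) :: real"] by (intro power_mono) auto
      also have "\<dots> = exp (- (j / 2))" by (simp add: exp_of_nat_mult[symmetric])
      also have "\<dots> \<le> exp (- (2 * ln n))" using j by (intro exp_mono) auto
      also have "\<dots> = 1 / n ^ 2"
        using n exp_of_nat_mult[of 2 "- ln (real n)"] by (simp add: exp_minus inverse_eq_divide power_one_over)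
      finally show "2 * (1 / 2) ^ (defect_nat n \<Delta> (Suc i) + 1) \<le> 2 / real (n ^ 2)"
        unfolding j_def by simp
    qed (use n t t' in auto)
    also have "\<dots> \<le> n * (2 / n ^ 2) + 2 * (n * exp (- (2 * ln n)))"
      using Rn PR unfolding P_def by (intro add_mono mult_right_mono mult_left_mono exp_mono) auto
    also have "exp (- (2 * ln n)) = 1 / n ^ 2"
      using n exp_of_nat_mult[of 2 "- ln (real n)"] by (simp add: exp_minus inverse_eq_divide power_one_over)
    also have "n * (2 / n ^ 2) + 2 * (n * (1 / n ^ 2)) = 4 / n"
      using n by (simp add: power2_eq_square field_simps)
    finally show ?thesis .
  qed
  define T where "T = tA + (tB + (tI + ((\<Sum>i<R. t i) + t')))"
  have I: "fail n (near_copy n D 0) (tI + ((\<Sum>i<R. t i) + t')) E \<le> 2 / n + 4 / n"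
    if "card (D - E) < n div 8 + 1" for E
  proof -
    have "fail n (near_copy n D 0) (tI + ((\<Sum>i<R. t i) + t')) E \<le> fail n (near_copy n D (defect_nat n \<Delta> 0)) tI E + 4 / n"
      using chain by (intro fail_compose) auto
    also have "fail n (near_copy n D (defect_nat n \<Delta> 0)) tI E \<le> 2 / n"
      using n D \<Delta> y that big2 tI by (intro identity_completion) auto
    finally show ?thesis by simp
  qed
  have B: "fail n (near_copy n D 0) (tB + (tI + ((\<Sum>i<R. t i) + t'))) E \<le> exp (- real n) + (2 / n + 4 / n)"
    if E: "card (D - E) < k" for E
  proof -
    have "real (card (D - E)) + 1 \<le> k" using E by linarith
    then have "card (D - E) \<le> 128 * y\<^sup>2 * n" using k(2) by linarith
    then have "fail n {E. card (D - E) < n div 8 + 1} tB E \<le> exp (- real n)"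
      using n D y tB by (intro greedy_middle) auto
    moreover have "fail n (near_copy n D 0) (tB + (tI + ((\<Sum>i<R. t i) + t'))) E \<le>
        fail n {E. card (D - E) < n div 8 + 1} tB E + (2 / n + 4 / n)"
      using I by (intro fail_compose) auto
    ultimately show ?thesis by linarith
  qed
  have "fail n (near_copy n D 0) T {} \<le> fail n {E. card (D - E) < k} tA {} + (exp (- real n) + (2 / n + 4 / n))"
    unfolding T_def using B by (intro fail_compose) auto
  moreover have "fail n {E. card (D - E) < k} tA {} \<le> exp (1 - n / 4)"
    using n D handshake_le[OF D deg] y tA k by (intro greedy_bulk) auto
  ultimately have f: "fail n (near_copy n D 0) T {} \<le> exp (1 - n / 4) + exp (- real n) + 6 / n"
    by (simp add: add_divide_distrib[symmetric])
  have sum_t: "real (\<Sum>i<R. t i) \<le> 8 * y * real n + 9 * real n"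
  proof -
    have "real (t i) \<le> (if i = 0 then 8 * y * real n else 0) + (4 * real n * (1 / 2) ^ i + 1)" for i
    proof (cases "i = 0")
      case True
      have "2 * stage_rate \<Delta> i * n \<le> 2 * (4 * y) * n"
        using ln16 True by (intro mult_right_mono mult_left_mono) (auto simp: stage_rate_def)
      then have "real (t i) \<le> 8 * y * real n + 1" using t(2)[of i] by linarith
      then have "real (t i) \<le> 8 * y * real n + (4 * real n * (1 / 2) ^ i + 1)"
        by (rule order_trans) simp
      then show ?thesis using True by simp
    next
      case False
      then have "2 * stage_rate \<Delta> i * n \<le> 2 * (2 * (1 / 2) ^ i) * n"
        using stage_rate_le[of i \<Delta>] by (intro mult_right_mono mult_left_mono) auto
      then show ?thesis using t(2)[of i] False by (simp add: mult_ac)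
    qed
    then have "(\<Sum>i<R. real (t i)) \<le> (\<Sum>i<R. (if i = 0 then 8 * y * real n else 0) + (4 * real n * (1 / 2) ^ i + 1))"
      by (rule sum_mono)
    also have "\<dots> = (\<Sum>i<R. if i = 0 then 8 * y * real n else 0) + (4 * real n * (\<Sum>i<R. (1 / 2) ^ i) + R)"
      by (simp only: sum.distrib sum_distrib_left) simp
    also have "\<dots> \<le> 8 * y * real n + (4 * real n * 2 + real n)"
    proof (intro add_mono)
      show "(\<Sum>i<R. if i = 0 then 8 * y * real n else 0) \<le> 8 * y * real n"
        using y0 by (simp add: sum.delta)
      show "4 * real n * (\<Sum>i<R. (1 / 2) ^ i) \<le> 4 * real n * 2"
        by (rule mult_left_mono[OF sum_half_powers_le]) simp
      show "real R \<le> real n" using Rn by simp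
    qed
    finally show ?thesis by simp
  qed
  have "real T \<le> real \<Delta> * n / 2 + 5000 * y ^ 3 * n"
  proof -
    define w where "w = y ^ 3 * n"
    have nw: "1 \<le> w" "real n \<le> w" "y * n \<le> w" "y\<^sup>2 * n \<le> w"
    proof -
      show "real n \<le> w" unfolding w_def using y2(4) mult_right_mono[of 1 "y ^ 3" "real n"] by simp
      then show "1 \<le> w" using n by linarith
      show "y * n \<le> w" unfolding w_def using y2(5) by (rule mult_right_mono) simp
      show "y\<^sup>2 * n \<le> w" unfolding w_def using y2(3) by (rule mult_right_mono) simp
    qed
    have a: "real tA \<le> real \<Delta> * n / 2 + w / 2 + 1"
    proof -
      have "(1 + 1 / y) * (real \<Delta> * n / 2) = real \<Delta> * n / 2 + (real \<Delta> / y) * n / 2"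
        by (simp add: field_simps)
      then show ?thesis using tA(2) unfolding y\<Delta> w_def by (simp add: add_divide_distrib)
    qed
    have b: "real tB \<le> 4128 * w + 1" using tB(2) nw(4) by linarith
    have "2 * (2 * y\<^sup>2 + 1 + ln (1 / defect \<Delta> 0)) * n \<le> 2 * (2 * y\<^sup>2 + 1 + 20 * y) * n"
      using ln\<theta> by (intro mult_right_mono mult_left_mono) auto
    also have "\<dots> = 4 * (y\<^sup>2 * n) + 2 * n + 40 * (y * n)" by (simp add: algebra_simps)
    finally have c: "real tI \<le> 46 * w + 1" using tI(2) nw by linarith
    have d: "real (\<Sum>i<R. t i) \<le> 17 * w" using sum_t nw by linarith
    have "2 * ln (16 * real \<Delta>) * n \<le> 2 * (4 * y) * n"
      using ln16 by (intro mult_right_mono mult_left_mono) auto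
    then have e: "real t' \<le> 8 * w + 1" using t'(2) nw by linarith
    have "real T = real tA + (real tB + (real tI + (real (\<Sum>i<R. t i) + real t')))"
      unfolding T_def by (simp only: of_nat_add)
    also have "\<dots> \<le> real \<Delta> * n / 2 + 5000 * w" using a b c d e nw(1) by linarith
    finally show ?thesis by (simp add: w_def)
  qed
  then show ?thesis using f by blast
qed

section \<open>Strategies\<close>

definition process_error :: "nat \<Rightarrow> real" where
  "process_error n = exp (1 - n / 4) + exp (- real n) + 6 / n"

text \<open>
  The two growth conditions hold for all sufficiently large \<open>n\<close> and do not involve \<open>\<Delta>\<close>; uniformity in \<open>\<Delta>\<close>
  is what allows \<open>\<Delta>\<close> to depend on \<open>n\<close> in an arbitrary way.
\<close>
definition large :: "nat \<Rightarrow> bool" where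
  "large n \<longleftrightarrow> 8 \<le> n \<and> 4 * ln n * (24 * (2 * ln n)\<^sup>2 * exp (sqrt (2 * ln n))) \<le> n \<and> ln n * (81600 * ln n ^ 10) \<le> n"

lemma eventually_large: "eventually large sequentially"
proof -
  have "eventually (\<lambda>n. 4 * ln (real n) * (24 * (2 * ln (real n))\<^sup>2 * exp (sqrt (2 * ln (real n)))) \<le> n) sequentially"
    by real_asymp
  moreover have "eventually (\<lambda>n. ln (real n) * (81600 * ln (real n) ^ 10) \<le> n) sequentially"
    by real_asymp
  ultimately show ?thesis
    using eventually_ge_at_top[of 8] unfolding large_def by eventually_elim simp
qed

lemma process_error_tendsto: "process_error \<longlonglongrightarrow> 0"
  unfolding process_error_def by real_asymp

text \<open>
  For an edgeless graph every edge set is a copy; otherwise \<open>near_copy_reachable\<close> applies to the edge set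
  transported to \<open>{1..n}\<close>.
\<close>
lemma strategy_exists:
  assumes n: "1 \<le> n" and H: "simple_graph H" "card (verts H) = n" "max_degree H = \<Delta>"
  shows "\<exists>\<sigma>. valid_strategy n \<sigma> \<and> (large n \<longrightarrow>
     (\<forall>m. real \<Delta> * n / 2 + 5000 * sqrt (sqrt \<Delta>) ^ 3 * n \<le> real m \<longrightarrow>
        1 - process_error n \<le> measure_pmf.prob (tree_process n \<sigma> m) {G. contains_copy G H}))"
proof -
  have fin: "finite (verts H)" using H(1) by (simp add: simple_graph_def)
  then obtain g where g: "bij_betw g (verts H) {1..n}"
    using finite_same_card_bij[of "verts H" "{1..n}"] H(2) by auto
  have inj: "inj_on g (verts H)" using g by (rule bij_betw_imp_inj_on)
  have eH: "e \<subseteq> verts H" "card e = 2" if "e \<in> edges H" for e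
    using H(1) that by (auto simp: simple_graph_def)
  have fE: "finite (edges H)"
    by (rule finite_subset[of _ "Pow (verts H)"]) (use eH fin in auto)
  define D where "D = (`) g ` edges H"
  have D: "D \<subseteq> Kn n"
  proof
    fix e assume "e \<in> D"
    then obtain e' where e': "e' \<in> edges H" "e = g ` e'" by (auto simp: D_def)
    have "e \<subseteq> {1..n}" using e' eH(1)[OF e'(1)] bij_betw_imp_surj_on[OF g] by auto
    moreover have "card e = 2"
      using e' eH[OF e'(1)] card_image[OF inj_on_subset[OF inj]] by simp
    ultimately show "e \<in> Kn n" by (simp add: Kn_eq)
  qed
  have deg: "card {e \<in> D. v \<in> e} \<le> \<Delta>" for v
  proof (cases "v \<in> {1..n}")
    case True
    then obtain w where w: "w \<in> verts H" "v = g w"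
      using bij_betw_imp_surj_on[OF g] by blast
    have "{e \<in> D. v \<in> e} \<subseteq> (`) g ` {e \<in> edges H. w \<in> e}"
    proof
      fix e assume "e \<in> {e \<in> D. v \<in> e}"
      then obtain e' where e': "e' \<in> edges H" "e = g ` e'" "g w \<in> g ` e'" by (auto simp: D_def w)
      then have "w \<in> e'" using inj_on_image_mem_iff[OF inj w(1) eH(1)] by blast
      then show "e \<in> (`) g ` {e \<in> edges H. w \<in> e}" using e' by blast
    qed
    then have "card {e \<in> D. v \<in> e} \<le> card ((`) g ` {e \<in> edges H. w \<in> e})"
      using fE by (intro card_mono) auto
    also have "\<dots> \<le> vertex_degree H w"
      unfolding vertex_degree_def using fE by (intro card_image_le) auto
    also have "\<dots> \<le> \<Delta>"
      unfolding H(3)[symmetric] max_degree_def using fin w(1) by (intro Max_ge) auto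
    finally show ?thesis .
  next
    case False
    then have "{e \<in> D. v \<in> e} = {}" using D unfolding Kn_eq by blast
    then show ?thesis by (metis card.empty le0)
  qed
  have "\<exists>T. large n \<longrightarrow> real T \<le> real \<Delta> * n / 2 + 5000 * sqrt (sqrt \<Delta>) ^ 3 * n \<and>
     fail n (near_copy n D 0) T {} \<le> process_error n"
  proof (cases "\<Delta> = 0")
    case True
    have "2 * card D \<le> \<Delta> * n" using handshake_le[OF D deg] .
    then have "D = {}" using True finite_subset[OF D finite_Kn] by simp
    then have "{} \<in> near_copy n D 0"
      unfolding near_copy_def mem_Collect_eq
      by (intro exI[of _ id] exI[of _ "{}"]) (simp add: permutes_id)
    then have "fail n (near_copy n D 0) 0 {} \<le> process_error n"
      using fail_reached[of "{}" "near_copy n D 0" n 0] by (simp add: process_error_def add_nonneg_nonneg)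
    then show ?thesis using True by (intro exI[of _ 0]) auto
  next
    case False
    then have \<Delta>: "1 \<le> \<Delta>" by simp
    have "sqrt (sqrt \<Delta>) ^ 4 = (sqrt (sqrt \<Delta>) ^ 2) ^ 2" by (simp only: power_mult[symmetric]) simp
    then have y: "1 \<le> sqrt (sqrt \<Delta>)" "sqrt (sqrt \<Delta>) ^ 4 = \<Delta>" using \<Delta> by simp_all
    show ?thesis
    proof (cases "large n")
      case True
      then show ?thesis
        using near_copy_reachable[OF _ D deg \<Delta> y] unfolding large_def process_error_def by blast
    qed simp
  qed
  then obtain T where T: "large n \<Longrightarrow> real T \<le> real \<Delta> * n / 2 + 5000 * sqrt (sqrt \<Delta>) ^ 3 * n"
    "large n \<Longrightarrow> fail n (near_copy n D 0) T {} \<le> process_error n" by blast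
  define \<sigma> where "\<sigma> = best_strategy n (near_copy n D 0) T"
  have "1 - process_error n \<le> measure_pmf.prob (tree_process n \<sigma> m) {G. contains_copy G H}"
    if large: "large n" and m: "real \<Delta> * n / 2 + 5000 * sqrt (sqrt \<Delta>) ^ 3 * n \<le> real m" for m
  proof -
    define p where "p = replicate_pmf m (pmf_of_set (trees n))"
    define bad where "bad = {Ts. edges (built_graph n (play \<sigma> [] Ts)) \<notin> near_copy n D 0}"
    have "T \<le> m" using T(1)[OF large] m by simp
    then have "measure_pmf.prob p bad \<le> fail n (near_copy n D 0) T (edges (built_graph n []))"
      unfolding p_def bad_def \<sigma>_def using prob_best_strategy[of T "[]" m n "near_copy n D 0"] by simp
    also have "edges (built_graph n []) = {}" by (simp add: built_graph_def)
    finally have bad: "measure_pmf.prob p bad \<le> process_error n" using T(2)[OF large] by simp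
    have "- bad \<subseteq> {Ts. contains_copy (built_graph n (play \<sigma> [] Ts)) H}"
    proof
      fix Ts assume "Ts \<in> - bad"
      then have "edges (built_graph n (play \<sigma> [] Ts)) \<in> near_copy n D 0" by (simp add: bad_def)
      then have "contains_copy ({1..n}, edges (built_graph n (play \<sigma> [] Ts))) H"
        unfolding D_def by (rule contains_copy_if_near_copy[OF H(1) g])
      then show "Ts \<in> {Ts. contains_copy (built_graph n (play \<sigma> [] Ts)) H}"
        by (simp add: built_graph_def)
    qed
    then have "measure_pmf.prob p (- bad) \<le> measure_pmf.prob p {Ts. contains_copy (built_graph n (play \<sigma> [] Ts)) H}"
      by (intro measure_pmf.finite_measure_mono) auto
    moreover have "measure_pmf.prob p (- bad) = 1 - measure_pmf.prob p bad"
      using measure_pmf.prob_compl[of bad p] by (simp add: Compl_eq_Diff_UNIV)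
    moreover have "measure_pmf.prob (tree_process n \<sigma> m) {G. contains_copy G H} =
        measure_pmf.prob p {Ts. contains_copy (built_graph n (play \<sigma> [] Ts)) H}"
      by (simp add: tree_process_def p_def vimage_def)
    ultimately show ?thesis using bad by linarith
  qed
  then show ?thesis
    using valid_best_strategy[of n "near_copy n D 0" T] unfolding \<sigma>_def by blast
qed

section \<open>A Poisson number of rounds\<close>

text \<open>
  Obtained from the series for the first two factorial moments.
\<close>
lemma poisson_variance_sums:
  fixes x :: real
  shows "(\<lambda>t. x ^ t / fact t * exp (- x) * (real t - x)\<^sup>2) sums x"
proof -
  have e: "(\<lambda>t. x ^ t / fact t) sums exp x"
    using exp_converges[of x] by (simp add: scaleR_conv_of_real divide_inverse mult.commute)
  have "real (Suc t) * (x ^ Suc t / fact (Suc t)) = x * (x ^ t / fact t)" for t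
    by (simp del: of_nat_Suc add: field_simps)
  note S = this
  have m1: "(\<lambda>t. real t * (x ^ t / fact t)) sums (x * exp x)"
    using sums_Suc_iff[of "\<lambda>t. real t * (x ^ t / fact t)"] sums_mult[OF e, of x] unfolding S by simp
  have eq: "real t * (real (Suc t) * (x ^ Suc t / fact (Suc t))) = x * (real t * (x ^ t / fact t))" for t
    unfolding S by simp
  have "(\<lambda>t. real t * (real (Suc t) * (x ^ Suc t / fact (Suc t)))) sums (x * (x * exp x))"
    unfolding eq by (rule sums_mult[OF m1])
  then have m2: "(\<lambda>t. (real t - 1) * (real t * (x ^ t / fact t))) sums (x * (x * exp x))"
    using sums_Suc_iff[of "\<lambda>t. (real t - 1) * (real t * (x ^ t / fact t))"] by simp
  have "(\<lambda>t. exp (- x) * ((real t - 1) * (real t * (x ^ t / fact t)) + ((1 - 2 * x) * (real t * (x ^ t / fact t)) + x\<^sup>2 * (x ^ t / fact t))))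
      sums (exp (- x) * (x * (x * exp x) + ((1 - 2 * x) * (x * exp x) + x\<^sup>2 * exp x)))"
    by (intro sums_mult sums_add m2 m1 e)
  moreover have "exp (- x) * (x * (x * exp x) + ((1 - 2 * x) * (x * exp x) + x\<^sup>2 * exp x)) = (exp (- x) * exp x) * x"
    by (simp add: algebra_simps power2_eq_square)
  moreover have "exp (- x) * exp x = 1" by (simp add: exp_minus)
  moreover have "(\<lambda>t. exp (- x) * ((real t - 1) * (real t * (x ^ t / fact t)) + ((1 - 2 * x) * (real t * (x ^ t / fact t)) + x\<^sup>2 * (x ^ t / fact t)))) =
      (\<lambda>t. x ^ t / fact t * exp (- x) * (real t - x)\<^sup>2)"
  proof
    fix t
    define a where "a = x ^ t / fact t"
    show "exp (- x) * ((real t - 1) * (real t * (x ^ t / fact t)) + ((1 - 2 * x) * (real t * (x ^ t / fact t)) + x\<^sup>2 * (x ^ t / fact t))) =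
        x ^ t / fact t * exp (- x) * (real t - x)\<^sup>2"
      unfolding a_def[symmetric] by (simp add: algebra_simps power2_eq_square)
  qed
  ultimately show ?thesis by simp
qed

lemma poisson_lower_tail:
  assumes "0 < x" "real T < x"
  shows "measure_pmf.prob (poisson_pmf x) {..<T} \<le> x / (x - T)\<^sup>2"
proof -
  have "measure_pmf.prob (poisson_pmf x) {..<T} * (x - T)\<^sup>2 = (\<Sum>t<T. pmf (poisson_pmf x) t * (x - T)\<^sup>2)"
    by (simp add: measure_measure_pmf_finite sum_distrib_right)
  also have "\<dots> \<le> (\<Sum>t<T. x ^ t / fact t * exp (- x) * (real t - x)\<^sup>2)"
  proof (rule sum_mono)
    fix t assume "t \<in> {..<T}"
    then have "(x - T)\<^sup>2 \<le> (x - t)\<^sup>2" using assms by (intro power_mono) auto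
    then have "(x - T)\<^sup>2 \<le> (real t - x)\<^sup>2" by (simp add: power2_commute)
    then show "pmf (poisson_pmf x) t * (x - T)\<^sup>2 \<le> x ^ t / fact t * exp (- x) * (real t - x)\<^sup>2"
      using mult_left_mono[of "(x - T)\<^sup>2" "(real t - x)\<^sup>2" "x ^ t / fact t * exp (- x)"] assms(1) by simp
  qed
  also have "\<dots> \<le> (\<Sum>t. x ^ t / fact t * exp (- x) * (real t - x)\<^sup>2)"
    using poisson_variance_sums[of x] assms(1) by (intro sum_le_suminf) (auto simp: sums_iff)
  also have "\<dots> = x" using poisson_variance_sums[of x] by (simp add: sums_iff)
  finally show ?thesis using assms by (simp add: le_divide_eq)
qed

lemma tree_process_random_prob_ge:
  assumes "\<And>m. T \<le> m \<Longrightarrow> 1 - \<epsilon> \<le> measure_pmf.prob (tree_process n \<sigma> m) A" "0 \<le> \<epsilon>"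
  shows "1 - \<epsilon> - measure_pmf.prob N {..<T} \<le> measure_pmf.prob (tree_process_random n \<sigma> N) A"
proof -
  have int: "integrable (measure_pmf N) (\<lambda>m. 1 - \<epsilon> - indicator {..<T} m)"
    by (rule measure_pmf.integrable_const_bound[where B = "2 + \<epsilon>"])
      (use assms(2) in \<open>auto simp: indicator_def\<close>)
  have "1 - \<epsilon> - measure_pmf.prob N {..<T} = measure_pmf.expectation N (\<lambda>m. 1 - \<epsilon> - indicator {..<T} m)"
  proof -
    have "integrable (measure_pmf N) (indicator {..<T} :: nat \<Rightarrow> real)"
      by (rule measure_pmf.integrable_const_bound[where B = 1]) (auto simp: indicator_def)
    then show ?thesis by (subst Bochner_Integration.integral_diff) auto
  qed
  also have "\<dots> \<le> measure_pmf.expectation N (\<lambda>m. measure_pmf.prob (tree_process n \<sigma> m) A)"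
  proof (rule integral_mono[OF int])
    show "integrable (measure_pmf N) (\<lambda>m. measure_pmf.prob (tree_process n \<sigma> m) A)"
      by (rule measure_pmf.integrable_const_bound[where B = 1]) auto
    fix m
    have "0 \<le> measure_pmf.prob (tree_process n \<sigma> m) A" by simp
    then show "1 - \<epsilon> - indicator {..<T} m \<le> measure_pmf.prob (tree_process n \<sigma> m) A"
      using assms(1)[of m] assms(2) by (cases "T \<le> m") (auto simp: indicator_def intro: order_trans[of _ 0])
  qed
  also have "\<dots> = measure_pmf.prob (tree_process_random n \<sigma> N) A"
    unfolding tree_process_random_def by (rule prob_bind_pmf[symmetric])
  finally show ?thesis .
qed

section \<open>Asymptotics\<close>

text \<open>
  The number 12000 leaves \<open>1000 * \<Delta> powr (3 / 4) * n\<close> rounds beyond those that the strategy needs, enough to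
  cover the fluctuations of the Poisson distribution.
\<close>
definition overhead :: "nat \<Rightarrow> real" where
  "overhead d = 12000 / sqrt (sqrt d)"

lemma overhead_nonneg: "0 \<le> overhead d"
  by (simp add: overhead_def)

lemma overhead_tendsto: "overhead \<longlonglongrightarrow> 0"
  unfolding overhead_def by real_asymp

lemma rounds_eq:
  "(1 + overhead \<Delta>) * (real \<Delta> * real n / 2) = real \<Delta> * n / 2 + 6000 * sqrt (sqrt \<Delta>) ^ 3 * n"
proof (cases "\<Delta> = 0")
  case False
  define y where "y = sqrt (sqrt (real \<Delta>))"
  have y0: "0 < y" using False by (simp add: y_def)
  have "y ^ 4 = (y ^ 2) ^ 2" by (simp only: power_mult[symmetric]) simp
  then have "real \<Delta> = y ^ 4" by (simp add: y_def)
  then have "12000 / y * (real \<Delta> * real n / 2) = 6000 * y ^ 3 * n"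
    using y0 by (simp add: power_numeral_reduce)
  then show ?thesis
    unfolding overhead_def y_def[symmetric] by (simp add: algebra_simps)
qed simp

text \<open>
  The rate \<open>r\<close> exceeds the number of required rounds by at least \<open>999 * w\<close> with \<open>w = \<Delta> powr (3 / 4) * n\<close>,
  while the variance \<open>r\<close> is at most of the order of \<open>w\<^sup>2 / n\<close>.
\<close>
lemma poisson_enough_rounds:
  assumes n: "1 \<le> n"
  shows "measure_pmf.prob (Po ((1 + overhead \<Delta>) * (real \<Delta> * real n / 2)))
    {..<nat \<lceil>real \<Delta> * n / 2 + 5000 * sqrt (sqrt \<Delta>) ^ 3 * n\<rceil>} \<le> 1 / n"
proof (cases "\<Delta> = 0")
  case True
  then show ?thesis by simp
next
  case False
  define y where "y = sqrt (sqrt (real \<Delta>))"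
  define r where "r = real \<Delta> * n / 2 + 6000 * y ^ 3 * n"
  define T where "T = nat \<lceil>real \<Delta> * n / 2 + 5000 * y ^ 3 * n\<rceil>"
  define w where "w = y ^ 3 * n"
  have "1 \<le> sqrt (real \<Delta>)" using False by simp
  then have y: "1 \<le> y" by (simp add: y_def)
  have "y ^ 4 = (y ^ 2) ^ 2" by (simp only: power_mult[symmetric]) simp
  then have \<Delta>: "real \<Delta> = y ^ 4" by (simp add: y_def)
  have y3: "1 \<le> y ^ 3" "y ^ 3 \<le> y ^ 4" "y ^ 4 \<le> y ^ 6"
    using y power_increasing[of 3 4 y] power_increasing[of 4 6 y] one_le_power[of y 3] by simp_all
  have wn: "n \<le> w" unfolding w_def using mult_right_mono[OF y3(1), of "real n"] by simp
  then have w1: "1 \<le> w" using n by linarith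
  have T: "T \<le> real \<Delta> * n / 2 + 5000 * w + 1"
  proof -
    have "0 \<le> real \<Delta> * n / 2 + 5000 * y ^ 3 * n" using y by simp
    from nat_ceiling_bounds(2)[OF this] show ?thesis
      unfolding T_def w_def by (simp only: mult.assoc)
  qed
  have r: "r = real \<Delta> * n / 2 + 6000 * w" by (simp add: r_def w_def)
  have gap: "999 * w \<le> r - T" using T r w1 by linarith
  have "0 \<le> real \<Delta> * n / 2" by simp
  then have r0: "0 < r" using r w1 by linarith
  have "measure_pmf.prob (poisson_pmf r) {..<T} \<le> r / (r - T)\<^sup>2"
    using r0 gap w1 by (intro poisson_lower_tail) linarith+
  also have "\<dots> \<le> (6001 * (y ^ 6 * n)) / (999 * w)\<^sup>2"
  proof (rule frac_le)
    have a: "real \<Delta> * n \<le> y ^ 6 * n" "w \<le> y ^ 6 * n"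
      unfolding \<Delta> w_def using y3 by (intro mult_right_mono; linarith)+
    then show "r \<le> 6001 * (y ^ 6 * n)" using r w1 by linarith
    show "(999 * w)\<^sup>2 \<le> (r - T)\<^sup>2" using gap w1 by (intro power_mono) auto
    show "0 < (999 * w)\<^sup>2" using w1 by simp
    show "0 \<le> 6001 * (y ^ 6 * n)" using y by simp
  qed
  also have "\<dots> = 6001 / (999\<^sup>2 * n)"
  proof -
    have "(999 * w)\<^sup>2 = 999\<^sup>2 * n * (y ^ 6 * n)"
      by (simp add: w_def power_mult_distrib power_mult[symmetric] power2_eq_square)
    moreover have "y ^ 6 * n \<noteq> 0" using y n by simp
    ultimately show ?thesis by simp
  qed
  also have "\<dots> \<le> 1 / n" using n by (simp add: field_simps)
  finally show ?thesis
    unfolding rounds_eq y_def[symmetric] using r0 by (simp add: Po_def r_def T_def)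
qed

lemma tendsto_1_lower_bound:
  assumes "\<epsilon> \<longlonglongrightarrow> 0" "eventually (\<lambda>n. 1 - \<epsilon> n \<le> p n) sequentially" "\<And>n. p n \<le> (1 :: real)"
  shows "p \<longlonglongrightarrow> 1"
proof (rule tendsto_sandwich[OF assms(2)])
  show "eventually (\<lambda>n. p n \<le> 1) sequentially" using assms(3) by simp
  show "(\<lambda>n. 1 - \<epsilon> n) \<longlonglongrightarrow> 1" using tendsto_diff[OF tendsto_const assms(1), of 1] by simp
qed simp

theorem theorem1p3:
  shows
    "(\<exists>f :: nat \<Rightarrow> real. (\<forall>d. f d \<ge> 0) \<and> f \<longlonglongrightarrow> 0 \<and>
       (\<forall>(\<Delta> :: nat \<Rightarrow> nat) (H :: nat \<Rightarrow> nat graph).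
          (\<forall>n\<ge>1. simple_graph (H n) \<and> card (verts (H n)) = n \<and> max_degree (H n) = \<Delta> n) \<longrightarrow>
          (\<exists>\<sigma> :: nat \<Rightarrow> strategy. (\<forall>n\<ge>1. valid_strategy n (\<sigma> n)) \<and>
             (\<lambda>n. measure_pmf.prob
                (tree_process n (\<sigma> n) (nat \<lceil>(1 + f (\<Delta> n)) * (real (\<Delta> n) * real n / 2)\<rceil>))
                {G. contains_copy G (H n)}) \<longlonglongrightarrow> 1))) \<and>
     (\<exists>f :: nat \<Rightarrow> real. (\<forall>d. f d \<ge> 0) \<and> f \<longlonglongrightarrow> 0 \<and>
       (\<forall>(\<Delta> :: nat \<Rightarrow> nat) (H :: nat \<Rightarrow> nat graph).
          (\<forall>n\<ge>1. simple_graph (H n) \<and> card (verts (H n)) = n \<and> max_degree (H n) = \<Delta> n) \<longrightarrow>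
          (\<exists>\<sigma> :: nat \<Rightarrow> strategy. (\<forall>n\<ge>1. valid_strategy n (\<sigma> n)) \<and>
             (\<lambda>n. measure_pmf.prob
                (tree_process_random n (\<sigma> n) (Po ((1 + f (\<Delta> n)) * (real (\<Delta> n) * real n / 2))))
                {G. contains_copy G (H n)}) \<longlonglongrightarrow> 1)))"
proof -
  define p\<^sub>1 where "p\<^sub>1 = (\<lambda>\<Delta> H \<sigma> n. measure_pmf.prob
    (tree_process n (\<sigma> n) (nat \<lceil>(1 + overhead (\<Delta> n)) * (real (\<Delta> n) * real n / 2)\<rceil>))
    {G. contains_copy G (H n :: nat graph)})"
  define p\<^sub>2 where "p\<^sub>2 = (\<lambda>\<Delta> H \<sigma> n. measure_pmf.prob
    (tree_process_random n (\<sigma> n) (Po ((1 + overhead (\<Delta> n)) * (real (\<Delta> n) * real n / 2))))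
    {G. contains_copy G (H n :: nat graph)})"
  have main: "\<exists>\<sigma>. (\<forall>n\<ge>1. valid_strategy n (\<sigma> n)) \<and> p\<^sub>1 \<Delta> H \<sigma> \<longlonglongrightarrow> 1 \<and> p\<^sub>2 \<Delta> H \<sigma> \<longlonglongrightarrow> 1"
    if H: "\<forall>n\<ge>1. simple_graph (H n) \<and> card (verts (H n)) = n \<and> max_degree (H n) = \<Delta> n"
    for \<Delta> :: "nat \<Rightarrow> nat" and H :: "nat \<Rightarrow> nat graph"
  proof -
    define need where "need = (\<lambda>n. real (\<Delta> n) * n / 2 + 5000 * sqrt (sqrt (\<Delta> n)) ^ 3 * n)"
    define good where "good = (\<lambda>n \<sigma>. valid_strategy n \<sigma> \<and> (large n \<longrightarrow>
      (\<forall>m. need n \<le> real m \<longrightarrow> 1 - process_error n \<le> measure_pmf.prob (tree_process n \<sigma> m) {G. contains_copy G (H n)})))"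
    have "\<forall>n. \<exists>\<sigma>. 1 \<le> n \<longrightarrow> good n \<sigma>"
      using strategy_exists H unfolding good_def need_def by blast
    then obtain \<sigma> where \<sigma>: "\<And>n. 1 \<le> n \<Longrightarrow> good n (\<sigma> n)" by metis
    have \<sigma>_prob: "1 - process_error n \<le> measure_pmf.prob (tree_process n (\<sigma> n) m) {G. contains_copy G (H n)}"
      if "large n" "need n \<le> real m" for n m
      using \<sigma>[of n] that unfolding good_def large_def by simp
    have nonneg: "0 \<le> need n" for n unfolding need_def by simp
    have more: "need n \<le> (1 + overhead (\<Delta> n)) * (real (\<Delta> n) * real n / 2)" for n
      unfolding rounds_eq need_def by (intro add_left_mono mult_right_mono) auto
    have "p\<^sub>1 \<Delta> H \<sigma> \<longlonglongrightarrow> 1"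
    proof (rule tendsto_1_lower_bound[OF process_error_tendsto])
      show "eventually (\<lambda>n. 1 - process_error n \<le> p\<^sub>1 \<Delta> H \<sigma> n) sequentially"
        using eventually_large
      proof eventually_elim
        case (elim n)
        have "need n \<le> real (nat \<lceil>(1 + overhead (\<Delta> n)) * (real (\<Delta> n) * real n / 2)\<rceil>)"
          using more[of n] nonneg[of n] nat_ceiling_bounds(1) by (meson order_trans)
        then show ?case unfolding p\<^sub>1_def by (rule \<sigma>_prob[OF elim])
      qed
    qed (simp add: p\<^sub>1_def)
    moreover have "p\<^sub>2 \<Delta> H \<sigma> \<longlonglongrightarrow> 1"
    proof (rule tendsto_1_lower_bound[where \<epsilon> = "\<lambda>n. process_error n + 1 / n"])
      show "(\<lambda>n. process_error n + 1 / real n) \<longlonglongrightarrow> 0"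
        using tendsto_add[OF process_error_tendsto lim_1_over_n] by simp
      show "eventually (\<lambda>n. 1 - (process_error n + 1 / n) \<le> p\<^sub>2 \<Delta> H \<sigma> n) sequentially"
        using eventually_large
      proof eventually_elim
        case (elim n)
        let ?N = "Po ((1 + overhead (\<Delta> n)) * (real (\<Delta> n) * real n / 2))"
        have n: "1 \<le> n" using elim by (simp add: large_def)
        have "1 - process_error n - measure_pmf.prob ?N {..<nat \<lceil>need n\<rceil>} \<le> p\<^sub>2 \<Delta> H \<sigma> n"
          unfolding p\<^sub>2_def
        proof (rule tree_process_random_prob_ge)
          fix m assume "nat \<lceil>need n\<rceil> \<le> m"
          then have "need n \<le> real m" by linarith
          then show "1 - process_error n \<le> measure_pmf.prob (tree_process n (\<sigma> n) m) {G. contains_copy G (H n)}"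
            by (rule \<sigma>_prob[OF elim])
        qed (simp add: process_error_def add_nonneg_nonneg)
        moreover have "measure_pmf.prob ?N {..<nat \<lceil>need n\<rceil>} \<le> 1 / n"
          unfolding need_def using poisson_enough_rounds[OF n, of "\<Delta> n"] by simp
        ultimately show ?case by linarith
      qed
    qed (simp add: p\<^sub>2_def)
    ultimately show ?thesis using \<sigma> unfolding good_def by blast
  qed
  show ?thesis
  proof (intro conjI exI[of _ overhead] allI impI)
    fix \<Delta> :: "nat \<Rightarrow> nat" and H :: "nat \<Rightarrow> nat graph"
    assume H: "\<forall>n\<ge>1. simple_graph (H n) \<and> card (verts (H n)) = n \<and> max_degree (H n) = \<Delta> n"
    from main[OF H] obtain \<sigma> where \<sigma>: "\<forall>n\<ge>1. valid_strategy n (\<sigma> n)" "p\<^sub>1 \<Delta> H \<sigma> \<longlonglongrightarrow> 1" "p\<^sub>2 \<Delta> H \<sigma> \<longlonglongrightarrow> 1"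
      by blast
    show "\<exists>\<sigma> :: nat \<Rightarrow> strategy. (\<forall>n\<ge>1. valid_strategy n (\<sigma> n)) \<and>
        (\<lambda>n. measure_pmf.prob
          (tree_process n (\<sigma> n) (nat \<lceil>(1 + overhead (\<Delta> n)) * (real (\<Delta> n) * real n / 2)\<rceil>))
          {G. contains_copy G (H n)}) \<longlonglongrightarrow> 1"
      using \<sigma>(1,2) unfolding p\<^sub>1_def by (intro exI[of _ \<sigma>] conjI)
    show "\<exists>\<sigma> :: nat \<Rightarrow> strategy. (\<forall>n\<ge>1. valid_strategy n (\<sigma> n)) \<and>
        (\<lambda>n. measure_pmf.prob
          (tree_process_random n (\<sigma> n) (Po ((1 + overhead (\<Delta> n)) * (real (\<Delta> n) * real n / 2))))
          {G. contains_copy G (H n)}) \<longlonglongrightarrow> 1"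
      using \<sigma>(1,3) unfolding p\<^sub>2_def by (intro exI[of _ \<sigma>] conjI)
  qed (use overhead_nonneg overhead_tendsto in simp_all)
qed

end
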